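(* Assume that there is an oracle for evaluating bisubmodular functions. Then there is an implementation of the reverse search which, given (by this oracle) a bisubmodular function $f:3^N\to\mathbb{R}$ with $f(\emptyset,\emptyset)=0$ on a ground set $N=\{1,\dots,n\}$, enumerates all the vertices of the bisubmodular polyhedron ${\rm P}_*(f)$ with time complexity $\mathcal{O}(n^4|V|)$ and space complexity $\mathcal{O}(n^2)$, where $V$ is the set of vertices (extreme points) of ${\rm P}_*(f)$.
   Context: Let $N=\{1,\dots,n\}$ and $3^N=\{(X,Y)\mid X,Y\subseteq N,\ X\cap Y=\emptyset\}$. For $(X_1,Y_1),(X_2,Y_2)\in 3^N$ put $(X_1,Y_1)\sqcup(X_2,Y_2)=((X_1\cup X_2)\setminus(Y_1\cup Y_2),\,(Y_1\cup Y_2)\setminus(X_1\cup X_2))$ and $(X_1,Y_1)\sqcap(X_2,Y_2)=(X_1\cap X_2,\,Y_1\cap Y_2)$. A function $f:3^N\to\mathbb{R}$ is bisubmodular if $f(X_1,Y_1)+f(X_2,Y_2)\ge f((X_1,Y_1)\sqcup(X_2,Y_2))+f((X_1,Y_1)\sqcap(X_2,Y_2))$ for all $(X_1,Y_1),(X_2,Y_2)\in 3^N$. For such $f$ with $f(\emptyset,\emptyset)=0$, the bisubmodular polyhedron is ${\rm P}_*(f)=\{x\in\mathbb{R}^N\mid x(X)-x(Y)\le f(X,Y)\ \ \forall (X,Y)\in 3^N\}$, where $x(X)=\sum_{i\in X}x(i)$ and $x(\emptyset)=0$; it is nonempty and bounded. The oracle returns $f(X,Y)$ for a queried $(X,Y)\in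 3^N$; each oracle call and each elementary arithmetic operation or comparison on real numbers counts as one unit of time, and storing one number counts as one unit of space. The vertices are reported one at a time; the output is not counted in the working space. Reverse search (Avis and Fukuda): let $G_R=(V_R,E_R)$ be a graph, $s\in V_R$, and let $g:V_R\setminus\{s\}\to V_R$ be a local search function, i.e. $\{v,g(v)\}\in E_R$ for all $v\ne s$ and the arcs $(v,g(v))$, $v\in V_R\setminus\{s\}$, form a directed spanning tree of $G_R$ with unique sink $s$. The reverse search starts from $s$, traverses this tree by depth-first search (moving from the current vertex $v$ to a neighbour $u$ of $v$ in $G_R$ whenever $g(u)=v$, and backtracking from $v$ to $g(v)$ when all neighbours of $v$ have been examined), and outputs every vertex of $G_R$ when it is first reached. Here $V_R=V$, and $E_R$ consists of the pairs of adjacent vertices (edges) of ${\rm P}_*(f)$. *)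

theory Defs
  imports "HOL-Analysis.Analysis" "HOL-Library.Function_Algebras"
begin

section \<open>Real vectors indexed by an initial segment of the natural numbers\<close>

text \<open>The dimension n varies inside the statement (one program serves all n), so it cannot be
  a type.  The space of real vectors indexed by {1..n} is represented by the functions from nat to
  real that vanish outside {1..n}.  With pointwise operations the function type is a real vector
  space, which makes the library's faces and extreme points available.\<close>

instantiation "fun" :: (type, real_vector) real_vector
begin

definition scaleR_fun :: "real \<Rightarrow> ('a \<Rightarrow> 'b) \<Rightarrow> 'a \<Rightarrow> 'b" where
  "scaleR_fun c x = (\<lambda>i. c *\<^sub>R x i)"

instance
  by standard (auto simp: scaleR_fun_def fun_eq_iff scaleR_add_left scaleR_add_right)

end


section \<open>Bisubmodular polyhedra\<close>

type_synonym signed_set = "nat set \<times> nat set"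

definition signed_sets :: "nat \<Rightarrow> signed_set set" where
  "signed_sets n = {(X, Y). X \<subseteq> {1..n} \<and> Y \<subseteq> {1..n} \<and> X \<inter> Y = {}}"

definition sjoin :: "signed_set \<Rightarrow> signed_set \<Rightarrow> signed_set" where
  "sjoin A B = ((fst A \<union> fst B) - (snd A \<union> snd B), (snd A \<union> snd B) - (fst A \<union> fst B))"

definition smeet :: "signed_set \<Rightarrow> signed_set \<Rightarrow> signed_set" where
  "smeet A B = (fst A \<inter> fst B, snd A \<inter> snd B)"

text \<open>Values of f outside \<open>signed_sets n\<close> are irrelevant throughout.\<close>

definition bisubmodular :: "nat \<Rightarrow> (signed_set \<Rightarrow> real) \<Rightarrow> bool" where
  "bisubmodular n f \<longleftrightarrow>
     (\<forall>A \<in> signed_sets n. \<forall>B \<in> signed_sets n. f A + f B \<ge> f (sjoin A B) + f (smeet A B))"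

definition bisub_polyhedron :: "nat \<Rightarrow> (signed_set \<Rightarrow> real) \<Rightarrow> (nat \<Rightarrow> real) set" where
  "bisub_polyhedron n f =
     {x. (\<forall>i. i \<notin> {1..n} \<longrightarrow> x i = 0) \<and>
         (\<forall>(X, Y) \<in> signed_sets n. (\<Sum>i\<in>X. x i) - (\<Sum>i\<in>Y. x i) \<le> f (X, Y))}"

definition vertices :: "'a::real_vector set \<Rightarrow> 'a set" where
  "vertices P = {x. x extreme_point_of P}"

text \<open>The library's \<open>edge_of\<close> needs a Euclidean type because of \<open>aff_dim\<close>; the following is the
  same notion, the affine dimension being 1 when the affine hull is a line.\<close>

definition is_edge :: "'a::real_vector set \<Rightarrow> 'a set \<Rightarrow> bool" where
  "is_edge F P \<longleftrightarrow> F face_of P \<and> (\<exists>a b. a \<noteq> b \<and> affine hull F = affine hull {a, b})"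

definition adjacent_pairs :: "'a::real_vector set \<Rightarrow> 'a set set" where
  "adjacent_pairs P = {{u, v} | u v. u \<in> vertices P \<and> v \<in> vertices P \<and> u \<noteq> v \<and>
                                     (\<exists>F. is_edge F P \<and> u \<in> F \<and> v \<in> F)}"


section \<open>Reverse search\<close>

text \<open>A spanning tree directed towards its sink s: s has no outgoing arc, every other
  vertex has exactly one, and s is reachable from everywhere.\<close>

definition directed_spanning_tree :: "'v set \<Rightarrow> 'v set set \<Rightarrow> ('v \<times> 'v) set \<Rightarrow> 'v \<Rightarrow> bool" where
  "directed_spanning_tree V E A s \<longleftrightarrow>
     s \<in> V \<and> A \<subseteq> V \<times> V \<and> (\<forall>(v, w) \<in> A. {v, w} \<in> E) \<and>
     (\<forall>w. (s, w) \<notin> A) \<and> (\<forall>v \<in> V - {s}. \<exists>!w. (v, w) \<in> A) \<and>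
     (\<forall>v \<in> V. (v, s) \<in> A\<^sup>*)"

text \<open>The value g s is irrelevant, g being defined on V - {s} only.\<close>

definition local_search_function ::
    "'v set \<Rightarrow> 'v set set \<Rightarrow> 'v \<Rightarrow> ('v \<Rightarrow> 'v) \<Rightarrow> bool" where
  "local_search_function V E s g \<longleftrightarrow>
     (\<forall>v \<in> V - {s}. g v \<in> V \<and> {v, g v} \<in> E) \<and>
     directed_spanning_tree V E {(v, g v) | v. v \<in> V - {s}} s"

text \<open>For each vertex, a list of its neighbours in the order in which they are examined.\<close>

definition neighbour_lists :: "'v set \<Rightarrow> 'v set set \<Rightarrow> ('v \<Rightarrow> 'v list) \<Rightarrow> bool" where
  "neighbour_lists V E adj \<longleftrightarrow>
     (\<forall>v \<in> V. distinct (adj v) \<and> set (adj v) = {u \<in> V. {v, u} \<in> E})"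

datatype 'v event = Move 'v | Report 'v

text \<open>\<open>rs_from adj s g v j tr\<close>: a reverse search that stands at v and has examined the first j
  neighbours of v produces the events tr until it stops, where \<open>Move u\<close> says that u becomes the
  current vertex and \<open>Report u\<close> that u is output.\<close>

inductive rs_from ::
    "('v \<Rightarrow> 'v list) \<Rightarrow> 'v \<Rightarrow> ('v \<Rightarrow> 'v) \<Rightarrow> 'v \<Rightarrow> nat \<Rightarrow> 'v event list \<Rightarrow> bool"
  for adj :: "'v \<Rightarrow> 'v list" and s :: 'v and g :: "'v \<Rightarrow> 'v"
where
  rs_reject:
    "\<lbrakk> j < length (adj v); adj v ! j = u; u = s \<or> g u \<noteq> v; rs_from adj s g v (Suc j) tr \<rbrakk>
     \<Longrightarrow> rs_from adj s g v j tr"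
| rs_forward:
    "\<lbrakk> j < length (adj v); adj v ! j = u; u \<noteq> s; g u = v; rs_from adj s g u 0 tr \<rbrakk>
     \<Longrightarrow> rs_from adj s g v j (Move u # Report u # tr)"
| rs_backtrack:
    "\<lbrakk> v \<noteq> s; g v = w; k < length (adj w); adj w ! k = v; rs_from adj s g w (Suc k) tr \<rbrakk>
     \<Longrightarrow> rs_from adj s g v (length (adj v)) (Move w # tr)"
| rs_stop:
    "rs_from adj s g s (length (adj s)) []"

definition reverse_search ::
    "('v \<Rightarrow> 'v list) \<Rightarrow> 'v \<Rightarrow> ('v \<Rightarrow> 'v) \<Rightarrow> 'v event list \<Rightarrow> bool" where
  "reverse_search adj s g tr \<longleftrightarrow>
     (\<exists>tr'. tr = Move s # Report s # tr' \<and> rs_from adj s g s 0 tr')"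

fun reported :: "'v event list \<Rightarrow> 'v list" where
  "reported [] = []"
| "reported (Report x # tr) = x # reported tr"
| "reported (Move x # tr) = reported tr"


section \<open>A real random access machine with an oracle\<close>

text \<open>The memory is an array of real numbers with indirect addressing.  A number can be
  used as an address only if it is a natural number; there is no rounding operation.  A program is a
  single finite syntactic object, with integer constants only, that does not depend on n or f.\<close>

type_synonym memory = "nat \<Rightarrow> real"

datatype exp =
    Num int
  | Cell exp
  | Add exp exp
  | Sub exp exp
  | Mul exp exp
  | Div exp exp

datatype test =
    Less exp exp
  | Eq exp exp
  | Not test
  | And test test

text \<open>\<open>Query a b\<close> stores in cell a the value of the oracle at the signed set encoded in the cells
  b+1, ..., b+n (1, -1 or 0 in cell b+i if i belongs to the first set, to the second set or to
  neither).  \<open>ReportVec b\<close> outputs the vector stored in the cells b+1, ..., b+n.  \<open>MoveTo b\<close>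
  likewise announces this vector as the current vertex of the traversal; it makes the walk
  observable and has no effect on the memory.\<close>

datatype com =
    Skip
  | Assign exp exp
  | Query exp exp
  | ReportVec exp
  | MoveTo exp
  | Seq com com
  | If test com com
  | While test com

primrec ev :: "memory \<Rightarrow> exp \<Rightarrow> real" where
  "ev M (Num k) = of_int k"
| "ev M (Cell a) = M (nat \<lfloor>ev M a\<rfloor>)"
| "ev M (Add a b) = ev M a + ev M b"
| "ev M (Sub a b) = ev M a - ev M b"
| "ev M (Mul a b) = ev M a * ev M b"
| "ev M (Div a b) = ev M a / ev M b"

text \<open>In a memory of m cells, numbered from 0, the addresses are 0, ..., m - 1.\<close>

definition is_address :: "nat \<Rightarrow> real \<Rightarrow> bool" where
  "is_address m r \<longleftrightarrow> (\<exists>k<m. r = real k)"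

definition is_block :: "nat \<Rightarrow> nat \<Rightarrow> real \<Rightarrow> bool" where
  "is_block n m r \<longleftrightarrow> (\<exists>k. r = real k \<and> k + n < m)"

text \<open>Evaluation is legal if all addresses lie in the memory and no divisor is 0; an
  illegal evaluation blocks the execution.\<close>

primrec legal :: "nat \<Rightarrow> memory \<Rightarrow> exp \<Rightarrow> bool" where
  "legal m M (Num k) \<longleftrightarrow> True"
| "legal m M (Cell a) \<longleftrightarrow> legal m M a \<and> is_address m (ev M a)"
| "legal m M (Add a b) \<longleftrightarrow> legal m M a \<and> legal m M b"
| "legal m M (Sub a b) \<longleftrightarrow> legal m M a \<and> legal m M b"
| "legal m M (Mul a b) \<longleftrightarrow> legal m M a \<and> legal m M b"
| "legal m M (Div a b) \<longleftrightarrow> legal m M a \<and> legal m M b \<and> ev M b \<noteq> 0"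

primrec holds :: "memory \<Rightarrow> test \<Rightarrow> bool" where
  "holds M (Less a b) \<longleftrightarrow> ev M a < ev M b"
| "holds M (Eq a b) \<longleftrightarrow> ev M a = ev M b"
| "holds M (Not t) \<longleftrightarrow> \<not> holds M t"
| "holds M (And t t') \<longleftrightarrow> holds M t \<and> holds M t'"

primrec legal_test :: "nat \<Rightarrow> memory \<Rightarrow> test \<Rightarrow> bool" where
  "legal_test m M (Less a b) \<longleftrightarrow> legal m M a \<and> legal m M b"
| "legal_test m M (Eq a b) \<longleftrightarrow> legal m M a \<and> legal m M b"
| "legal_test m M (Not t) \<longleftrightarrow> legal_test m M t"
| "legal_test m M (And t t') \<longleftrightarrow> legal_test m M t \<and> legal_test m M t'"

text \<open>Besides arithmetic operations, comparisons and oracle calls, also memory accesses,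
  constants and assignments are charged one unit each, and the output of a vector is charged n + 1
  units.\<close>

primrec cost :: "exp \<Rightarrow> nat" where
  "cost (Num k) = 1"
| "cost (Cell a) = 1 + cost a"
| "cost (Add a b) = 1 + cost a + cost b"
| "cost (Sub a b) = 1 + cost a + cost b"
| "cost (Mul a b) = 1 + cost a + cost b"
| "cost (Div a b) = 1 + cost a + cost b"

primrec cost_test :: "test \<Rightarrow> nat" where
  "cost_test (Less a b) = 1 + cost a + cost b"
| "cost_test (Eq a b) = 1 + cost a + cost b"
| "cost_test (Not t) = 1 + cost_test t"
| "cost_test (And t t') = 1 + cost_test t + cost_test t'"

definition vector_at :: "nat \<Rightarrow> memory \<Rightarrow> real \<Rightarrow> nat \<Rightarrow> real" where
  "vector_at n M b = (\<lambda>i. if i \<in> {1..n} then M (nat \<lfloor>b\<rfloor> + i) else 0)"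

definition signed_set_at :: "nat \<Rightarrow> memory \<Rightarrow> real \<Rightarrow> signed_set" where
  "signed_set_at n M b =
     ({i \<in> {1..n}. vector_at n M b i = 1}, {i \<in> {1..n}. vector_at n M b i = - 1})"

text \<open>\<open>exec n f m c M tr t M'\<close>: with oracle f on the ground set {1..n}, the command c, started in
  memory M, terminates in memory M' after t units of time, accesses no cell outside 0, ..., m - 1
  and emits the events tr.  Expressions and control need only a number of further
  registers that depends on the program alone.\<close>

inductive exec ::
    "nat \<Rightarrow> (signed_set \<Rightarrow> real) \<Rightarrow> nat \<Rightarrow>
     com \<Rightarrow> memory \<Rightarrow> (nat \<Rightarrow> real) event list \<Rightarrow> nat \<Rightarrow> memory \<Rightarrow> bool"
  for n :: nat and f :: "signed_set \<Rightarrow> real" and m :: nat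
where
  exec_Skip:
    "exec n f m Skip M [] 0 M"
| exec_Assign:
    "\<lbrakk> legal m M a; is_address m (ev M a); legal m M e \<rbrakk>
     \<Longrightarrow> exec n f m (Assign a e) M [] (1 + cost a + cost e) (M(nat \<lfloor>ev M a\<rfloor> := ev M e))"
| exec_Query:
    "\<lbrakk> legal m M a; is_address m (ev M a); legal m M b; is_block n m (ev M b);
       \<forall>i \<in> {1..n}. vector_at n M (ev M b) i \<in> {- 1, 0, 1} \<rbrakk>
     \<Longrightarrow> exec n f m (Query a b) M [] (1 + cost a + cost b)
           (M(nat \<lfloor>ev M a\<rfloor> := f (signed_set_at n M (ev M b))))"
| exec_ReportVec:
    "\<lbrakk> legal m M b; is_block n m (ev M b) \<rbrakk>
     \<Longrightarrow> exec n f m (ReportVec b) M [Report (vector_at n M (ev M b))] (1 + n + cost b) M"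
| exec_MoveTo:
    "\<lbrakk> legal m M b; is_block n m (ev M b) \<rbrakk>
     \<Longrightarrow> exec n f m (MoveTo b) M [Move (vector_at n M (ev M b))] (1 + n + cost b) M"
| exec_Seq:
    "\<lbrakk> exec n f m c M tr t M'; exec n f m c' M' tr' t' M'' \<rbrakk>
     \<Longrightarrow> exec n f m (Seq c c') M (tr @ tr') (t + t') M''"
| exec_IfTrue:
    "\<lbrakk> legal_test m M b; holds M b; exec n f m c M tr t M' \<rbrakk>
     \<Longrightarrow> exec n f m (If b c c') M tr (cost_test b + t) M'"
| exec_IfFalse:
    "\<lbrakk> legal_test m M b; \<not> holds M b; exec n f m c' M tr t M' \<rbrakk>
     \<Longrightarrow> exec n f m (If b c c') M tr (cost_test b + t) M'"
| exec_WhileFalse: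
    "\<lbrakk> legal_test m M b; \<not> holds M b \<rbrakk>
     \<Longrightarrow> exec n f m (While b c) M [] (cost_test b) M"
| exec_WhileTrue:
    "\<lbrakk> legal_test m M b; holds M b; exec n f m c M tr t M';
       exec n f m (While b c) M' tr' t' M'' \<rbrakk>
     \<Longrightarrow> exec n f m (While b c) M (tr @ tr') (cost_test b + t + t') M''"

text \<open>Execution is deterministic, so that a derivable execution is the run of the program.\<close>

lemma exec_deterministic:
  "exec n f m c M tr t M' \<Longrightarrow> exec n f m c M tr' t' M'' \<Longrightarrow> tr = tr' \<and> t = t' \<and> M' = M''"
proof (induction arbitrary: tr' t' M'' rule: exec.induct)
  case (exec_Seq c M tr t M' c' tr1 t1 M1)
  from exec_Seq.prems show ?case
    by (cases rule: exec.cases) (use exec_Seq.IH in blast)+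
next
  case (exec_WhileTrue b M c tr t M' tr1 t1 M1)
  from exec_WhileTrue.prems show ?case
    by (cases rule: exec.cases) (use exec_WhileTrue in blast)+
next
  case (exec_IfTrue M b c tr t M' c')
  from exec_IfTrue.prems show ?case
    by (cases rule: exec.cases) (use exec_IfTrue in blast)+
next
  case (exec_IfFalse M b c' tr t M' c)
  from exec_IfFalse.prems show ?case
    by (cases rule: exec.cases) (use exec_IfFalse in blast)+
qed (erule exec.cases; simp)+

text \<open>Initially the first cell contains n.\<close>

definition initial_memory :: "nat \<Rightarrow> memory" where
  "initial_memory n = (\<lambda>_. 0)(0 := real n)"

end

theory Submission
  imports Defs
begin

text \<open>Signed sets are handled as vectors with entries -1, 0, 1.  The constraints that are tight at a
  feasible point are closed under both lattice operations, every chain of tight sign vectors at a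
  vertex can be refined to a maximal one, and conversely a point that is tight on a maximal chain is
  a vertex.  Giving up one member of a maximal chain leads along an edge to a vertex whose chain
  arises by exchanging two consecutive signed elements a, b (or by changing the sign of the last
  element).

  Vertices are compared by the linear objective with the weights n, ..., 1.  Adding at every step the
  least signed element that keeps the constraint tight gives each vertex a canonical maximal chain; a
  descent (a, b) in it is an improving exchange and determines the parent, and only the canonical
  chain of the maximizer has no descent.  The same pair leads back from the parent to the child,
  because the canonical chain that avoids the coordinates of a and b is the same at both ends of the
  edge.  Hence the children of a vertex are found by trying the 4 n^2 pairs.  Each trial constructs
  two canonical chains with O(n^2) oracle calls, which makes O(n^4) per vertex, and only one vertex,
  one sign vector and two counters have to be remembered.\<close>

section \<open>Sign vectors\<close>

text \<open>A degenerate vertex has many maximal chains, and an exchange in an arbitrary one of them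
  may have length 0. The canonical chain excludes this: if b directly follows a in it and b < a,
  then b was refused when a was taken, so the vector with b in place of a is not tight there and the
  exchange has positive length. The exchange is nevertheless not carried out in this chain, whose
  part before a need not be recoverable at the far end. It is carried out above the greedy chain
  that never touches the two coordinates: only constraints with equal slack at both ends enter it,
  so either end can rebuild it. This chain extends the part before a; composition carries the
  required tightness up to it, and the meet would carry an unwanted tightness of the vector with b
  back down, which keeps the length positive.\<close>

type_synonym rvec = "nat \<Rightarrow> real"

definition sign_vec :: "nat \<Rightarrow> rvec \<Rightarrow> bool" where
  "sign_vec n S \<longleftrightarrow> (\<forall>i. S i \<in> {- 1, 0, 1}) \<and> (\<forall>i. i \<notin> {1..n} \<longrightarrow> S i = 0)"

definition signed_set_of :: "nat \<Rightarrow> rvec \<Rightarrow> signed_set" where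
  "signed_set_of n S = ({i \<in> {1..n}. S i = 1}, {i \<in> {1..n}. S i = - 1})"

definition vjoin :: "rvec \<Rightarrow> rvec \<Rightarrow> nat \<Rightarrow> real" where
  "vjoin S T = (\<lambda>i. sgn (S i + T i))"

definition vmeet :: "rvec \<Rightarrow> rvec \<Rightarrow> nat \<Rightarrow> real" where
  "vmeet S T = (\<lambda>i. if S i = T i then S i else 0)"

text \<open>Composition as for oriented matroids: conflicts are decided in favour of
  \<open>S\<close>, whereas \<open>vjoin\<close> cancels them to 0. Hence the result always extends
  \<open>S\<close>.\<close>

definition vcomp :: "rvec \<Rightarrow> rvec \<Rightarrow> nat \<Rightarrow> real" where
  "vcomp S T = (\<lambda>i. if S i \<noteq> 0 then S i else T i)"

definition vle :: "rvec \<Rightarrow> rvec \<Rightarrow> bool" where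
  "vle S T \<longleftrightarrow> (\<forall>i. S i \<noteq> 0 \<longrightarrow> T i = S i)"

lemma sign_vecD: "sign_vec n S \<Longrightarrow> S i = -1 \<or> S i = 0 \<or> S i = 1"
  by (auto simp: sign_vec_def)

lemma sign_vec_outside: "sign_vec n S \<Longrightarrow> i \<notin> {1..n} \<Longrightarrow> S i = 0"
  by (auto simp: sign_vec_def)

lemma sign_vec_vmeet: "sign_vec n S \<Longrightarrow> sign_vec n T \<Longrightarrow> sign_vec n (vmeet S T)"
  by (auto simp: sign_vec_def vmeet_def)

lemma sign_vec_vjoin: "sign_vec n S \<Longrightarrow> sign_vec n T \<Longrightarrow> sign_vec n (vjoin S T)"
  by (auto simp: sign_vec_def vjoin_def sgn_if)

lemma sign_vec_eq_sgn: "sign_vec n S \<Longrightarrow> sgn (S i) = S i"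
  using sign_vecD[of n S i] by auto

text \<open>A conflict contributes 0 on both sides, and an agreement is counted once by each
  operation. By this modularity the linear part of the slack drops out of the bisubmodular
  inequality.\<close>

lemma vjoin_plus_vmeet:
  assumes "sign_vec n S" "sign_vec n T"
  shows "vjoin S T i + vmeet S T i = S i + T i"
  using sign_vecD[OF assms(1), of i] sign_vecD[OF assms(2), of i]
  by (elim disjE) (simp_all add: vjoin_def vmeet_def)

text \<open>The inner join cancels the conflicts to 0, so that the outer one restores the sign of
  \<open>S\<close> there. Thus whatever is closed under joins is closed under composition.\<close>

lemma vcomp_eq_vjoin:
  assumes "sign_vec n S" "sign_vec n T"
  shows "vcomp S T = vjoin S (vjoin S T)"
proof
  fix i show "vcomp S T i = vjoin S (vjoin S T) i"
    using sign_vecD[OF assms(1), of i] sign_vecD[OF assms(2), of i]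
    by (elim disjE) (simp_all add: vjoin_def vcomp_def)
qed

lemma signed_set_of_in: "sign_vec n S \<Longrightarrow> signed_set_of n S \<in> signed_sets n"
  by (auto simp: signed_set_of_def signed_sets_def)

lemma signed_set_of_vjoin:
  assumes "sign_vec n S" "sign_vec n T"
  shows "signed_set_of n (vjoin S T) = sjoin (signed_set_of n S) (signed_set_of n T)"
proof -
  have "vjoin S T i = 1 \<longleftrightarrow> (S i = 1 \<or> T i = 1) \<and> \<not> (S i = -1 \<or> T i = -1)"
    "vjoin S T i = - 1 \<longleftrightarrow> (S i = -1 \<or> T i = -1) \<and> \<not> (S i = 1 \<or> T i = 1)" for i
    using sign_vecD[OF assms(1), of i] sign_vecD[OF assms(2), of i]
    by (elim disjE; simp add: vjoin_def)+
  then show ?thesis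
    by (auto simp: signed_set_of_def sjoin_def)
qed

lemma signed_set_of_vmeet:
  "signed_set_of n (vmeet S T) = smeet (signed_set_of n S) (signed_set_of n T)"
  by (auto simp: signed_set_of_def smeet_def vmeet_def split: if_splits)

lemma vle_refl: "vle S S" by (simp add: vle_def)

lemma vle_trans: "vle S T \<Longrightarrow> vle T U \<Longrightarrow> vle S U"
  unfolding vle_def by metis

text \<open>The codes 1, ..., 2 n denote the signed unit vectors: y stands for the y-th unit vector if
  \<open>y \<le> n\<close>, and 2 n + 1 - y for the negative of the y-th one.  In this order the objective strictly
  decreases.  A chain of sign vectors is given by the list of the codes added successively.\<close>

definition idx :: "nat \<Rightarrow> nat \<Rightarrow> nat" where
  "idx n y = (if y \<le> n then y else 2 * n + 1 - y)"

definition sg :: "nat \<Rightarrow> nat \<Rightarrow> real" where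
  "sg n y = (if y \<le> n then 1 else - 1)"

definition neg :: "nat \<Rightarrow> nat \<Rightarrow> nat" where
  "neg n y = 2 * n + 1 - y"

definition unit :: "nat \<Rightarrow> nat \<Rightarrow> nat \<Rightarrow> real" where
  "unit n y = (\<lambda>i. if i = idx n y then sg n y else 0)"

definition codes :: "nat \<Rightarrow> nat set" where
  "codes n = {1..2 * n}"

primrec svec :: "nat \<Rightarrow> nat list \<Rightarrow> nat \<Rightarrow> real" where
  "svec n [] = (\<lambda>i. 0)"
| "svec n (y # l) = (\<lambda>i. unit n y i + svec n l i)"

definition code_list :: "nat \<Rightarrow> nat list \<Rightarrow> bool" where
  "code_list n l \<longleftrightarrow> set l \<subseteq> codes n \<and> distinct (map (idx n) l)"

lemma idx_range: "y \<in> codes n \<Longrightarrow> idx n y \<in> {1..n}"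
  by (auto simp: codes_def idx_def)

lemma sg_cases: "sg n y = 1 \<or> sg n y = - 1"
  by (auto simp: sg_def)

lemma sg_nz [simp]: "sg n y \<noteq> 0"
  by (auto simp: sg_def)

lemma sg_sq [simp]: "sg n y * sg n y = 1"
  by (auto simp: sg_def)

lemma neg_codes: "y \<in> codes n \<Longrightarrow> neg n y \<in> codes n"
  by (auto simp: codes_def neg_def)

lemma idx_neg: "y \<in> codes n \<Longrightarrow> idx n (neg n y) = idx n y"
  by (auto simp: codes_def neg_def idx_def)

lemma sg_neg: "y \<in> codes n \<Longrightarrow> sg n (neg n y) = - sg n y"
  by (auto simp: codes_def neg_def sg_def)

lemma same_idx: "a \<in> codes n \<Longrightarrow> b \<in> codes n \<Longrightarrow> idx n a = idx n b \<Longrightarrow> b = a \<or> b = neg n a"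
  by (auto simp: codes_def neg_def idx_def split: if_splits)

lemma ex_code: "i \<in> {1..n} \<Longrightarrow> s = 1 \<or> s = - 1 \<Longrightarrow> \<exists>y \<in> codes n. idx n y = i \<and> sg n y = s"
  by (cases "s = 1", rule bexI[of _ i], (force simp: idx_def sg_def codes_def)+,
      rule bexI[of _ "2 * n + 1 - i"], (force simp: idx_def sg_def codes_def)+)

lemma svec_append: "svec n (l @ m) i = svec n l i + svec n m i"
  by (induction l) auto

lemma svec_snoc: "svec n (l @ [y]) i = svec n l i + unit n y i"
  by (simp add: svec_append)

lemma unit_eq [simp]: "unit n y (idx n y) = sg n y"
  by (simp add: unit_def)

lemma unit_ne [simp]: "i \<noteq> idx n y \<Longrightarrow> unit n y i = 0"
  by (simp add: unit_def)

lemma svec_notin: "i \<notin> idx n ` set l \<Longrightarrow> svec n l i = 0"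
  by (induction l) auto

lemma svec_in: "distinct (map (idx n) l) \<Longrightarrow> y \<in> set l \<Longrightarrow> svec n l (idx n y) = sg n y"
proof (induction l)
  case (Cons z l)
  show ?case
  proof (cases "y = z")
    case True
    then show ?thesis using Cons.prems svec_notin[of "idx n z" n l] by auto
  next
    case False
    then have "idx n y \<noteq> idx n z" using Cons.prems by (auto simp: image_iff) 
    then show ?thesis using Cons False by auto
  qed
qed simp

lemma code_list_append:
  "code_list n (l @ m) \<longleftrightarrow> code_list n l \<and> code_list n m \<and> idx n ` set l \<inter> idx n ` set m = {}"
  by (auto simp: code_list_def)

lemma code_list_Nil [simp]: "code_list n []"
  by (auto simp: code_list_def)

lemma code_list_single [simp]: "code_list n [y] \<longleftrightarrow> y \<in> codes n"
  by (auto simp: code_list_def)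

lemma code_list_snoc:
  "code_list n (l @ [y]) \<longleftrightarrow> code_list n l \<and> y \<in> codes n \<and> idx n y \<notin> idx n ` set l"
  by (simp add: code_list_append)

lemma code_list_take: "code_list n l \<Longrightarrow> code_list n (take k l)"
  by (metis append_take_drop_id code_list_append)

lemma svec_nz: "code_list n l \<Longrightarrow> svec n l i \<noteq> 0 \<longleftrightarrow> i \<in> idx n ` set l"
  using svec_in[of n l] svec_notin[of i n l] by (auto simp: code_list_def)

lemma sign_vec_svec: "code_list n l \<Longrightarrow> sign_vec n (svec n l)"
proof -
  assume c: "code_list n l"
  have "svec n l i \<in> {-1, 0, 1}" for i
  proof (cases "i \<in> idx n ` set l")
    case True
    then show ?thesis using c svec_in[of n l] sg_cases by (fastforce simp: code_list_def)
  qed (simp add: svec_notin)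
  moreover have "svec n l i = 0" if "i \<notin> {1..n}" for i
  proof (rule svec_notin)
    show "i \<notin> idx n ` set l" using that c idx_range by (auto simp: code_list_def)
  qed
  ultimately show ?thesis unfolding sign_vec_def by blast
qed

lemma code_list_length: "code_list n l \<Longrightarrow> length l \<le> n"
proof -
  assume c: "code_list n l"
  then have "length l = card (idx n ` set l)"
    by (metis code_list_def distinct_card length_map list.set_map)
  also have "\<dots> \<le> card {1..n}"
    by (rule card_mono) (use c idx_range in \<open>auto simp: code_list_def\<close>)
  finally show ?thesis by simp
qed

lemma code_list_full_iff: "code_list n l \<Longrightarrow> length l = n \<longleftrightarrow> idx n ` set l = {1..n}"
proof -
  assume c: "code_list n l"
  have e: "length l = card (idx n ` set l)"
    using c by (metis code_list_def distinct_card length_map list.set_map)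
  have s: "idx n ` set l \<subseteq> {1..n}"
    using c idx_range by (auto simp: code_list_def)
  show ?thesis
    by (metis e s card_atLeastAtMost card_subset_eq diff_Suc_1 finite_atLeastAtMost)
qed

section \<open>Chains of tight sign vectors\<close>

definition dot :: "nat \<Rightarrow> rvec \<Rightarrow> rvec \<Rightarrow> real" where
  "dot n S x = (\<Sum>i\<in>{1..n}. S i * x i)"

locale bisub =
  fixes n :: nat and f :: "signed_set \<Rightarrow> real"
  assumes n_pos: "n \<ge> 1" and bisubmodular: "bisubmodular n f" and f_empty: "f ({}, {}) = 0"
begin

definition slack :: "rvec \<Rightarrow> rvec \<Rightarrow> real" where
  "slack x S = f (signed_set_of n S) - dot n S x"

definition P :: "rvec set" where
  "P = bisub_polyhedron n f"

definition V :: "rvec set" where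
  "V = vertices P"

definition supported :: "rvec \<Rightarrow> bool" where
  "supported x \<longleftrightarrow> (\<forall>i. i \<notin> {1..n} \<longrightarrow> x i = 0)"

definition tight :: "rvec \<Rightarrow> rvec \<Rightarrow> bool" where
  "tight x S \<longleftrightarrow> sign_vec n S \<and> slack x S = 0"

definition tight_list :: "rvec \<Rightarrow> nat list \<Rightarrow> bool" where
  "tight_list x l \<longleftrightarrow> code_list n l \<and> (\<forall>k \<le> length l. slack x (svec n (take k l)) = 0)"

lemma dot_vjoin_vmeet:
  assumes "sign_vec n S" "sign_vec n T"
  shows "dot n (vjoin S T) x + dot n (vmeet S T) x = dot n S x + dot n T x"
  unfolding dot_def sum.distrib[symmetric]
  by (rule sum.cong) (simp_all add: vjoin_plus_vmeet[OF assms] distrib_right[symmetric])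

text \<open>The slack is f minus a modular function. The inequality holds at every \<open>x\<close>
  and is therefore at hand before feasibility is known.\<close>

lemma slack_bisubmodular:
  assumes "sign_vec n S" "sign_vec n T"
  shows "slack x (vjoin S T) + slack x (vmeet S T) \<le> slack x S + slack x T"
proof -
  have "f (sjoin (signed_set_of n S) (signed_set_of n T)) +
        f (smeet (signed_set_of n S) (signed_set_of n T))
        \<le> f (signed_set_of n S) + f (signed_set_of n T)"
    using bisubmodular signed_set_of_in assms unfolding bisubmodular_def by blast
  then show ?thesis
    using dot_vjoin_vmeet[OF assms, of x]
    by (simp add: slack_def signed_set_of_vjoin[OF assms] signed_set_of_vmeet)
qed

text \<open>Splitting the inner product by signs gives x(X) - x(Y), and every signed set comes from
  a sign vector, so the constraints may be indexed by sign vectors.\<close>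

lemma P_iff: "x \<in> P \<longleftrightarrow> supported x \<and> (\<forall>S. sign_vec n S \<longrightarrow> slack x S \<ge> 0)"
proof -
  have d: "dot n S x = (\<Sum>i\<in>fst (signed_set_of n S). x i) - (\<Sum>i\<in>snd (signed_set_of n S). x i)"
    if S: "sign_vec n S" for S
  proof -
    have "dot n S x = (\<Sum>i\<in>{1..n}. (if S i = 1 then x i else 0) - (if S i = - 1 then x i else 0))"
      unfolding dot_def
    proof (rule sum.cong)
      fix i assume "i \<in> {1..n}"
      show "S i * x i = (if S i = 1 then x i else 0) - (if S i = - 1 then x i else 0)"
        using sign_vecD[OF S, of i] by auto
    qed simp
    also have "\<dots> = (\<Sum>i\<in>{1..n}. if S i = 1 then x i else 0) - (\<Sum>i\<in>{1..n}. if S i = - 1 then x i else 0)"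
      by (rule sum_subtractf)
    also have "\<dots> = (\<Sum>i\<in>{i \<in> {1..n}. S i = 1}. x i) - (\<Sum>i\<in>{i \<in> {1..n}. S i = - 1}. x i)"
      by (simp only: sum.inter_filter finite_atLeastAtMost)
    finally show ?thesis by (simp add: signed_set_of_def)
  qed
  have e: "\<exists>S. sign_vec n S \<and> signed_set_of n S = A" if "A \<in> signed_sets n" for A
  proof -
    obtain X Y where A: "A = (X, Y)" "X \<subseteq> {1..n}" "Y \<subseteq> {1..n}" "X \<inter> Y = {}"
      using \<open>A \<in> signed_sets n\<close> by (auto simp: signed_sets_def)
    let ?S = "\<lambda>i. if i \<in> X then 1 else if i \<in> Y then - 1 else (0::real)"
    have "sign_vec n ?S" using A by (auto simp: sign_vec_def)
    moreover have "signed_set_of n ?S = A" using A by (auto simp: signed_set_of_def)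
    ultimately show ?thesis by blast
  qed
  have "(\<forall>(X, Y) \<in> signed_sets n. (\<Sum>i\<in>X. x i) - (\<Sum>i\<in>Y. x i) \<le> f (X, Y)) \<longleftrightarrow>
      (\<forall>A \<in> signed_sets n. (\<Sum>i\<in>fst A. x i) - (\<Sum>i\<in>snd A. x i) \<le> f A)"
    by (simp add: case_prod_unfold)
  also have "\<dots> \<longleftrightarrow> (\<forall>S. sign_vec n S \<longrightarrow> slack x S \<ge> 0)"
  proof
    assume "\<forall>A \<in> signed_sets n. (\<Sum>i\<in>fst A. x i) - (\<Sum>i\<in>snd A. x i) \<le> f A"
    then show "\<forall>S. sign_vec n S \<longrightarrow> slack x S \<ge> 0"
      using d signed_set_of_in by (auto simp: slack_def)
  next
    assume r: "\<forall>S. sign_vec n S \<longrightarrow> slack x S \<ge> 0"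
    show "\<forall>A \<in> signed_sets n. (\<Sum>i\<in>fst A. x i) - (\<Sum>i\<in>snd A. x i) \<le> f A"
    proof
      fix A assume "A \<in> signed_sets n"
      then obtain S where "sign_vec n S" "signed_set_of n S = A" using e by blast
      then show "(\<Sum>i\<in>fst A. x i) - (\<Sum>i\<in>snd A. x i) \<le> f A"
        using d[of S] r by (auto simp: slack_def)
    qed
  qed
  finally show ?thesis
    by (simp add: P_def bisub_polyhedron_def supported_def)
qed

lemma slack_nonneg: "x \<in> P \<Longrightarrow> sign_vec n S \<Longrightarrow> slack x S \<ge> 0"
  by (simp add: P_iff)

lemma slack_zero: "slack x (\<lambda>i. 0) = 0"
  using f_empty by (simp add: slack_def signed_set_of_def dot_def)

text \<open>Two nonnegative slacks whose sum is at most 0 both vanish.\<close>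

lemma tight_vjoin_vmeet:
  assumes "x \<in> P" "tight x S" "tight x T"
  shows "tight x (vjoin S T)" "tight x (vmeet S T)"
  using slack_bisubmodular[of S T x] assms(2,3) slack_nonneg[OF assms(1), of "vjoin S T"]
    slack_nonneg[OF assms(1), of "vmeet S T"] sign_vec_vjoin[of n S T] sign_vec_vmeet[of n S T]
  by (auto simp: tight_def)

lemma tight_vcomp:
  assumes "x \<in> P" "tight x S" "tight x T"
  shows "tight x (vcomp S T)"
proof -
  have "tight x (vjoin S (vjoin S T))" using assms tight_vjoin_vmeet by metis
  then show ?thesis using assms vcomp_eq_vjoin[of n S T] by (simp add: tight_def)
qed

lemma tight_listD: "tight_list x l \<Longrightarrow> k \<le> length l \<Longrightarrow> tight x (svec n (take k l))"
  by (auto simp: tight_list_def tight_def intro!: sign_vec_svec code_list_take)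

lemma tight_list_last: "tight_list x l \<Longrightarrow> tight x (svec n l)"
  using tight_listD[of x l "length l"] by simp

lemma tight_list_snoc:
  "tight_list x (l @ [y]) \<longleftrightarrow> tight_list x l \<and> code_list n (l @ [y]) \<and> slack x (svec n (l @ [y])) = 0"
proof -
  have "(\<forall>k \<le> length (l @ [y]). slack x (svec n (take k (l @ [y]))) = 0) \<longleftrightarrow>
      (\<forall>k \<le> length l. slack x (svec n (take k l)) = 0) \<and> slack x (svec n (l @ [y])) = 0"
    by (auto simp: le_Suc_eq)
  then show ?thesis by (auto simp: tight_list_def code_list_append)
qed

lemma tight_list_Nil [simp]: "tight_list x []"
  by (simp add: tight_list_def slack_zero)

lemma tight_list_appendD: "tight_list x (l @ m) \<Longrightarrow> tight_list x l"
  by (induction m rule: rev_induct) (auto simp: tight_list_snoc simp flip: append_assoc)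

text \<open>Let \<open>Z\<close> be the chain without its last code. The join of \<open>S\<close>
  and \<open>Z\<close> can only be \<open>Z\<close> or the top of the chain, both of slack 0; the
  meet lies below \<open>Z\<close> and is covered by induction. Bisubmodularity passes the bound on
  to \<open>S\<close>.\<close>

lemma tight_list_nonneg_below:
  assumes "tight_list x l" "sign_vec n S" "vle S (svec n l)"
  shows "slack x S \<ge> 0"
  using assms
proof (induction l arbitrary: S rule: rev_induct)
  case Nil
  then have "S = (\<lambda>i. 0)" by (auto simp: vle_def)
  then show ?case by (simp add: slack_zero)
next
  case (snoc y l)
  let ?Z = "svec n l" and ?Y = "svec n (l @ [y])"
  have tl: "tight_list x l" and c: "code_list n (l @ [y])" and ty: "slack x ?Y = 0"
    using snoc.prems(1) by (auto simp: tight_list_snoc)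
  have Z: "sign_vec n ?Z" and ny: "idx n y \<notin> idx n ` set l"
    using c by (auto simp: code_list_snoc sign_vec_svec)
  have le: "vle (vmeet S ?Z) ?Z" by (auto simp: vle_def vmeet_def)
  have Y: "?Y i = (if i = idx n y then sg n y else ?Z i)" for i
    using ny by (simp add: svec_snoc unit_def svec_notin)
  have cases: "vjoin S ?Z = ?Z \<or> vjoin S ?Z = ?Y"
  proof -
    have e: "vjoin S ?Z i = ?Z i" if "i \<noteq> idx n y" for i
      using snoc.prems(3) that sign_vec_eq_sgn[OF Z, of i] Y[of i]
      by (cases "S i = 0") (auto simp: vjoin_def vle_def sgn_if)
    have z: "?Z (idx n y) = 0" using ny by (rule svec_notin)
    show ?thesis
    proof (cases "S (idx n y) = 0")
      case True
      then have "vjoin S ?Z (idx n y) = ?Z (idx n y)" using z by (simp add: vjoin_def)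
      then have "vjoin S ?Z i = ?Z i" for i using e by (cases "i = idx n y") auto
      then show ?thesis by blast
    next
      case False
      then have "S (idx n y) = sg n y" using snoc.prems(3) Y[of "idx n y"] by (auto simp: vle_def)
      then have "vjoin S ?Z (idx n y) = sg n y" using z sg_cases[of n y] by (auto simp: vjoin_def)
      then have "vjoin S ?Z i = ?Y i" for i using e Y by (cases "i = idx n y") auto
      then show ?thesis by blast
    qed
  qed
  have "slack x ?Z = 0" using tight_list_last[OF tl] by (simp add: tight_def)
  then have "slack x (vjoin S ?Z) = 0" using cases ty by auto
  moreover have "slack x (vmeet S ?Z) \<ge> 0"
    using snoc.IH[OF tl sign_vec_vmeet[OF snoc.prems(2) Z] le] .
  ultimately show ?case
    using slack_bisubmodular[OF snoc.prems(2) Z, of x] \<open>slack x ?Z = 0\<close> by simp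
qed

text \<open>Only the constraints of one maximal chain are assumed to hold: this is the validity of the
  greedy algorithm.\<close>

lemma full_tight_list_feasible:
  assumes l: "tight_list x l" "length l = n" and x: "supported x"
  shows "x \<in> P"
  unfolding P_iff
proof (intro conjI allI impI x)
  fix S assume S: "sign_vec n S"
  let ?Z = "svec n l"
  have c: "code_list n l" using l by (simp add: tight_list_def)
  have Z: "sign_vec n ?Z" using c by (rule sign_vec_svec)
  have full: "?Z i \<noteq> 0" if "i \<in> {1..n}" for i
    using svec_nz[OF c] code_list_full_iff[OF c] l(2) that by blast
  \<comment> \<open>\<open>?Z\<close> has no zero entry in {1..n}, so adding an entry of
    \<open>S\<close> either keeps its sign or cancels it to 0.\<close>
  have "vle (vjoin S ?Z) ?Z"
    unfolding vle_def
  proof (intro allI impI)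
    fix i assume a: "vjoin S ?Z i \<noteq> 0"
    then have "i \<in> {1..n}" using sign_vec_vjoin[OF S Z] sign_vec_outside by blast
    then show "?Z i = vjoin S ?Z i"
      using a full[of i] sign_vecD[OF S, of i] sign_vecD[OF Z, of i] by (auto simp: vjoin_def)
  qed
  then have "slack x (vjoin S ?Z) \<ge> 0"
    using tight_list_nonneg_below[OF l(1)] sign_vec_vjoin[OF S Z] by blast
  moreover have "slack x (vmeet S ?Z) \<ge> 0"
    using tight_list_nonneg_below[OF l(1) sign_vec_vmeet[OF S Z]] by (auto simp: vle_def vmeet_def)
  moreover have "slack x ?Z = 0" using tight_list_last[OF l(1)] by (simp add: tight_def)
  ultimately show "slack x S \<ge> 0" using slack_bisubmodular[OF S Z, of x] by simp
qed

section \<open>Coordinates determined by consecutive tight vectors\<close>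

lemma dot_unit: "y \<in> codes n \<Longrightarrow> dot n (unit n y) x = sg n y * x (idx n y)"
proof -
  assume y: "y \<in> codes n"
  have "dot n (unit n y) x = (\<Sum>i\<in>{1..n}. if i = idx n y then sg n y * x (idx n y) else 0)"
    unfolding dot_def by (rule sum.cong) (auto simp: unit_def)
  then show ?thesis using idx_range[OF y] by simp
qed

lemma dot_add_left: "dot n (\<lambda>i. S i + T i) x = dot n S x + dot n T x"
  by (simp add: dot_def distrib_right sum.distrib)

lemma dot_add_right: "dot n S (\<lambda>i. x i + c * d i) = dot n S x + c * dot n S d"
  by (simp add: dot_def distrib_left sum.distrib sum_distrib_left mult.left_commute)

lemma dot_snoc: "y \<in> codes n \<Longrightarrow> dot n (svec n (l @ [y])) x = dot n (svec n l) x + sg n y * x (idx n y)"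
  using dot_add_left[of "svec n l" "unit n y" x] by (simp add: dot_unit svec_snoc[abs_def])

lemma slack_add_right: "slack (\<lambda>i. x i + c * d i) S = slack x S - c * dot n S d"
  by (simp add: slack_def dot_add_right)

text \<open>Subtracting the two tight equations leaves one coordinate: this is the value that the
  greedy algorithm assigns.\<close>

lemma tight_step_value:
  assumes "y \<in> codes n" "slack x (svec n l) = 0" "slack x (svec n (l @ [y])) = 0"
  shows "sg n y * x (idx n y) = f (signed_set_of n (svec n (l @ [y]))) - f (signed_set_of n (svec n l))"
  using assms by (simp add: slack_def dot_snoc)

lemma tight_step_coordinate:
  assumes "y \<in> codes n" "slack x (svec n l) = 0" "slack x (svec n (l @ [y])) = 0"
    "slack z (svec n l) = 0" "slack z (svec n (l @ [y])) = 0"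
  shows "x (idx n y) = z (idx n y)"
  using tight_step_value[OF assms(1-3)] tight_step_value[OF assms(1,4,5)] sg_cases[of n y] by auto

text \<open>A chain of length n adds each coordinate of {1..n} once, and each addition determines
  that coordinate from \<open>f\<close> alone.\<close>

lemma full_tight_list_unique:
  assumes l: "tight_list x l" "tight_list z l" "length l = n" and s: "supported x" "supported z"
  shows "x = z"
proof
  fix i
  have "x (idx n y) = z (idx n y)" if y: "y \<in> set l" for y
  proof -
    obtain l1 l2 where "l = l1 @ y # l2" using split_list[OF y] by blast
    then have t: "tight_list x (l1 @ [y])" "tight_list z (l1 @ [y])"
      using l(1,2) tight_list_appendD[of _ "l1 @ [y]" l2] by simp_all
    have "y \<in> codes n" using t by (auto simp: tight_list_snoc code_list_snoc)
    moreover have "slack x (svec n l1) = 0" "slack z (svec n l1) = 0"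
      using t tight_list_last by (auto simp: tight_list_snoc tight_def)
    ultimately show ?thesis
      using t by (intro tight_step_coordinate[of y x l1]) (simp_all add: tight_list_snoc)
  qed
  moreover have "i \<in> idx n ` set l" if "i \<in> {1..n}"
    using code_list_full_iff[of n l] l(1,3) that unfolding tight_list_def by blast
  ultimately show "x i = z i"
    using s by (cases "i \<in> {1..n}") (auto simp: supported_def)
qed

section \<open>Convexity and extreme points\<close>

lemma slack_segment:
  assumes "x = (\<lambda>i. (1 - u) * a i + u * b i)"
  shows "slack x S = (1 - u) * slack a S + u * slack b S"
proof -
  have "dot n S x = (1 - u) * dot n S a + u * dot n S b"
    using dot_add_right[of S "\<lambda>i. (1 - u) * a i" u b] dot_add_right[of S "\<lambda>i. 0" "1 - u" a] assms
    by (simp add: dot_def)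
  then show ?thesis by (simp add: slack_def algebra_simps)
qed

text \<open>The slack is affine along the segment; with positive weights, nonnegative values at the
  ends average to 0 only if both are 0.\<close>

lemma slack_open_segment:
  assumes "a \<in> P" "b \<in> P" "x \<in> open_segment a b" "sign_vec n S" "slack x S = 0"
  shows "slack a S = 0" "slack b S = 0"
proof -
  obtain u where u: "0 < u" "u < 1" "x = (1 - u) *\<^sub>R a + u *\<^sub>R b"
    using assms(3) by (auto simp: in_segment)
  have "x = (\<lambda>i. (1 - u) * a i + u * b i)"
    using u by (simp add: scaleR_fun_def fun_eq_iff)
  then have "0 = (1 - u) * slack a S + u * slack b S"
    using slack_segment assms(5) by simp
  moreover have "slack a S \<ge> 0" "slack b S \<ge> 0" using slack_nonneg assms by auto
  moreover have "(1 - u) * slack a S \<ge> 0" "u * slack b S \<ge> 0" using calculation u by auto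
  ultimately have "(1 - u) * slack a S = 0" "u * slack b S = 0" by linarith+
  then show "slack a S = 0" "slack b S = 0" using u by auto
qed

lemma convex_P: "convex P"
proof (unfold convex_alt, intro ballI allI impI)
  fix x y and u :: real assume h: "x \<in> P" "y \<in> P" "0 \<le> u \<and> u \<le> 1"
  have e: "(1 - u) *\<^sub>R x + u *\<^sub>R y = (\<lambda>i. (1 - u) * x i + u * y i)"
    by (simp add: scaleR_fun_def fun_eq_iff)
  show "(1 - u) *\<^sub>R x + u *\<^sub>R y \<in> P"
    unfolding e P_iff using h slack_nonneg[OF h(1)] slack_nonneg[OF h(2)]
    by (auto simp: slack_segment[OF refl] supported_def P_iff)
qed

lemma V_in_P: "x \<in> V \<Longrightarrow> x \<in> P"
  by (simp add: V_def vertices_def extreme_point_of_def)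

lemma P_supported: "x \<in> P \<Longrightarrow> supported x"
  by (simp add: P_iff)

text \<open>The ends of a feasible segment around \<open>x\<close> inherit the whole tight chain and
  therefore coincide with \<open>x\<close>.\<close>

lemma full_tight_list_vertex:
  assumes l: "tight_list x l" "length l = n" and x: "supported x"
  shows "x \<in> V"
proof -
  have xP: "x \<in> P" using full_tight_list_feasible assms by blast
  have "x \<notin> open_segment a b" if ab: "a \<in> P" "b \<in> P" for a b
  proof
    assume o: "x \<in> open_segment a b"
    have "tight_list a l" "tight_list b l"
      using slack_open_segment[OF ab o] tight_listD[OF l(1)] l(1)
      by (auto simp: tight_list_def tight_def)
    then have "a = x" "b = x"
      using full_tight_list_unique l ab P_supported x by metis+
    then show False using o by simp
  qed
  then show ?thesis using xP by (simp add: V_def vertices_def extreme_point_of_def)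
qed

section \<open>Refinement of chains at a vertex\<close>

lemma finite_sign_vecs: "finite {S. sign_vec n S}"
proof (rule finite_subset)
  show "{S. sign_vec n S} \<subseteq> {S. \<forall>i. (i \<in> {1..n} \<longrightarrow> S i \<in> {- 1, 0, 1}) \<and> (i \<notin> {1..n} \<longrightarrow> S i = 0)}"
    by (auto simp: sign_vec_def)
  show "finite {S. \<forall>i. (i \<in> {1..n} \<longrightarrow> S i \<in> {- 1, 0, 1::real}) \<and> (i \<notin> {1..n} \<longrightarrow> S i = 0)}"
    by (rule finite_set_of_finite_funs) auto
qed

text \<open>If all tight vectors were orthogonal to \<open>d\<close>, there would be room to move
  from \<open>x\<close> both along \<open>d\<close> and against it: finitely many constraints admit
  a common step \<open>e\<close>.\<close>

lemma vertex_separates: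
  assumes x: "x \<in> V" and d: "supported d" "d \<noteq> (\<lambda>i. 0)"
  shows "\<exists>S. tight x S \<and> dot n S d \<noteq> 0"
proof (rule ccontr)
  assume c: "\<not> ?thesis"
  have xP: "x \<in> P" using x V_in_P by blast
  \<comment> \<open>The element 1 keeps the set nonempty when no constraint is slack; the 1 in the
    denominator covers vectors orthogonal to \<open>d\<close>.\<close>
  define A where "A = insert 1 ((\<lambda>S. slack x S / (1 + \<bar>dot n S d\<bar>)) ` {S. sign_vec n S \<and> slack x S \<noteq> 0})"
  have fin: "finite A" unfolding A_def using finite_sign_vecs by auto
  have pos: "a > 0" if "a \<in> A" for a
  proof -
    have "slack x S > 0" if "sign_vec n S" "slack x S \<noteq> 0" for S
      using slack_nonneg[OF xP that(1)] that(2) by simp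
    then show ?thesis using \<open>a \<in> A\<close> unfolding A_def by (auto intro!: divide_pos_pos)
  qed
  define e where "e = Min A"
  have "e \<in> A" unfolding e_def using fin by (rule Min_in) (simp add: A_def)
  then have e: "e > 0" by (rule pos)
  have eb: "e * \<bar>dot n S d\<bar> \<le> slack x S" if S: "sign_vec n S" for S
  proof (cases "slack x S = 0")
    case True
    then show ?thesis using c S by (auto simp: tight_def)
  next
    case False
    then have "e \<le> slack x S / (1 + \<bar>dot n S d\<bar>)"
      unfolding e_def using fin S by (intro Min_le) (auto simp: A_def)
    then have "e * (1 + \<bar>dot n S d\<bar>) \<le> slack x S"
      by (simp add: pos_le_divide_eq add_pos_nonneg)
    then show ?thesis using e by (simp add: distrib_left)
  qed
  have inP: "(\<lambda>i. x i + s * d i) \<in> P" if "s = e \<or> s = - e" for s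
    unfolding P_iff
  proof (intro conjI allI impI)
    show "supported (\<lambda>i. x i + s * d i)" using P_supported[OF xP] d by (simp add: supported_def)
    fix S assume "sign_vec n S"
    from eb[OF this] have "\<bar>s * dot n S d\<bar> \<le> slack x S" using that e by (auto simp: abs_mult)
    then show "0 \<le> slack (\<lambda>i. x i + s * d i) S" by (simp add: slack_add_right)
  qed
  let ?a = "\<lambda>i. x i + e * d i" and ?b = "\<lambda>i. x i + (- e) * d i"
  obtain i where "d i \<noteq> 0" using d by auto
  then have "?a i \<noteq> ?b i" using e by simp
  then have "?a \<noteq> ?b" by metis
  moreover have "x = (1 - 1/2) *\<^sub>R ?a + (1/2) *\<^sub>R ?b"
    by (simp add: scaleR_fun_def fun_eq_iff algebra_simps)
  ultimately have "x \<in> open_segment ?a ?b"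
    unfolding in_segment by (intro conjI exI[of _ "1/2"]) auto
  then show False using x inP[of e] inP[of "- e"] by (simp add: V_def vertices_def extreme_point_of_def)
qed


lemma tight_between:
  assumes x: "x \<in> V" and S: "tight x S" and Z: "tight x Z" and le: "vle S Z"
    and ij: "i \<noteq> j" "S i = 0" "S j = 0" "Z i \<noteq> 0" "Z j \<noteq> 0"
  shows "\<exists>U. tight x U \<and> vle S U \<and> vle U Z \<and> U \<noteq> S \<and> U \<noteq> Z"
proof -
  have xP: "x \<in> P" using x by (rule V_in_P)
  have sZ: "sign_vec n Z" using Z by (simp add: tight_def)
  have ijn: "i \<in> {1..n}" "j \<in> {1..n}" using sign_vec_outside[OF sZ] ij by blast+
  \<comment> \<open>This direction is orthogonal to both \<open>S\<close> and \<open>Z\<close>, so a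
    tight \<open>T\<close> that is not orthogonal to it relates to \<open>Z\<close> differently at
    \<open>i\<close> and at \<open>j\<close>.\<close>
  define d where "d = (\<lambda>k. if k = i then Z i else if k = j then - Z j else 0)"
  have "supported d" using ijn by (auto simp: supported_def d_def)
  moreover have "d i \<noteq> 0" using ij by (simp add: d_def)
  ultimately obtain T where T: "tight x T" "dot n T d \<noteq> 0" using vertex_separates[OF x] by metis
  have sT: "sign_vec n T" using T by (simp add: tight_def)
  have "dot n T d = (\<Sum>k\<in>{1..n}. (if k = i then T i * Z i else 0) - (if k = j then T j * Z j else 0))"
    unfolding dot_def by (rule sum.cong) (use ij in \<open>auto simp: d_def\<close>)
  also have "\<dots> = T i * Z i - T j * Z j" using ijn by (simp add: sum_subtractf)
  finally have ne: "T i * Z i \<noteq> T j * Z j" using T by simp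
  \<comment> \<open>On the coordinates added between \<open>S\<close> and \<open>Z\<close>,
    \<open>?A\<close> keeps those where \<open>T\<close> agrees with \<open>Z\<close>, and
    \<open>?B\<close> those where \<open>T\<close> is not opposite to \<open>Z\<close>. Any two of
    the relations agreeing, zero, opposite are told apart by one of them.\<close>
  let ?A = "vmeet (vcomp S T) Z" and ?B = "vmeet (vcomp S (vjoin Z T)) Z"
  have tA: "tight x ?A" and tB: "tight x ?B"
    using S Z T by (intro tight_vjoin_vmeet[OF xP] tight_vcomp[OF xP]; simp)+
  have leAB: "vle S ?A" "vle ?A Z" "vle S ?B" "vle ?B Z"
    using le by (auto simp: vle_def vmeet_def vcomp_def)
  have A0: "?A k = 0 \<longleftrightarrow> T k \<noteq> Z k" if "S k = 0" "Z k \<noteq> 0" for k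
    using that by (auto simp: vmeet_def vcomp_def)
  have B0: "?B k = 0 \<longleftrightarrow> T k = - Z k" if "S k = 0" "Z k \<noteq> 0" for k
    using that sign_vecD[OF sZ, of k] sign_vecD[OF sT, of k]
    by (elim disjE) (simp_all add: vmeet_def vcomp_def vjoin_def)
  have prod: "T k * Z k = (if T k = Z k then 1 else if T k = - Z k then - 1 else 0)" if "Z k \<noteq> 0" for k
    using that sign_vecD[OF sZ, of k] sign_vecD[OF sT, of k] by (elim disjE) simp_all
  have "(?A i = 0) \<noteq> (?A j = 0) \<or> (?B i = 0) \<noteq> (?B j = 0)"
    using ne unfolding A0[OF ij(2,4)] A0[OF ij(3,5)] B0[OF ij(2,4)] B0[OF ij(3,5)]
      prod[OF ij(4)] prod[OF ij(5)] by (auto split: if_splits)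
  then show ?thesis
  proof (rule disjE)
    assume "(?A i = 0) \<noteq> (?A j = 0)"
    then have "?A \<noteq> S" "?A \<noteq> Z" using ij by auto
    then show ?thesis using tA leAB by blast
  next
    assume "(?B i = 0) \<noteq> (?B j = 0)"
    then have "?B \<noteq> S" "?B \<noteq> Z" using ij by auto
    then show ?thesis using tB leAB by blast
  qed
qed

lemma vle_ne_exists: "vle S Z \<Longrightarrow> S \<noteq> Z \<Longrightarrow> \<exists>i. S i = 0 \<and> Z i \<noteq> 0"
  unfolding vle_def fun_eq_iff by metis

text \<open>Among the tight vectors strictly above \<open>S\<close> and below \<open>Z\<close>, one
  of least support adds a single coordinate: two added coordinates would leave room for a smaller
  one.\<close>

lemma tight_step:
  assumes x: "x \<in> V" and S: "tight x S" and Z: "tight x Z" and le: "vle S Z" "S \<noteq> Z"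
  shows "\<exists>y \<in> codes n. S (idx n y) = 0 \<and> Z (idx n y) = sg n y \<and> tight x (\<lambda>i. S i + unit n y i)"
proof -
  let ?Q = "\<lambda>U. tight x U \<and> vle S U \<and> vle U Z \<and> U \<noteq> S"
  let ?m = "\<lambda>U. card {i. U i \<noteq> (0::real)}"
  have "?Q Z" using Z le vle_refl by auto
  from ex_has_least_nat[where P = ?Q and m = ?m, OF this]
  obtain U where U: "?Q U" and min: "\<And>U'. ?Q U' \<Longrightarrow> ?m U \<le> ?m U'" by blast
  obtain i where i: "S i = 0" "U i \<noteq> 0" using U vle_ne_exists by metis
  have only: "U j = S j" if "j \<noteq> i" for j
  proof (rule ccontr)
    assume c: "U j \<noteq> S j"
    then have "S j = 0" using U by (auto simp: vle_def)
    then have "\<exists>U'. tight x U' \<and> vle S U' \<and> vle U' U \<and> U' \<noteq> S \<and> U' \<noteq> U"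
      using tight_between[OF x S, of U i j] U i c that by auto
    then obtain U' where U': "tight x U'" "vle S U'" "vle U' U" "U' \<noteq> S" "U' \<noteq> U" by blast
    have "finite {i. U i \<noteq> 0}"
      by (rule finite_subset[of _ "{1..n}"]) (use U sign_vec_outside[of n U] in \<open>auto simp: tight_def\<close>)
    moreover have "{i. U' i \<noteq> 0} \<subset> {i. U i \<noteq> 0}"
      using U'(3) vle_ne_exists[OF U'(3,5)] by (auto simp: vle_def)
    ultimately have "?m U' < ?m U" by (rule psubset_card_mono)
    moreover have "?m U \<le> ?m U'" using U U' vle_trans by (intro min) blast
    ultimately show False by simp
  qed
  have "sign_vec n U" using U by (simp add: tight_def)
  then have "i \<in> {1..n}" "U i = 1 \<or> U i = - 1"
    using sign_vec_outside i sign_vecD[of n U i] by blast+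
  then obtain y where y: "y \<in> codes n" "idx n y = i" "sg n y = U i" using ex_code by metis
  have "(\<lambda>i. S i + unit n y i) = U"
    using only i y by (auto simp: unit_def fun_eq_iff)
  moreover have "Z i = U i" using U i(2) unfolding vle_def by blast
  moreover have "tight x U" using U by blast
  ultimately show ?thesis using y i by (intro bexI[of _ y]) simp_all
qed

text \<open>Some tight vector is not orthogonal to the i-th unit vector, hence has a nonzero entry
  at \<open>i\<close>. Composing \<open>S\<close> with it extends \<open>S\<close> there.\<close>

lemma tight_grow:
  assumes x: "x \<in> V" and S: "tight x S" and i: "i \<in> {1..n}" "S i = 0"
  shows "\<exists>Z. tight x Z \<and> vle S Z \<and> S \<noteq> Z"
proof -
  have "supported (\<lambda>k. if k = i then 1 else 0)" "(\<lambda>k. if k = i then 1 else 0::real) \<noteq> (\<lambda>k. 0)"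
    using i by (auto simp: supported_def fun_eq_iff)
  from vertex_separates[OF x this] obtain T where T: "tight x T"
    "dot n T (\<lambda>k. if k = i then 1 else 0) \<noteq> 0" by blast
  have "dot n T (\<lambda>k. if k = i then 1 else 0) = (\<Sum>k\<in>{1..n}. if k = i then T i else 0)"
    unfolding dot_def by (rule sum.cong) auto
  then have "T i \<noteq> 0" using T i by simp
  then have "vcomp S T i \<noteq> S i" using i by (simp add: vcomp_def)
  moreover have "vle S (vcomp S T)" by (simp add: vle_def vcomp_def)
  ultimately show ?thesis using tight_vcomp[OF V_in_P[OF x] S T(1)] by metis
qed

lemma tight_list_extend:
  assumes x: "x \<in> V" and l: "tight_list x l" "length l < n"
  shows "\<exists>y. tight_list x (l @ [y])"
proof -
  have c: "code_list n l" using l by (simp add: tight_list_def)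
  have sub: "idx n ` set l \<subseteq> {1..n}" using c idx_range by (auto simp: code_list_def)
  have "idx n ` set l \<noteq> {1..n}" using code_list_full_iff[OF c] l by simp
  then obtain i where i: "i \<in> {1..n}" "i \<notin> idx n ` set l" using sub by blast
  then have "svec n l i = 0" by (intro svec_notin)
  then obtain Z where Z: "tight x Z" "vle (svec n l) Z" "svec n l \<noteq> Z"
    using tight_grow[OF x tight_list_last[OF l(1)] i(1)] by blast
  obtain y where y: "y \<in> codes n" "svec n l (idx n y) = 0" "tight x (\<lambda>i. svec n l i + unit n y i)"
    using tight_step[OF x tight_list_last[OF l(1)] Z] by blast
  have "code_list n (l @ [y])" using y c svec_nz[OF c, of "idx n y"] by (simp add: code_list_snoc)
  moreover have "(\<lambda>i. svec n l i + unit n y i) = svec n (l @ [y])" by (simp add: svec_snoc fun_eq_iff)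
  ultimately have "tight_list x (l @ [y])" using y l by (simp add: tight_list_snoc tight_def)
  then show ?thesis ..
qed

lemma tight_list_complete:
  assumes "x \<in> V" "tight_list x l"
  shows "\<exists>m. tight_list x (l @ m) \<and> length (l @ m) = n"
  using assms(2)
proof (induction "n - length l" arbitrary: l)
  case 0
  then have "length l = n" using code_list_length[of n l] by (auto simp: tight_list_def)
  then show ?case using 0 by (intro exI[of _ "[]"]) simp
next
  case (Suc k)
  then have "length l < n" by simp
  then obtain y where y: "tight_list x (l @ [y])" using tight_list_extend assms Suc by blast
  have "k = n - length (l @ [y])" using Suc(2) by simp
  from Suc(1)[OF this y] obtain m where "tight_list x ((l @ [y]) @ m) \<and> length ((l @ [y]) @ m) = n" by blast
  then show ?case by (intro exI[of _ "y # m"]) simp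
qed

section \<open>Canonical chains\<close>

text \<open>The canonical chain at x that avoids the coordinates in I adds the least available code at
  every step.  It depends on the constraints that avoid I only and is therefore the same at both ends
  of an edge along which only the coordinates in I change.\<close>

definition avail :: "rvec \<Rightarrow> nat set \<Rightarrow> nat list \<Rightarrow> nat \<Rightarrow> bool" where
  "avail x I l y \<longleftrightarrow> y \<in> codes n \<and> idx n y \<notin> I \<and> idx n y \<notin> idx n ` set l \<and>
     slack x (svec n (l @ [y])) = 0"

inductive greedy_prefix :: "rvec \<Rightarrow> nat set \<Rightarrow> nat list \<Rightarrow> bool"
  for x :: "nat \<Rightarrow> real" and I :: "nat set"
where
  greedy_Nil: "greedy_prefix x I []"
| greedy_snoc: "greedy_prefix x I l \<Longrightarrow> avail x I l y \<Longrightarrow> \<forall>z<y. \<not> avail x I l z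
    \<Longrightarrow> greedy_prefix x I (l @ [y])"

definition greedy :: "rvec \<Rightarrow> nat set \<Rightarrow> nat list \<Rightarrow> bool" where
  "greedy x I l \<longleftrightarrow> greedy_prefix x I l \<and> (\<forall>y. \<not> avail x I l y)"

definition glist :: "rvec \<Rightarrow> nat set \<Rightarrow> nat list" where
  "glist x I = (THE l. greedy x I l)"

lemma greedy_prefix_snocD:
  assumes "greedy_prefix x I (l @ [y])"
  shows "greedy_prefix x I l" "avail x I l y" "\<forall>z<y. \<not> avail x I l z"
  using assms by (cases rule: greedy_prefix.cases; simp)+

lemma greedy_prefix_appendD: "greedy_prefix x I (l @ m) \<Longrightarrow> greedy_prefix x I l"
proof (induction m rule: rev_induct)
  case (snoc y m)
  then show ?case using greedy_prefix_snocD(1)[of x I "l @ m" y] by simp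
qed simp

lemma greedy_prefix_tight:
  "greedy_prefix x I l \<Longrightarrow> tight_list x l \<and> idx n ` set l \<inter> I = {}"
proof (induction rule: greedy_prefix.induct)
  case (greedy_snoc l y)
  then show ?case
    by (auto simp: tight_list_snoc code_list_snoc avail_def) (auto simp: tight_list_def)
qed simp

text \<open>The least available code is unique, and a complete canonical chain cannot stop while a
  code is available; so at every stage it continues as the prefix does.\<close>

lemma greedy_extends:
  assumes "greedy x I m"
  shows "greedy_prefix x I l \<Longrightarrow> \<exists>r. m = l @ r"
proof (induction rule: greedy_prefix.induct)
  case (greedy_snoc l y)
  then obtain r where r: "m = l @ r" by blast
  obtain z r' where z: "r = z # r'"
    using r assms greedy_snoc.hyps by (cases r) (auto simp: greedy_def)
  have "greedy_prefix x I ((l @ [z]) @ r')" using assms r z by (simp add: greedy_def)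
  then have "greedy_prefix x I (l @ [z])" by (rule greedy_prefix_appendD)
  note zl = greedy_prefix_snocD[OF this]
  have "z = y" using zl(2,3) greedy_snoc.hyps by (metis linorder_neqE_nat)
  then show ?case using r z by simp
qed simp

text \<open>Codes with distinct coordinates form a list of at most n entries, so the process stops
  at every point \<open>x\<close>. This makes \<open>glist\<close> total.\<close>

lemma greedy_prefix_completes:
  "greedy_prefix x I l \<Longrightarrow> \<exists>m. greedy x I m"
proof (induction "n - length l" arbitrary: l rule: less_induct)
  case less
  show ?case
  proof (cases "\<exists>y. avail x I l y")
    case True
    define y where "y = (LEAST y. avail x I l y)"
    have y: "avail x I l y" "\<forall>z<y. \<not> avail x I l z"
      using True LeastI_ex[of "avail x I l"] not_less_Least unfolding y_def by blast+
    have g: "greedy_prefix x I (l @ [y])" using less.prems y by (rule greedy_snoc)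
    then have "length (l @ [y]) \<le> n"
      using greedy_prefix_tight code_list_length unfolding tight_list_def by blast
    then show ?thesis using less.hyps[OF _ g] by simp
  next
    case False
    then show ?thesis using less.prems by (auto simp: greedy_def)
  qed
qed

lemma greedy_unique: "greedy x I l \<Longrightarrow> greedy x I m \<Longrightarrow> l = m"
proof -
  assume l: "greedy x I l" and m: "greedy x I m"
  obtain r where "m = l @ r" using greedy_extends[OF m] l unfolding greedy_def by blast
  moreover obtain r' where "l = m @ r'" using greedy_extends[OF l] m unfolding greedy_def by blast
  ultimately show ?thesis by simp
qed

lemma glist_eqI: "greedy x I l \<Longrightarrow> glist x I = l"
  unfolding glist_def using greedy_unique by blast

lemma greedy_glist: "greedy x I (glist x I)"
  using greedy_prefix_completes[OF greedy_Nil] glist_eqI by metis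

lemma glist_tight: "tight_list x (glist x I)"
  using greedy_glist greedy_prefix_tight unfolding greedy_def by blast

lemma glist_avoids: "idx n ` set (glist x I) \<inter> I = {}"
  using greedy_glist greedy_prefix_tight unfolding greedy_def by blast

lemma glist_code_list: "code_list n (glist x I)"
  using glist_tight by (simp add: tight_list_def)

lemma glist_full: "x \<in> V \<Longrightarrow> length (glist x {}) = n"
proof (rule ccontr)
  assume x: "x \<in> V" and "length (glist x {}) \<noteq> n"
  then have "length (glist x {}) < n" using code_list_length[OF glist_code_list, of x "{}"] by simp
  then obtain y where y: "tight_list x (glist x {} @ [y])"
    using tight_list_extend[OF x glist_tight] by blast
  then have "avail x {} (glist x {}) y" by (auto simp: tight_list_snoc code_list_snoc avail_def)
  then show False using greedy_glist[of x "{}"] by (simp add: greedy_def)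
qed

lemma glist_cong:
  assumes eq: "\<And>S. sign_vec n S \<Longrightarrow> (\<forall>i\<in>I. S i = 0) \<Longrightarrow> slack x S = slack z S"
  shows "glist x I = glist z I"
proof -
  have av: "avail x I l y \<longleftrightarrow> avail z I l y" if l: "code_list n l" "idx n ` set l \<inter> I = {}" for l y
  proof -
    have "slack x (svec n (l @ [y])) = slack z (svec n (l @ [y]))"
      if "y \<in> codes n" "idx n y \<notin> I" "idx n y \<notin> idx n ` set l"
    proof (rule eq)
      show "sign_vec n (svec n (l @ [y]))" using l that by (simp add: code_list_snoc sign_vec_svec)
      show "\<forall>i\<in>I. svec n (l @ [y]) i = 0"
      proof
        fix i assume "i \<in> I"
        then have "i \<notin> idx n ` set (l @ [y])" using l(2) that by auto
        then show "svec n (l @ [y]) i = 0" by (rule svec_notin)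
      qed
    qed
    then show ?thesis by (auto simp: avail_def)
  qed
  have "greedy_prefix z I l" if "greedy_prefix x I l" for l
    using that
  proof (induction rule: greedy_prefix.induct)
    case (greedy_snoc l y)
    have "code_list n l" "idx n ` set l \<inter> I = {}"
      using greedy_prefix_tight[OF greedy_snoc.hyps(1)] by (auto simp: tight_list_def)
    then have "avail x I l = avail z I l" using av by blast
    then show ?case using greedy_snoc.hyps greedy_snoc.IH by (auto intro: greedy_prefix.greedy_snoc)
  qed (rule greedy_Nil)
  then have "greedy z I (glist x I)"
    using greedy_glist[of x I] av[OF glist_code_list glist_avoids, of x] unfolding greedy_def by metis
  then show ?thesis using glist_eqI by metis
qed

end

section \<open>Moves along edges\<close>

lemma svec_notin_append: "i \<notin> idx n ` set m \<Longrightarrow> svec n (l @ m) i = svec n l i"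
  by (simp add: svec_append svec_notin)

text \<open>Serves to carry tightness upwards, from \<open>l @ m\<close> to the chain with
  \<open>r\<close> inserted.\<close>

lemma vcomp_svec:
  assumes c: "code_list n (l @ r @ m)"
  shows "vcomp (svec n (l @ r)) (svec n (l @ m)) = svec n (l @ r @ m)"
proof
  fix i
  have lr: "code_list n (l @ r)" and d: "idx n ` set (l @ r) \<inter> idx n ` set m = {}"
    using c unfolding code_list_append by auto
  show "vcomp (svec n (l @ r)) (svec n (l @ m)) i = svec n (l @ r @ m) i"
  proof (cases "i \<in> idx n ` set (l @ r)")
    case True
    then have "i \<notin> idx n ` set m" using d by blast
    moreover have "svec n (l @ r) i \<noteq> 0" using svec_nz[OF lr] True by blast
    ultimately show ?thesis
      using svec_notin_append[of i n m "l @ r"] by (simp add: vcomp_def)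
  next
    case False
    then have "svec n r i = 0" "svec n (l @ r) i = 0" by (auto intro!: svec_notin)
    then show ?thesis by (simp add: vcomp_def svec_append)
  qed
qed

text \<open>Serves to carry tightness downwards: codes that occur in only one of the two lists
  vanish under the meet.\<close>

lemma vmeet_svec:
  assumes c: "code_list n (l @ r @ m @ k)"
  shows "vmeet (svec n (l @ r @ m)) (svec n (l @ k @ m)) = svec n (l @ m)"
proof
  fix i
  have d: "idx n ` set r \<inter> idx n ` set k = {}" "idx n ` set r \<inter> idx n ` set (l @ m) = {}"
    "idx n ` set k \<inter> idx n ` set (l @ m) = {}"
    using c unfolding code_list_append by auto
  have cr: "code_list n r" "code_list n k" using c unfolding code_list_append by auto
  consider "i \<in> idx n ` set r" | "i \<in> idx n ` set k" | "i \<notin> idx n ` set r" "i \<notin> idx n ` set k"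
    by blast
  then show "vmeet (svec n (l @ r @ m)) (svec n (l @ k @ m)) i = svec n (l @ m) i"
  proof cases
    case 1
    then have "svec n k i = 0" "svec n (l @ m) i = 0" using d by (blast intro: svec_notin)+
    then show ?thesis by (simp add: vmeet_def svec_append)
  next
    case 2
    then have "svec n r i = 0" "svec n (l @ m) i = 0" using d by (blast intro: svec_notin)+
    then show ?thesis by (simp add: vmeet_def svec_append)
  next
    case 3
    then have "svec n r i = 0" "svec n k i = 0" by (blast intro: svec_notin)+
    then show ?thesis by (simp add: vmeet_def svec_append)
  qed
qed

context bisub
begin

text \<open>In a chain T, T + b, T + b + a, ... of tight vectors at v, the member T + b is replaced by
  T + a.  If a = - b, then T + b is the last member of the chain, and the move changes one coordinate
  only.  For T the canonical chain that avoids the coordinates of a and b is taken.  The length W of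
  the move is 0 if the vectors required are not tight.\<close>

definition dvec :: "nat \<Rightarrow> nat \<Rightarrow> nat \<Rightarrow> real" where
  "dvec a b = (\<lambda>i. unit n a i - (if idx n a = idx n b then 0 else unit n b i))"

definition W :: "rvec \<Rightarrow> nat \<Rightarrow> nat \<Rightarrow> real" where
  "W v a b = (let l = glist v {idx n a, idx n b} in
     if slack v (svec n (l @ [b])) = 0 \<and>
        (if idx n a = idx n b then length l = n - 1 else slack v (svec n (l @ [b, a])) = 0)
     then slack v (svec n (l @ [a])) else 0)"

definition E :: "rvec \<Rightarrow> nat \<Rightarrow> nat \<Rightarrow> nat \<Rightarrow> real" where
  "E v a b = (\<lambda>i. v i + W v a b * dvec a b i)"

lemma dot_commute: "dot n S T = dot n T S"
  by (simp add: dot_def mult.commute)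

lemma dot_dvec:
  assumes "a \<in> codes n" "b \<in> codes n"
  shows "dot n S (dvec a b) =
    sg n a * S (idx n a) - (if idx n a = idx n b then 0 else sg n b * S (idx n b))"
proof -
  have "dot n S (\<lambda>i. unit n a i - unit n b i) = dot n S (unit n a) - dot n S (unit n b)"
    by (simp add: dot_def right_diff_distrib sum_subtractf)
  then show ?thesis
    using dot_unit[OF assms(1)] dot_unit[OF assms(2)] dot_commute[of S]
    by (simp add: dvec_def)
qed

lemma supported_dvec: "a \<in> codes n \<Longrightarrow> b \<in> codes n \<Longrightarrow> supported (dvec a b)"
  using idx_range[of a n] idx_range[of b n] by (auto simp: supported_def dvec_def unit_def)

text \<open>The edge is the face cut out by all constraints that are tight at both ends. Assumption
  \<open>line\<close> leaves these equations one degree of freedom, so the affine hull of the face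
  is the line through \<open>v\<close> and \<open>u\<close>.\<close>

lemma adjacentI:
  assumes v: "v \<in> V" and u: "u \<in> V" and ud: "u = (\<lambda>i. v i + w * d i)" and w: "w \<noteq> 0"
    and d: "d \<noteq> (\<lambda>i. 0)"
    and line: "\<And>x. supported x \<Longrightarrow>
      (\<forall>S. sign_vec n S \<longrightarrow> slack v S = 0 \<longrightarrow> slack u S = 0 \<longrightarrow> slack x S = 0) \<Longrightarrow>
      \<exists>t. x = (\<lambda>i. v i + t * d i)"
  shows "{v, u} \<in> adjacent_pairs P"
proof -
  define F where "F = {x \<in> P. \<forall>S. sign_vec n S \<longrightarrow> slack v S = 0 \<longrightarrow> slack u S = 0 \<longrightarrow> slack x S = 0}"
  have vu: "v \<in> F" "u \<in> F" using V_in_P v u by (auto simp: F_def)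
  obtain i where i: "d i \<noteq> 0" using d by auto
  have ne: "v \<noteq> u"
  proof
    assume "v = u"
    then have "v i = v i + w * d i" using fun_cong[OF ud, of i] by simp
    then show False using w i by simp
  qed
  have "F face_of P"
    unfolding face_of_def
  proof (intro conjI ballI impI)
    show "F \<subseteq> P" by (auto simp: F_def)
    show "convex F"
    proof (unfold convex_alt, intro ballI allI impI)
      fix x y and t :: real assume h: "x \<in> F" "y \<in> F" "0 \<le> t \<and> t \<le> 1"
      have e: "(1 - t) *\<^sub>R x + t *\<^sub>R y = (\<lambda>i. (1 - t) * x i + t * y i)"
        by (simp add: scaleR_fun_def fun_eq_iff)
      have "(1 - t) *\<^sub>R x + t *\<^sub>R y \<in> P"
        using convex_P h unfolding convex_alt F_def by blast
      then show "(1 - t) *\<^sub>R x + t *\<^sub>R y \<in> F"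
        using h unfolding F_def e by (auto simp: slack_segment[OF refl])
    qed
    fix a b x assume h: "a \<in> P" "b \<in> P" "x \<in> F" "x \<in> open_segment a b"
    show "a \<in> F" "b \<in> F"
      using slack_open_segment[OF h(1,2,4)] h by (auto simp: F_def)
  qed
  moreover have "affine hull F = affine hull {v, u}"
  proof
    show "affine hull {v, u} \<subseteq> affine hull F" using vu by (intro hull_mono) auto
    show "affine hull F \<subseteq> affine hull {v, u}"
    proof (rule hull_minimal)
      show "F \<subseteq> affine hull {v, u}"
      proof
        fix x assume "x \<in> F"
        then obtain t where t: "x = (\<lambda>i. v i + t * d i)"
          using line P_supported unfolding F_def by blast
        have "x = (1 - t / w) *\<^sub>R v + (t / w) *\<^sub>R u"
          using w by (simp add: t ud scaleR_fun_def fun_eq_iff algebra_simps)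
        moreover have "(1 - t / w) + t / w = 1" by simp
        ultimately show "x \<in> affine hull {v, u}" unfolding affine_hull_2 by blast
      qed
    qed (rule affine_affine_hull)
  qed
  ultimately have "is_edge F P" unfolding is_edge_def using ne by blast
  then show ?thesis
    unfolding adjacent_pairs_def using v u vu ne by (auto simp: V_def)
qed

lemma W_nonzeroD:
  assumes "W v a b \<noteq> 0"
  defines "l \<equiv> glist v {idx n a, idx n b}"
  shows "slack v (svec n (l @ [b])) = 0" "W v a b = slack v (svec n (l @ [a]))"
    "idx n a = idx n b \<Longrightarrow> length l = n - 1"
    "idx n a \<noteq> idx n b \<Longrightarrow> slack v (svec n (l @ [b, a])) = 0"
  using assms(1) by (auto simp: W_def Let_def l_def split: if_splits)

lemma slack_move:
  assumes "a \<in> codes n" "b \<in> codes n"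
  shows "slack (\<lambda>i. v i + w * dvec a b i) S =
    slack v S - w * (sg n a * S (idx n a) - (if idx n a = idx n b then 0 else sg n b * S (idx n b)))"
  by (simp add: slack_add_right dot_dvec assms)

lemma svec_pair:
  assumes "idx n a \<notin> idx n ` set l" "idx n b \<notin> idx n ` set l"
  shows "svec n l (idx n a) = 0" "svec n l (idx n b) = 0"
    "svec n (l @ [a]) (idx n a) = sg n a"
    "idx n a \<noteq> idx n b \<Longrightarrow> svec n (l @ [a]) (idx n b) = 0"
    "svec n (l @ [b]) (idx n b) = sg n b"
    "idx n a \<noteq> idx n b \<Longrightarrow> svec n (l @ [b]) (idx n a) = 0"
  using assms by (simp_all add: svec_snoc svec_notin unit_def)

lemma svec_swap: "svec n (l @ a # b # m) = svec n (l @ b # a # m)"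
  by (simp add: svec_append fun_eq_iff)

lemma glist_move:
  assumes "a \<in> codes n" "b \<in> codes n" "u = (\<lambda>i. v i + w * dvec a b i)"
  shows "glist u {idx n a, idx n b} = glist v {idx n a, idx n b}"
proof (rule glist_cong)
  fix S :: "nat \<Rightarrow> real"
  assume "\<forall>i\<in>{idx n a, idx n b}. S i = 0"
  then show "slack u S = slack v S" by (simp add: assms slack_move)
qed

lemma tight_list_prefix_cong:
  assumes t: "tight_list v l" and eq: "\<And>S. (\<forall>i. i \<notin> idx n ` set l \<longrightarrow> S i = 0) \<Longrightarrow> slack u S = slack v S"
  shows "tight_list u l"
  unfolding tight_list_def
proof (intro conjI allI impI)
  show "code_list n l" using t by (simp add: tight_list_def)
  fix k assume k: "k \<le> length l"
  have "svec n (take k l) i = 0" if "i \<notin> idx n ` set l" for i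
    by (rule svec_notin) (use that in \<open>auto dest: in_set_takeD\<close>)
  then have "slack u (svec n (take k l)) = slack v (svec n (take k l))" by (intro eq) auto
  then show "slack u (svec n (take k l)) = 0" using t k by (simp add: tight_list_def)
qed

text \<open>A nonzero length is the slack of a valid constraint at \<open>v\<close>.\<close>

lemma W_pos: "v \<in> V \<Longrightarrow> a \<in> codes n \<Longrightarrow> W v a b \<noteq> 0 \<Longrightarrow> W v a b > 0"
proof -
  assume v: "v \<in> V" and a: "a \<in> codes n" and W: "W v a b \<noteq> 0"
  let ?l = "glist v {idx n a, idx n b}"
  have "code_list n (?l @ [a])"
    using a glist_code_list[of v "{idx n a, idx n b}"] glist_avoids[of v "{idx n a, idx n b}"]
    by (auto simp: code_list_snoc)
  then have "slack v (svec n (?l @ [a])) \<ge> 0" using slack_nonneg[OF V_in_P[OF v]] sign_vec_svec by blast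
  then show ?thesis using W W_nonzeroD(2)[OF W] by simp
qed

text \<open>A move of length w uses up the slack of T + a and opens the slack w at T + b, where T is
  \<open>svec n l\<close>; the other members of the chain contain neither or both of a and b and
  keep their slack. Exchanging a and b in a maximal chain thus gives a maximal tight chain at the
  new point, and the way back is symmetric.\<close>

lemma move_generic:
  assumes v: "v \<in> V" and a: "a \<in> codes n" and b: "b \<in> codes n" and W: "W v a b \<noteq> 0"
    and ab: "idx n a \<noteq> idx n b"
  shows "E v a b \<in> V" "W (E v a b) b a = W v a b" "{v, E v a b} \<in> adjacent_pairs P"
proof -
  define l where "l = glist v {idx n a, idx n b}"
  define w where "w = W v a b"
  define u where "u = E v a b"
  have u: "u = (\<lambda>i. v i + w * dvec a b i)" by (simp add: u_def E_def w_def)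
  note wd = W_nonzeroD[OF W, folded l_def w_def]
  have lt: "tight_list v l" and lc: "code_list n l" unfolding l_def by (rule glist_tight glist_code_list)+
  have av: "idx n a \<notin> idx n ` set l" "idx n b \<notin> idx n ` set l"
    using glist_avoids[of v "{idx n a, idx n b}"] by (auto simp: l_def)
  note sp = svec_pair[OF av]
  note sm = slack_move[OF a b, of v w, folded u]
  have cb: "code_list n (l @ [b])" "code_list n (l @ [b, a])" "code_list n (l @ [a])" "code_list n (l @ [a, b])"
    using lc av a b ab by (auto simp: code_list_append) (auto simp: code_list_def)
  have "tight_list v (l @ [b])" using lt cb wd(1) by (simp add: tight_list_snoc)
  then have "tight_list v ((l @ [b]) @ [a])" unfolding tight_list_snoc using cb wd(4) ab by simp
  then have tba: "tight_list v (l @ [b, a])" by simp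
  obtain m where "tight_list v ((l @ [b, a]) @ m) \<and> length ((l @ [b, a]) @ m) = n"
    using tight_list_complete[OF v tba] by blast
  then have m: "tight_list v (l @ b # a # m)" "length (l @ b # a # m) = n" by simp_all
  have cm: "code_list n ((l @ [b, a]) @ m)" using m by (simp add: tight_list_def)
  then have dm: "idx n a \<notin> idx n ` set m" "idx n b \<notin> idx n ` set m"
    unfolding code_list_append[of n "l @ [b, a]"] by auto
  have tua: "slack u (svec n (l @ [a])) = 0"
    using sm[of "svec n (l @ [a])"] sp wd(2) ab by simp
  have tub: "slack u (svec n (l @ [b])) = w"
    using sm[of "svec n (l @ [b])"] sp wd(1) ab by simp
  have tv: "tight_list v ((l @ [b, a]) @ take k m)" for k
    using m(1) tight_list_appendD[of v "(l @ [b, a]) @ take k m" "drop k m"] by simp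
  then have tv: "slack v (svec n (l @ b # a # take k m)) = 0" for k
    using tight_list_last[OF tv[of k]] by (simp add: tight_def)
  \<comment> \<open>Both codes are present, so their contributions to the change cancel.\<close>
  have tail: "slack u (svec n (l @ b # a # take k m)) = 0" for k
  proof -
    have "idx n a \<notin> idx n ` set (take k m)" "idx n b \<notin> idx n ` set (take k m)"
      using dm by (auto dest: in_set_takeD)
    then have "svec n (l @ b # a # take k m) (idx n a) = sg n a"
      "svec n (l @ b # a # take k m) (idx n b) = sg n b"
      using av ab by (simp_all add: svec_append svec_notin unit_def)
    then show ?thesis using sm ab tv by simp
  qed
  have tul: "tight_list u l"
    using lt
  proof (rule tight_list_prefix_cong)
    fix S :: "nat \<Rightarrow> real" assume "\<forall>i. i \<notin> idx n ` set l \<longrightarrow> S i = 0"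
    then show "slack u S = slack v S" using sm[of S] av by simp
  qed
  have tail': "slack u (svec n (l @ a # b # take k m)) = 0" for k
    using tail[of k] svec_swap[of l a b "take k m"] by simp
  have uf: "tight_list u (l @ a # b # m)"
    unfolding tight_list_def
  proof (intro conjI allI impI)
    show "code_list n (l @ a # b # m)" using cm by (auto simp: code_list_def)
    fix k
    show "slack u (svec n (take k (l @ a # b # m))) = 0"
    proof (cases "k \<le> length l + 1")
      case True
      then have "k \<le> length l \<or> k = length l + 1" by linarith
      then show ?thesis using tul tua by (auto simp: tight_list_def)
    next
      case False
      then obtain k' where "k = length l + 2 + k'" using le_Suc_ex[of "length l + 2" k] by auto
      then show ?thesis using tail'[of k'] by simp
    qed
  qed
  have su: "supported u"
    using P_supported[OF V_in_P[OF v]] supported_dvec[OF a b] by (simp add: u supported_def)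
  show uV: "E v a b \<in> V"
    using full_tight_list_vertex[OF uf _ su] m(2) by (simp add: u_def)
  have gu: "glist u {idx n b, idx n a} = l"
    using glist_move[OF a b u] by (simp add: l_def insert_commute)
  show "W (E v a b) b a = W v a b"
    unfolding u_def[symmetric] using gu tua tub tail'[of 0] ab by (simp add: W_def[of u] w_def)
  show "{v, E v a b} \<in> adjacent_pairs P"
  proof (rule adjacentI[OF v uV])
    show "E v a b = (\<lambda>i. v i + w * dvec a b i)" using u u_def by simp
    show "w \<noteq> 0" using W by (simp add: w_def)
    have "dvec a b (idx n a) \<noteq> 0" using ab by (simp add: dvec_def)
    then show "dvec a b \<noteq> (\<lambda>i. 0)" by auto
    fix x assume x: "supported x"
      and "\<forall>S. sign_vec n S \<longrightarrow> slack v S = 0 \<longrightarrow> slack (E v a b) S = 0 \<longrightarrow> slack x S = 0"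
    then have com: "slack x S = 0" if "sign_vec n S" "slack v S = 0" "slack u S = 0" for S
      using that by (simp add: u_def)
    have txl: "slack x (svec n (take k l)) = 0" if "k \<le> length l" for k
      using com tight_listD[OF lt that] tight_listD[OF tul that] by (auto simp: tight_def)
    have txm: "slack x (svec n (l @ b # a # take k m)) = 0" for k
    proof (rule com)
      have "code_list n ((l @ [b, a]) @ take k m)"
        using cm unfolding code_list_append[of n "l @ [b, a]"]
        by (auto intro: code_list_take dest!: in_set_takeD)
      then show "sign_vec n (svec n (l @ b # a # take k m))" using sign_vec_svec by fastforce
      show "slack u (svec n (l @ b # a # take k m)) = 0" by (rule tail)
      show "slack v (svec n (l @ b # a # take k m)) = 0" by (rule tv)
    qed
    have lm: "y \<in> codes n" if "y \<in> set l \<or> y \<in> set m" for y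
      using cm that by (auto simp: code_list_def)
    \<comment> \<open>The pairs of consecutive members below T and above T + b + a are tight at both
      ends, hence at \<open>x\<close>; they fix every coordinate other than those of a and
      b.\<close>
    have xi: "x i = v i" if i: "i \<in> {1..n}" "i \<noteq> idx n a" "i \<noteq> idx n b" for i
    proof -
      have "i \<in> idx n ` set ((l @ [b, a]) @ m)"
        using code_list_full_iff[OF cm] m(2) i by auto
      then obtain y where y: "i = idx n y" "y \<in> set l \<or> y \<in> set m" using i by auto
      then show ?thesis
      proof (elim disjE)
        assume "y \<in> set l"
        then obtain k where k: "k < length l" "l ! k = y" by (auto simp: in_set_conv_nth)
        then have t: "take (Suc k) l = take k l @ [y]" using take_Suc_conv_app_nth by metis
        show ?thesis unfolding y(1)
          using txl[of k] txl[of "Suc k"] tight_listD[OF lt, of k] tight_listD[OF lt, of "Suc k"] k t y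
          by (intro tight_step_coordinate[of y x "take k l"] lm) (simp_all add: tight_def)
      next
        assume "y \<in> set m"
        then obtain k where k: "k < length m" "m ! k = y" by (auto simp: in_set_conv_nth)
        then have t: "l @ b # a # take (Suc k) m = (l @ b # a # take k m) @ [y]"
          using take_Suc_conv_app_nth[OF k(1)] by simp
        show ?thesis unfolding y(1)
          using txm[of k] txm[of "Suc k"] tv[of k] tv[of "Suc k"] t y
          by (intro tight_step_coordinate[of y x "l @ b # a # take k m"] lm) simp_all
      qed
    qed
    \<comment> \<open>Of the last two coordinates only the signed sum is fixed, by T and T + b + a.
      This leaves the one degree of freedom.\<close>
    have sum: "sg n a * x (idx n a) + sg n b * x (idx n b) = sg n a * v (idx n a) + sg n b * v (idx n b)"
    proof -
      have "dot n (svec n ((l @ [b]) @ [a])) z = dot n (svec n l) z + sg n b * z (idx n b) + sg n a * z (idx n a)" for z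
        by (simp only: dot_snoc[OF a] dot_snoc[OF b])
      moreover have "slack x (svec n ((l @ [b]) @ [a])) = slack v (svec n ((l @ [b]) @ [a]))"
        using txm[of 0] wd(4)[OF ab] by simp
      moreover have "slack x (svec n l) = slack v (svec n l)"
        using txl[of "length l"] tight_list_last[OF lt] by (simp add: tight_def)
      ultimately show ?thesis by (simp add: slack_def)
    qed
    show "\<exists>t. x = (\<lambda>i. v i + t * dvec a b i)"
    proof (intro exI ext)
      fix i
      have sv: "supported v" using P_supported V_in_P v by blast
      let ?t = "sg n a * (x (idx n a) - v (idx n a))"
      consider "i = idx n a" | "i = idx n b" | "i \<noteq> idx n a" "i \<noteq> idx n b" by blast
      then show "x i = v i + ?t * dvec a b i"
      proof cases
        case 1
        then show ?thesis using ab sg_cases[of n a] by (auto simp: dvec_def)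
      next
        case 2
        then show ?thesis using sum ab sg_cases[of n a] sg_cases[of n b] by (auto simp: dvec_def)
      next
        case 3
        then show ?thesis
          using xi[of i] x sv by (cases "i \<in> {1..n}") (auto simp: dvec_def supported_def)
      qed
    qed
  qed
qed

text \<open>Here T omits a single coordinate, so T + b and T + a are both tops of maximal chains and
  the move reverses the sign of the last code. The members up to T fix all other
  coordinates.\<close>

lemma move_flip:
  assumes v: "v \<in> V" and a: "a \<in> codes n" and b: "b \<in> codes n" and W: "W v a b \<noteq> 0"
    and ab: "idx n a = idx n b"
  shows "E v a b \<in> V" "W (E v a b) b a = W v a b" "{v, E v a b} \<in> adjacent_pairs P"
proof -
  define l where "l = glist v {idx n a, idx n b}"
  define w where "w = W v a b"
  define u where "u = E v a b"
  have u: "u = (\<lambda>i. v i + w * dvec a b i)" by (simp add: u_def E_def w_def)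
  note wd = W_nonzeroD[OF W, folded l_def w_def]
  have w: "w \<noteq> 0" using W by (simp add: w_def)
  then have "a \<noteq> b" using wd(1,2) by auto
  then have bn: "b = neg n a" using same_idx[OF a b ab] by simp
  then have sb: "sg n b = - sg n a" using sg_neg[OF a] by simp
  have lt: "tight_list v l" and lc: "code_list n l" unfolding l_def by (rule glist_tight glist_code_list)+
  have av: "idx n a \<notin> idx n ` set l" "idx n b \<notin> idx n ` set l"
    using glist_avoids[of v "{idx n a, idx n b}"] by (auto simp: l_def)
  note sp = svec_pair[OF av]
  note sm = slack_move[OF a b, of v w, folded u]
  have cb: "code_list n (l @ [b])" "code_list n (l @ [a])"
    using lc av a b by (auto simp: code_list_append)
  have len: "length (l @ [a]) = n" using wd(3)[OF ab] n_pos by simp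
  have tul: "tight_list u l"
    using lt
  proof (rule tight_list_prefix_cong)
    fix S :: "nat \<Rightarrow> real" assume "\<forall>i. i \<notin> idx n ` set l \<longrightarrow> S i = 0"
    then show "slack u S = slack v S" using sm[of S] av ab by simp
  qed
  have tua: "slack u (svec n (l @ [a])) = 0"
    using sm[of "svec n (l @ [a])"] sp wd(2) ab by simp
  have tub: "slack u (svec n (l @ [b])) = w"
    using sm[of "svec n (l @ [b])"] sp(5) wd(1) ab sb by simp
  have uf: "tight_list u (l @ [a])" using tul cb tua by (simp add: tight_list_snoc)
  have su: "supported u"
    using P_supported[OF V_in_P[OF v]] supported_dvec[OF a b] by (simp add: u supported_def)
  show uV: "E v a b \<in> V"
    using full_tight_list_vertex[OF uf len su] by (simp add: u_def)
  have gu: "glist u {idx n b, idx n a} = l"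
    using glist_move[OF a b u] by (simp add: l_def insert_commute)
  then show "W (E v a b) b a = W v a b"
    unfolding u_def[symmetric] using tua tub ab wd(3)[OF ab] by (simp add: W_def[of u] w_def)
  show "{v, E v a b} \<in> adjacent_pairs P"
  proof (rule adjacentI[OF v uV])
    show "E v a b = (\<lambda>i. v i + w * dvec a b i)" using u u_def by simp
    show "w \<noteq> 0" by (fact w)
    have dv: "dvec a b i = unit n a i" for i using ab by (simp add: dvec_def)
    have "dvec a b (idx n a) \<noteq> 0" by (simp add: dv)
    then show "dvec a b \<noteq> (\<lambda>i. 0)" by auto
    fix x assume x: "supported x"
      and "\<forall>S. sign_vec n S \<longrightarrow> slack v S = 0 \<longrightarrow> slack (E v a b) S = 0 \<longrightarrow> slack x S = 0"
    then have com: "slack x S = 0" if "sign_vec n S" "slack v S = 0" "slack u S = 0" for S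
      using that by (simp add: u_def)
    have txl: "slack x (svec n (take k l)) = 0" if "k \<le> length l" for k
      using com tight_listD[OF lt that] tight_listD[OF tul that] by (auto simp: tight_def)
    have xi: "x i = v i" if i: "i \<in> {1..n}" "i \<noteq> idx n a" for i
    proof -
      have "i \<in> idx n ` set (l @ [a])"
        using code_list_full_iff[OF cb(2)] len i by auto
      then obtain y where y: "i = idx n y" "y \<in> set l" using i by auto
      then obtain k where k: "k < length l" "l ! k = y" by (auto simp: in_set_conv_nth)
      then have t: "take (Suc k) l = take k l @ [y]" using take_Suc_conv_app_nth by metis
      have yc: "y \<in> codes n" using y lc by (auto simp: code_list_def)
      show ?thesis unfolding y(1)
        using txl[of k] txl[of "Suc k"] tight_listD[OF lt, of k] tight_listD[OF lt, of "Suc k"] k t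
        by (intro tight_step_coordinate[of y x "take k l"] yc) (simp_all add: tight_def)
    qed
    show "\<exists>t. x = (\<lambda>i. v i + t * dvec a b i)"
    proof (intro exI ext)
      fix i
      have sv: "supported v" using P_supported V_in_P v by blast
      show "x i = v i + sg n a * (x (idx n a) - v (idx n a)) * dvec a b i"
      proof (cases "i = idx n a")
        case True
        then show ?thesis using sg_cases[of n a] by (auto simp: dv)
      next
        case False
        then show ?thesis
          using xi[of i] x sv by (cases "i \<in> {1..n}") (auto simp: dv supported_def)
      qed
    qed
  qed
qed

text \<open>The lengths of the two directions agree and \<open>dvec\<close> is antisymmetric, so
  exchanging a and b inverts the move. For equal coordinates antisymmetry rests on
  \<open>b = neg n a\<close>: a nonzero length excludes a = b.\<close>

lemma move:
  assumes "v \<in> V" "a \<in> codes n" "b \<in> codes n" "W v a b \<noteq> 0"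
  shows "E v a b \<in> V" "W (E v a b) b a = W v a b" "{v, E v a b} \<in> adjacent_pairs P"
    "E (E v a b) b a = v"
proof -
  have m: "E v a b \<in> V \<and> W (E v a b) b a = W v a b \<and> {v, E v a b} \<in> adjacent_pairs P"
  proof (cases "idx n a = idx n b")
    case True
    then show ?thesis using move_flip[OF assms] by simp
  next
    case False
    then show ?thesis using move_generic[OF assms] by simp
  qed
  then show "E v a b \<in> V" "W (E v a b) b a = W v a b" "{v, E v a b} \<in> adjacent_pairs P" by auto
  have "dvec b a i = - dvec a b i" for i
  proof (cases "idx n a = idx n b")
    case True
    have "W v a b = 0" if "a = b" using that by (auto simp: W_def Let_def)
    then have "b = neg n a" using same_idx[OF assms(2,3) True] assms(4) by blast
    then have "sg n b = - sg n a" using sg_neg[OF assms(2)] by simp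
    then show ?thesis using True by (simp add: dvec_def unit_def)
  next
    case False
    then show ?thesis by (simp add: dvec_def)
  qed
  then have "E v a b i + W (E v a b) b a * dvec b a i = v i" for i
    using m by (simp add: E_def[of v a b])
  then show "E (E v a b) b a = v"
    by (intro ext) (simp add: E_def[of "E v a b" b a])
qed

end

section \<open>The local search function\<close>

text \<open>The state is the previous code and the last descent found. Being a left fold with a
  state of constant size, it can be updated while the chain is built. The initial code 0 prevents a
  descent at the first entry.\<close>

fun dstep :: "nat \<times> nat \<times> nat \<Rightarrow> nat \<Rightarrow> nat \<times> nat \<times> nat" where
  "dstep (p, a, b) y = (y, if y < p then (p, y) else (a, b))"

definition descent :: "nat list \<Rightarrow> nat \<times> nat \<times> nat" where
  "descent l = foldl dstep (0, 0, 0) l"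

lemma descent_snoc: "descent (l @ [y]) = dstep (descent l) y"
  by (simp add: descent_def)

lemma descent_cases:
  assumes "descent l = (p, a, b)"
  shows "p = (if l = [] then 0 else last l) \<and>
    (a = 0 \<and> b = 0 \<and> sorted l \<or> (\<exists>l1 l2. l = l1 @ [a, b] @ l2 \<and> b < a))"
  using assms
proof (induction l arbitrary: p a b rule: rev_induct)
  case Nil
  then show ?case by (simp add: descent_def)
next
  case (snoc y l)
  obtain p' a' b' where d: "descent l = (p', a', b')" by (metis prod_cases3)
  note IH = snoc.IH[OF d]
  have p: "p = y" and ab: "(a, b) = (if y < p' then (p', y) else (a', b'))"
    using snoc.prems d by (auto simp: descent_snoc)
  show ?case
  proof (cases "y < p'")
    case True
    then have "l \<noteq> []" "p' = last l" using IH by (auto split: if_splits)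
    then have "l @ [y] = butlast l @ [a, b] @ [] \<and> b < a" using ab True by simp
    then show ?thesis using p by (metis last_snoc snoc_eq_iff_butlast)
  next
    case False
    then have e: "a = a'" "b = b'" using ab by auto
    show ?thesis
    proof (cases "a' = 0 \<and> b' = 0 \<and> sorted l")
      case True
      have "\<forall>z\<in>set l. z \<le> y"
      proof
        fix z assume z: "z \<in> set l"
        then have "z \<le> last l" using True by (cases l rule: rev_cases) (auto simp: sorted_append)
        moreover have "p' = last l" using IH z by auto
        ultimately show "z \<le> y" using False by simp
      qed
      then show ?thesis using True e p by (auto simp: sorted_append)
    next
      case nt: False
      then obtain l1 l2 where "l = l1 @ [a', b'] @ l2" "b' < a'" using IH by blast
      then have "l @ [y] = l1 @ [a, b] @ (l2 @ [y])" "b < a" using e by auto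
      then show ?thesis using p by auto
    qed
  qed
qed

lemma descent_sorted: "sorted l \<Longrightarrow> descent l = (if l = [] then 0 else last l, 0, 0)"
proof -
  assume s: "sorted l"
  obtain p a b where d: "descent l = (p, a, b)" by (metis prod_cases3)
  have "\<not> (\<exists>l1 l2. l = l1 @ [a, b] @ l2 \<and> b < a)"
    using s by (auto simp: sorted_append)
  then show ?thesis using descent_cases[OF d] d by auto
qed

context bisub
begin

text \<open>Any descent would serve; the fold finds the last one, and (0, 0) if there is none.  Appending
  the negative of the last code makes an improving change of its sign appear as a descent.\<close>

definition pair :: "rvec \<Rightarrow> nat \<times> nat" where
  "pair x = (let l = glist x {} in snd (descent (l @ [neg n (last l)])))"

text \<open>The arguments of \<open>E\<close> are exchanged: the pair (a, b) is the one that leads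
  from the parent to x, so the move to the parent takes b in place of a.\<close>

definition g :: "rvec \<Rightarrow> nat \<Rightarrow> real" where
  "g x = E x (snd (pair x)) (fst (pair x))"

definition obj :: "rvec \<Rightarrow> real" where
  "obj x = dot n (\<lambda>i. real (n + 1 - i)) x"

text \<open>The greedy solution for positive decreasing weights: the increments of f along the chain
  1, ..., n.\<close>

definition sink :: "nat \<Rightarrow> real" where
  "sink i = (if i \<in> {1..n} then f (signed_set_of n (svec n [1..<i + 1])) - f (signed_set_of n (svec n [1..<i])) else 0)"

lemma glist_nonempty: "x \<in> V \<Longrightarrow> glist x {} \<noteq> []"
  using glist_full[of x] n_pos by auto

lemma glist_codes: "y \<in> set (glist x I) \<Longrightarrow> y \<in> codes n"
  using glist_code_list[of x I] by (auto simp: code_list_def)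

text \<open>In \<open>swap\<close> the descent lies inside the chain; in \<open>flip\<close> it is
  formed by the last code and the appended negative of it.\<close>

lemma pair_cases:
  assumes x: "x \<in> V" and p: "pair x = (a, b)"
  defines "l \<equiv> glist x {}"
  obtains (sink) "a = 0" "b = 0" "sorted (l @ [neg n (last l)])"
  | (swap) l1 l2 where "l = l1 @ [a, b] @ l2" "b < a"
  | (flip) l1 where "l = l1 @ [a]" "b = neg n a" "b < a"
proof -
  have ne: "l \<noteq> []" using glist_nonempty x l_def by simp
  obtain q where d: "descent (l @ [neg n (last l)]) = (q, a, b)"
    using p unfolding pair_def l_def[symmetric] Let_def by (metis prod.collapse)
  have "(a = 0 \<and> b = 0 \<and> sorted (l @ [neg n (last l)])) \<or>
    (\<exists>l1 l2. l @ [neg n (last l)] = l1 @ [a, b] @ l2 \<and> b < a)"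
    using descent_cases[OF d] by blast
  then show ?thesis
  proof (elim disjE conjE exE)
    assume "a = 0" "b = 0" "sorted (l @ [neg n (last l)])"
    then show ?thesis by (rule sink)
  next
    fix l1 l2 assume e: "l @ [neg n (last l)] = l1 @ [a, b] @ l2" and ba: "b < a"
    show ?thesis
    proof (cases l2 rule: rev_cases)
      case Nil
      have "(l1 @ [a]) @ [b] = l @ [neg n (last l)]" using e unfolding Nil append.simps append_assoc by (rule sym)
      then have c: "l1 @ [a] = l \<and> b = neg n (last l)" unfolding append1_eq_conv .
      have "last l = a" unfolding conjunct1[OF c, symmetric] by (rule last_snoc)
      then have "b = neg n a" using conjunct2[OF c] by (simp only:)
      then show ?thesis using flip[OF conjunct1[OF c, symmetric]] ba by blast
    next
      case (snoc l2' z)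
      have "l @ [neg n (last l)] = (l1 @ [a, b] @ l2') @ [z]" using e unfolding snoc append_assoc .
      then have "l = l1 @ [a, b] @ l2'" unfolding append1_eq_conv by (rule conjunct1)
      then show ?thesis using swap[of l1 l2'] ba by blast
    qed
  qed
qed

text \<open>The canonical order gives that \<open>l1 @ [b]\<close> is not tight for the part
  \<open>l1\<close> before a. The chain used by \<open>W\<close> extends \<open>l1\<close> by some
  \<open>r\<close>; the required tightness is lifted past \<open>r\<close> by composition, and the
  required slack by the meet.\<close>

lemma pair_move:
  assumes x: "x \<in> V" and p: "pair x = (a, b)" "a \<noteq> 0"
  shows "a \<in> codes n" "b \<in> codes n" "b < a" "W x b a \<noteq> 0"
proof -
  define l where "l = glist x {}"
  have lc: "code_list n l" and lt: "tight_list x l" unfolding l_def by (rule glist_code_list glist_tight)+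
  have gl: "greedy_prefix x {} l" using greedy_glist[of x "{}"] by (simp add: greedy_def l_def)
  have "\<exists>l1. greedy_prefix x {} (l1 @ [a]) \<and> a \<in> codes n \<and> b \<in> codes n \<and> b < a \<and> idx n b \<notin> idx n ` set l1 \<and>
     code_list n (l1 @ [a]) \<and> tight_list x (l1 @ [a]) \<and>
     (idx n a \<noteq> idx n b \<longrightarrow> tight_list x (l1 @ [a, b])) \<and> (idx n a = idx n b \<longrightarrow> length l1 = n - 1)"
    using x p(1)
  proof (cases rule: pair_cases)
    case sink
    then show ?thesis using p by simp
  next
    case (swap l1 l2)
    then have e: "l = (l1 @ [a]) @ (b # l2)" "l = (l1 @ [a, b]) @ l2" by (simp_all add: l_def)
    have cl: "code_list n ((l1 @ [a, b]) @ l2)" using lc e by simp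
    then have c: "code_list n (l1 @ [a, b])" unfolding code_list_append by blast
    then have c2: "a \<in> codes n" "b \<in> codes n" "idx n b \<notin> idx n ` set l1" "idx n a \<noteq> idx n b"
      unfolding code_list_def by auto
    have "tight_list x (l1 @ [a])" "tight_list x (l1 @ [a, b])" using lt e tight_list_appendD by metis+
    moreover have "greedy_prefix x {} (l1 @ [a])" using gl e greedy_prefix_appendD by metis
    ultimately show ?thesis using c2 swap by (intro exI[of _ l1]) (auto simp: tight_list_def)
  next
    case (flip l1)
    have e: "l = l1 @ [a]" using flip by (simp add: l_def)
    have "a \<in> codes n" using lc e by (simp add: code_list_snoc)
    moreover have "idx n b = idx n a" "b \<in> codes n"
      using flip calculation by (simp_all add: idx_neg neg_codes)
    moreover have "length l1 = n - 1" using glist_full[OF x] e l_def by simp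
    ultimately show ?thesis using lc lt gl e flip by (intro exI[of _ l1]) (auto simp: code_list_snoc)
  qed
  then obtain l1 where l1: "greedy_prefix x {} (l1 @ [a])" "a \<in> codes n" "b \<in> codes n" "b < a"
    "idx n b \<notin> idx n ` set l1" "code_list n (l1 @ [a])" "tight_list x (l1 @ [a])"
    "idx n a \<noteq> idx n b \<Longrightarrow> tight_list x (l1 @ [a, b])" "idx n a = idx n b \<Longrightarrow> length l1 = n - 1"
    by blast
  show "a \<in> codes n" "b \<in> codes n" "b < a" using l1 by auto
  have "\<not> avail x {} l1 b" using greedy_prefix_snocD(3)[OF l1(1)] l1(4) by blast
  then have nb: "slack x (svec n (l1 @ [b])) \<noteq> 0" using l1(3,5) by (simp add: avail_def)
  let ?I = "{idx n b, idx n a}"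
  have g1: "greedy_prefix x {} l1" using greedy_prefix_snocD(1)[OF l1(1)] .
  have ia: "idx n a \<notin> idx n ` set l1" using l1(6) by (simp add: code_list_snoc)
  \<comment> \<open>Avoiding more coordinates only removes candidates, so a choice outside them
    remains the least one.\<close>
  have "greedy_prefix x ?I m" if "greedy_prefix x {} m" "idx n ` set m \<inter> ?I = {}" for m
    using that
  proof (induction rule: greedy_prefix.induct)
    case (greedy_snoc m y)
    then have "greedy_prefix x ?I m" "avail x ?I m y" by (auto simp: avail_def)
    moreover have "\<forall>z<y. \<not> avail x ?I m z" using greedy_snoc.hyps by (auto simp: avail_def)
    ultimately show ?case by (rule greedy_prefix.greedy_snoc)
  qed (rule greedy_Nil)
  then have "greedy_prefix x ?I l1" using g1 l1(5) ia by auto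
  then obtain r where r: "glist x ?I = l1 @ r" using greedy_extends[OF greedy_glist] by blast
  have xP: "x \<in> P" using x by (rule V_in_P)
  have rc: "code_list n (l1 @ r)" "tight x (svec n (l1 @ r))"
    using glist_code_list[of x ?I] tight_list_last[OF glist_tight[of x ?I]] r by simp_all
  have av: "idx n a \<notin> idx n ` set (l1 @ r)" "idx n b \<notin> idx n ` set (l1 @ r)"
    using glist_avoids[of x ?I] r by auto
  have cra: "code_list n (l1 @ r @ [a])"
    using rc av l1(2) code_list_snoc[of n "l1 @ r" a] by simp
  have ta: "slack x (svec n (l1 @ r @ [a])) = 0"
    using tight_vcomp[OF xP rc(2) tight_list_last[OF l1(7)]] vcomp_svec[OF cra] by (simp add: tight_def)
  show "W x b a \<noteq> 0"
  proof (cases "idx n a = idx n b")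
    case True
    have "length (l1 @ r @ [a]) \<le> n" using cra code_list_length by blast
    \<comment> \<open>\<open>l1\<close> and a together already have n entries.\<close>
    then have "r = []" using l1(9)[OF True] n_pos by (cases r) simp_all
    then show ?thesis using nb ta True l1(9)[OF True] r by (simp add: W_def)
  next
    case False
    have cab: "code_list n (l1 @ r @ [a, b])"
    proof -
      have "code_list n ((l1 @ r @ [a]) @ [b])"
        using cra av l1(3) False by (subst code_list_snoc) auto
      then show ?thesis by simp
    qed
    have tab: "tight x (svec n (l1 @ [a, b]))" using tight_list_last[OF l1(8)[OF False]] .
    have tab': "slack x (svec n (l1 @ r @ [a, b])) = 0"
      using tight_vcomp[OF xP rc(2) tab] vcomp_svec[OF cab] by (simp add: tight_def)
    \<comment> \<open>Otherwise the meet with \<open>l1 @ [a, b]\<close> would make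
      \<open>l1 @ [b]\<close> tight, although b was refused there.\<close>
    have "slack x (svec n (l1 @ r @ [b])) \<noteq> 0"
    proof
      assume z: "slack x (svec n (l1 @ r @ [b])) = 0"
      have cba: "code_list n (l1 @ r @ [b] @ [a])" using cab False by (auto simp: code_list_def)
      have "code_list n ((l1 @ r @ [b]) @ [a])" using cba by simp
      then have "tight x (svec n (l1 @ r @ [b]))"
        using z unfolding code_list_append[of n "l1 @ r @ [b]"] by (simp add: tight_def sign_vec_svec)
      moreover have "vmeet (svec n (l1 @ r @ [b])) (svec n (l1 @ [a] @ [b])) = svec n (l1 @ [b])"
        using cba by (intro vmeet_svec) simp
      ultimately have "tight x (svec n (l1 @ [b]))" using tight_vjoin_vmeet(2)[OF xP _ tab] by force
      then show False using nb by (simp add: tight_def)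
    qed
    then show ?thesis using False ta tab' r by (simp add: W_def)
  qed
qed

section \<open>The objective and the sink\<close>

lemma obj_E:
  assumes "a \<in> codes n" "b \<in> codes n"
  shows "obj (E x a b) = obj x + W x a b * (sg n a * real (n + 1 - idx n a) -
    (if idx n a = idx n b then 0 else sg n b * real (n + 1 - idx n b)))"
  unfolding obj_def E_def dot_add_right dot_dvec[OF assms] ..

text \<open>The unit vector of a code y has weight n + 1 - y if y \<le> n and n - y otherwise, which
  strictly decreases in y. A sign change adds only the weight of b, which is positive since b < a
  forces b \<le> n in that case.\<close>

lemma obj_less:
  assumes x: "x \<in> V" and p: "pair x = (a, b)" "a \<noteq> 0"
  shows "obj x < obj (g x)"
proof -
  note pm = pair_move[OF assms]
  have W: "W x b a > 0" using W_pos[OF x pm(2) pm(4)] .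
  have "sg n b * real (n + 1 - idx n b) -
    (if idx n b = idx n a then 0 else sg n a * real (n + 1 - idx n a)) > 0"
    using pm(1-3) by (auto simp: codes_def sg_def idx_def of_nat_diff)
  then show ?thesis using W obj_E[OF pm(2,1), of x] by (simp add: g_def p)
qed

lemma upt_codes: "i \<le> n \<Longrightarrow> code_list n [1..<i + 1]"
  by (auto simp: code_list_def codes_def distinct_map inj_on_def idx_def)

lemma idx_upt: "i \<le> n \<Longrightarrow> idx n ` set [1..<i + 1] = {1..i}"
  by (force simp: idx_def)

lemma sink_tight: "tight_list sink [1..<n + 1]"
proof -
  have "tight_list sink [1..<i + 1]" if "i \<le> n" for i
    using that
  proof (induction i)
    case (Suc i)
    have y: "Suc i \<in> codes n" "idx n (Suc i) = Suc i" "sg n (Suc i) = 1"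
      using Suc.prems by (auto simp: codes_def idx_def sg_def)
    have e: "[1..<Suc i + 1] = [1..<i + 1] @ [Suc i]" by simp
    have t: "tight_list sink [1..<i + 1]" using Suc by simp
    then have "slack sink (svec n [1..<i + 1]) = 0" using tight_list_last by (simp add: tight_def)
    moreover have "sink (Suc i) = f (signed_set_of n (svec n ([1..<i + 1] @ [Suc i])))
        - f (signed_set_of n (svec n [1..<i + 1]))"
      using Suc.prems by (simp add: sink_def)
    ultimately have "slack sink (svec n ([1..<i + 1] @ [Suc i])) = 0"
      unfolding slack_def dot_snoc[OF y(1)] by (simp add: y)
    then show ?case
      unfolding e tight_list_snoc using t upt_codes[OF Suc.prems] e by simp
  qed simp
  then show ?thesis by blast
qed

lemma sink_in_V: "sink \<in> V"
  by (rule full_tight_list_vertex[OF sink_tight]) (auto simp: supported_def sink_def)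

lemma tight_list_avail: "tight_list x (l @ [y]) \<Longrightarrow> avail x {} l y"
  by (simp add: tight_list_snoc code_list_snoc avail_def)

lemma glist_sink: "glist sink {} = [1..<n + 1]"
proof (rule glist_eqI)
  have g: "greedy_prefix sink {} [1..<i + 1]" if "i \<le> n" for i
    using that
  proof (induction i)
    case (Suc i)
    have "[1..<n + 1] = [1..<Suc i + 1] @ [Suc i + 1..<n + 1]"
    proof -
      have e: "n + 1 = (Suc i + 1) + (n - Suc i)" using Suc.prems by simp
      show ?thesis unfolding e by (rule upt_add_eq_append) simp
    qed
    moreover have "[1..<Suc i + 1] = [1..<i + 1] @ [Suc i]" by simp
    ultimately have "tight_list sink (([1..<i + 1] @ [Suc i]) @ [Suc i + 1..<n + 1])"
      using sink_tight by metis
    then have "tight_list sink ([1..<i + 1] @ [Suc i])" by (rule tight_list_appendD)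
    then have a: "avail sink {} [1..<i + 1] (Suc i)" by (rule tight_list_avail)
    \<comment> \<open>Smaller codes have coordinates that are already used.\<close>
    have "\<not> avail sink {} [1..<i + 1] z" if "z < Suc i" for z
    proof
      assume "avail sink {} [1..<i + 1] z"
      then have "z \<in> codes n" "idx n z \<notin> {1..i}"
        using idx_upt[of i] Suc.prems by (auto simp: avail_def)
      then show False using that Suc.prems by (auto simp: codes_def idx_def split: if_splits)
    qed
    then show ?case using greedy_snoc[OF _ a] Suc by simp
  qed (simp add: greedy_Nil)
  have "\<not> avail sink {} [1..<n + 1] y" for y
    using idx_range[of y n] idx_upt[of n] by (auto simp: avail_def)
  then show "greedy sink {} [1..<n + 1]" using g by (simp add: greedy_def)
qed

lemma pair_sink: "pair sink = (0, 0)"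
proof -
  have l: "last [1..<n + 1] = n" using n_pos by simp
  have "sorted ([1..<n + 1] @ [neg n n])"
    by (auto simp: sorted_append neg_def)
  then show ?thesis unfolding pair_def glist_sink Let_def l by (simp add: descent_sorted)
qed

text \<open>The appended code does not exceed its negative's partner only if the last code is at
  most n. Then the chain consists of n increasing codes in {1..n}, so it is 1, ..., n, and a full
  tight chain determines the point.\<close>

lemma pair_zero_sink:
  assumes x: "x \<in> V" and p: "pair x = (0, b)"
  shows "x = sink"
proof -
  let ?l = "glist x {}"
  have lc: "code_list n ?l" by (rule glist_code_list)
  have ln: "length ?l = n" using glist_full[OF x] .
  have s: "sorted (?l @ [neg n (last ?l)])"
    using x p
  proof (cases rule: pair_cases)
    case (swap l1 l2)
    then show ?thesis by simp
  next
    case (flip l1)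
    then show ?thesis by simp
  qed simp
  have in1: "y \<in> {1..n}" if "y \<in> set ?l" for y
  proof -
    have "y \<in> codes n" using glist_codes that by blast
    moreover have "y \<le> last ?l"
    proof -
      obtain m z where m: "?l = m @ [z]" using glist_nonempty[OF x] rev_exhaust by blast
      then show ?thesis using s that by (auto simp: sorted_append)
    qed
    moreover have "last ?l \<le> neg n (last ?l)"
      using s glist_nonempty[OF x] by (auto simp: sorted_append)
    ultimately show ?thesis by (auto simp: codes_def neg_def)
  qed
  have d: "distinct ?l" using lc by (auto simp: code_list_def distinct_map)
  have "set ?l = {1..n}"
    by (rule card_subset_eq) (use in1 distinct_card[OF d] ln in auto)
  then have "?l = [1..<n + 1]"
    using d s by (intro sorted_distinct_set_unique) (auto simp: sorted_append)
  then have "tight_list x [1..<n + 1]" using glist_tight[of x "{}"] by simp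
  then show ?thesis
    using full_tight_list_unique[OF _ sink_tight] P_supported V_in_P sink_in_V x by simp
qed

lemma pair_eq_zero_iff: "x \<in> V \<Longrightarrow> fst (pair x) = 0 \<longleftrightarrow> x = sink"
  using pair_sink pair_zero_sink[of x "snd (pair x)"] by (cases "pair x") auto

text \<open>A vertex is determined by its canonical chain, a list of n codes.\<close>

lemma finite_V: "finite V"
proof -
  have "inj_on (\<lambda>x. glist x {}) V"
  proof (rule inj_onI)
    fix x z assume h: "x \<in> V" "z \<in> V" "glist x {} = glist z {}"
    show "x = z"
      using full_tight_list_unique[of x "glist x {}" z] glist_tight[of x "{}"] glist_tight[of z "{}"]
        glist_full[OF h(1)] h P_supported V_in_P by simp
  qed
  moreover have "(\<lambda>x. glist x {}) ` V \<subseteq> {l. set l \<subseteq> codes n \<and> length l = n}"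
    using glist_codes glist_full by auto
  moreover have "finite {l. set l \<subseteq> codes n \<and> length l = n}"
    by (rule finite_lists_length_eq) (simp add: codes_def)
  ultimately show ?thesis by (rule inj_on_finite)
qed

text \<open>A child is recognised by the pair that leads back to its parent.\<close>

lemma parent:
  assumes x: "x \<in> V" "x \<noteq> sink" and p: "pair x = (a, b)"
  shows "a \<in> codes n" "b \<in> codes n" "g x \<in> V" "{x, g x} \<in> adjacent_pairs P" "obj x < obj (g x)"
    "W (g x) a b \<noteq> 0" "E (g x) a b = x" "W x b a \<noteq> 0"
proof -
  have a: "a \<noteq> 0" using pair_eq_zero_iff[OF x(1)] x(2) p by simp
  note pm = pair_move[OF x(1) p a]
  have gx: "g x = E x b a" by (simp add: g_def p)
  note m = move[OF x(1) pm(2,1,4)]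
  show "a \<in> codes n" "b \<in> codes n" "g x \<in> V" "{x, g x} \<in> adjacent_pairs P" "obj x < obj (g x)"
    "W (g x) a b \<noteq> 0" "E (g x) a b = x" "W x b a \<noteq> 0"
    using pm m obj_less[OF x(1) p a] by (simp_all add: gx)
qed

lemma child:
  assumes x: "x \<in> V" and ab: "a \<in> codes n" "b \<in> codes n" and W: "W x a b \<noteq> 0"
    and p: "pair (E x a b) = (a, b)"
  shows "E x a b \<in> V" "E x a b \<noteq> sink" "g (E x a b) = x"
proof -
  note m = move[OF x ab W]
  show "E x a b \<in> V" "g (E x a b) = x" using m by (simp_all add: g_def p)
  \<comment> \<open>The pair of the sink is (0, 0), and 0 is not a code.\<close>
  show "E x a b \<noteq> sink" using p pair_sink ab by (auto simp: codes_def)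
qed

end

section \<open>Reverse search in a tree\<close>

text \<open>The candidates for the children of a vertex are numbered by 0, ..., N - 1.\<close>

locale search_tree =
  fixes V :: "'v set" and E :: "'v set set" and s :: 'v and g :: "'v \<Rightarrow> 'v" and obj :: "'v \<Rightarrow> real"
    and N :: nat and child :: "'v \<Rightarrow> nat \<Rightarrow> 'v option" and key :: "'v \<Rightarrow> nat"
  assumes finite_V: "finite V" and s_in: "s \<in> V"
    and parent_in: "v \<in> V \<Longrightarrow> v \<noteq> s \<Longrightarrow> g v \<in> V"
    and parent_edge: "v \<in> V \<Longrightarrow> v \<noteq> s \<Longrightarrow> {v, g v} \<in> E"
    and parent_obj: "v \<in> V \<Longrightarrow> v \<noteq> s \<Longrightarrow> obj v < obj (g v)"
    and parent_key: "v \<in> V \<Longrightarrow> v \<noteq> s \<Longrightarrow> key v < N \<and> child (g v) (key v) = Some v"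
    and child_in: "v \<in> V \<Longrightarrow> k < N \<Longrightarrow> child v k = Some u \<Longrightarrow> u \<in> V \<and> u \<noteq> s \<and> g u = v \<and> key u = k"
begin

section \<open>Arcs to the parents and subtrees\<close>

definition arcs :: "('v \<times> 'v) set" where
  "arcs = {(v, g v) | v. v \<in> V - {s}}"

lemma arc_iff: "(v, w) \<in> arcs \<longleftrightarrow> v \<in> V \<and> v \<noteq> s \<and> w = g v"
  by (auto simp: arcs_def)

lemma arcs_obj: "(v, w) \<in> arcs\<^sup>* \<Longrightarrow> v = w \<or> obj v < obj w"
proof (induction rule: rtrancl_induct)
  case (step y z)
  then have "obj y < obj z" using parent_obj by (auto simp: arc_iff)
  then show ?case using step by auto
qed simp

text \<open>Each arc increases the objective, so the number of vertices with a larger objective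
  decreases until the root is met.\<close>

lemma reaches_s:
  assumes "v \<in> V" shows "(v, s) \<in> arcs\<^sup>*"
  using assms
proof (induction "card {w \<in> V. obj v < obj w}" arbitrary: v rule: less_induct)
  case less
  show ?case
  proof (cases "v = s")
    case False
    note o = parent_obj[OF less.prems False] and p = parent_in[OF less.prems False]
    have "{w \<in> V. obj (g v) < obj w} \<subset> {w \<in> V. obj v < obj w}" using o p by auto
    then have "card {w \<in> V. obj (g v) < obj w} < card {w \<in> V. obj v < obj w}"
      using finite_V by (intro psubset_card_mono) auto
    then have "(g v, s) \<in> arcs\<^sup>*" using less.hyps p by blast
    moreover have "(v, g v) \<in> arcs" using less.prems False by (simp add: arc_iff)
    ultimately show ?thesis by (rule converse_rtrancl_into_rtrancl[rotated])
  qed simp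
qed

lemma local_search: "local_search_function V E s g"
  unfolding local_search_function_def directed_spanning_tree_def arcs_def[symmetric]
  using parent_in parent_edge s_in reaches_s by (auto simp: arc_iff)

lemma single_valued_arcs: "single_valued arcs"
  by (auto simp: single_valued_def arc_iff)

text \<open>What remains to be visited below v when candidate k is the next to be tried.\<close>

definition below :: "'v \<Rightarrow> nat \<Rightarrow> 'v set" where
  "below v k = {w \<in> V. \<exists>j u. k \<le> j \<and> j < N \<and> child v j = Some u \<and> (w, u) \<in> arcs\<^sup>*}"

lemma child_arc: "v \<in> V \<Longrightarrow> k < N \<Longrightarrow> child v k = Some u \<Longrightarrow> (u, v) \<in> arcs \<and> obj u < obj v"
  using child_in[of v k u] parent_obj[of u] by (auto simp: arc_iff)

lemma below_0: "v \<in> V \<Longrightarrow> {w \<in> V. (w, v) \<in> arcs\<^sup>*} = insert v (below v 0)"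
proof (intro set_eqI iffI)
  fix w assume v: "v \<in> V" and "w \<in> {w \<in> V. (w, v) \<in> arcs\<^sup>*}"
  then have w: "w \<in> V" "(w, v) \<in> arcs\<^sup>*" by auto
  from w(2) show "w \<in> insert v (below v 0)"
  proof (cases rule: rtranclE)
    case (step c)
    then have "c \<in> V" "c \<noteq> s" "v = g c" by (auto simp: arc_iff)
    then show ?thesis using parent_key[of c] step w by (auto simp: below_def)
  qed simp
next
  fix w assume v: "v \<in> V" and "w \<in> insert v (below v 0)"
  then show "w \<in> {w \<in> V. (w, v) \<in> arcs\<^sup>*}"
    using child_arc[OF v] unfolding below_def by (auto intro: rtrancl_into_rtrancl)
qed

lemma not_below: "v \<in> V \<Longrightarrow> v \<notin> below v k"
proof
  assume v: "v \<in> V" and "v \<in> below v k"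
  then obtain j u where "j < N" "child v j = Some u" "(v, u) \<in> arcs\<^sup>*" by (auto simp: below_def)
  then show False using child_arc[OF v, of j u] arcs_obj[of v u] by auto
qed

lemma below_None: "child v k = None \<Longrightarrow> below v k = below v (Suc k)"
proof -
  assume c: "child v k = None"
  have "k \<le> j \<and> child v j = Some u \<longleftrightarrow> Suc k \<le> j \<and> child v j = Some u" for j u
    using c by (cases "j = k") auto
  then show ?thesis unfolding below_def by blast
qed

text \<open>A common descendant of two children would, arcs being single-valued, make one child
  reach the other. But the only arc from a child leads to \<open>v\<close>, whose objective exceeds
  that of both.\<close>

lemma below_Some:
  assumes v: "v \<in> V" and k: "k < N" and c: "child v k = Some u"
  shows "below v k = insert u (below u 0) \<union> below v (Suc k)"
    and "insert u (below u 0) \<inter> below v (Suc k) = {}"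
proof -
  have u: "u \<in> V" using child_in[OF v k c] by simp
  have eq: "k \<le> j \<and> j < N \<and> child v j = Some u' \<longleftrightarrow>
      j = k \<and> u' = u \<or> Suc k \<le> j \<and> j < N \<and> child v j = Some u'" for j u'
    using k c by (cases "j = k") auto
  have "below v k = {w \<in> V. \<exists>j u'. (k \<le> j \<and> j < N \<and> child v j = Some u') \<and> (w, u') \<in> arcs\<^sup>*}"
    by (simp add: below_def)
  also have "\<dots> = {w \<in> V. (w, u) \<in> arcs\<^sup>*} \<union> below v (Suc k)"
    unfolding eq below_def by auto
  finally have "below v k = {w \<in> V. (w, u) \<in> arcs\<^sup>*} \<union> below v (Suc k)" .
  then show "below v k = insert u (below u 0) \<union> below v (Suc k)"
    by (simp only: below_0[OF u])
  have False if w: "w \<in> {w \<in> V. (w, u) \<in> arcs\<^sup>*}" "w \<in> below v (Suc k)" for w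
  proof -
    obtain j u' where j: "Suc k \<le> j" "j < N" "child v j = Some u'" "(w, u') \<in> arcs\<^sup>*"
      using w by (auto simp: below_def)
    have ne: "u \<noteq> u'" using child_in[OF v k c] child_in[OF v j(2,3)] j(1) by auto
    have no: False if h: "(x, y) \<in> arcs\<^sup>*" "x \<noteq> y" "(x, v) \<in> arcs" "obj y < obj v" for x y
    proof -
      obtain z where z: "(x, z) \<in> arcs" "(z, y) \<in> arcs\<^sup>*" using h(1,2) by (metis converse_rtranclE)
      then have "z = v" using h(3) by (auto simp: arc_iff)
      then show False using arcs_obj[OF z(2)] h(4) by auto
    qed
    have "(u, u') \<in> arcs\<^sup>* \<or> (u', u) \<in> arcs\<^sup>*"
      using single_valued_confluent[OF single_valued_arcs] w j(4) by blast
    then show False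
    proof (rule disjE)
      assume "(u, u') \<in> arcs\<^sup>*"
      then show False using no ne child_arc[OF v k c] child_arc[OF v j(2,3)] by blast
    next
      assume "(u', u) \<in> arcs\<^sup>*"
      then show False using no ne[symmetric] child_arc[OF v k c] child_arc[OF v j(2,3)] by blast
    qed
  qed
  then show "insert u (below u 0) \<inter> below v (Suc k) = {}"
    unfolding below_0[OF u, symmetric] by blast
qed

text \<open>Stands between the reverse search on neighbour lists and the program: the state is a
  vertex with the number of its next candidate, and one rule is one iteration of the loop. In
  \<open>dfs_up\<close> the key of the finished vertex tells where to resume at its parent, which
  replaces a stack.\<close>

inductive dfs :: "'v \<Rightarrow> nat \<Rightarrow> 'v event list \<Rightarrow> nat \<Rightarrow> 'v \<Rightarrow> nat \<Rightarrow> bool" where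
  dfs_refl: "dfs v k [] 0 v k"
| dfs_down: "v \<in> V \<Longrightarrow> k < N \<Longrightarrow> child v k = Some u \<Longrightarrow> dfs u 0 tr m w j
    \<Longrightarrow> dfs v k (Move u # Report u # tr) (Suc m) w j"
| dfs_next: "v \<in> V \<Longrightarrow> k < N \<Longrightarrow> child v k = None \<Longrightarrow> dfs v (Suc k) tr m w j \<Longrightarrow> dfs v k tr (Suc m) w j"
| dfs_up: "v \<in> V \<Longrightarrow> v \<noteq> s \<Longrightarrow> dfs (g v) (Suc (key v)) tr m w j \<Longrightarrow> dfs v N (Move (g v) # tr) (Suc m) w j"

lemma dfs_trans: "dfs v k tr m u i \<Longrightarrow> dfs u i tr' m' w j \<Longrightarrow> dfs v k (tr @ tr') (m + m') w j"
  by (induction rule: dfs.induct) (auto intro: dfs.intros)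

section \<open>Neighbour lists that begin with the children\<close>

definition kids :: "'v \<Rightarrow> nat \<Rightarrow> 'v list" where
  "kids v k = concat (map (\<lambda>j. case child v j of None \<Rightarrow> [] | Some u \<Rightarrow> [u]) [0..<k])"

definition nbrs :: "'v \<Rightarrow> 'v set" where
  "nbrs v = {u \<in> V. {v, u} \<in> E}"

text \<open>The children come first.  A rejected neighbour leaves no trace in a reverse search, so that
  the other neighbours never have to be computed.\<close>

definition adj :: "'v \<Rightarrow> 'v list" where
  "adj v = kids v N @ (SOME l. distinct l \<and> set l = nbrs v - set (kids v N))"

lemma kids_Suc: "kids v (Suc k) = kids v k @ (case child v k of None \<Rightarrow> [] | Some u \<Rightarrow> [u])"
  by (simp add: kids_def)

lemma set_kids: "set (kids v k) = {u. \<exists>j<k. child v j = Some u}"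
  by (induction k) (auto simp: kids_Suc less_Suc_eq split: option.splits, simp add: kids_def)

lemma distinct_kids: "v \<in> V \<Longrightarrow> k \<le> N \<Longrightarrow> distinct (kids v k)"
proof (induction k)
  case (Suc k)
  have "u \<notin> set (kids v k)" if u: "child v k = Some u" for u
  proof
    assume "u \<in> set (kids v k)"
    then obtain j where "j < k" "child v j = Some u" by (auto simp: set_kids)
    then show False using child_in[of v k u] child_in[of v j u] u Suc.prems by simp
  qed
  then show ?case using Suc by (auto simp: kids_Suc split: option.splits)
qed (simp add: kids_def)

lemma kids_prefix: "k \<le> N \<Longrightarrow> \<exists>r. kids v N = kids v k @ r"
proof (induction "N - k" arbitrary: k)
  case (Suc d)
  then obtain r where "kids v N = kids v (Suc k) @ r" by (metis Suc_diff_Suc Suc_inject Suc_leI zero_less_Suc zero_less_diff)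
  then show ?case by (simp add: kids_Suc)
qed simp

lemma adj_split:
  assumes v: "v \<in> V"
  obtains r where "adj v = kids v N @ r" "distinct r" "set r = nbrs v - set (kids v N)"
proof -
  have "finite (nbrs v - set (kids v N))" using finite_V by (simp add: nbrs_def)
  then have "\<exists>l. distinct l \<and> set l = nbrs v - set (kids v N)" using finite_distinct_list by blast
  from someI_ex[OF this] show ?thesis using that unfolding adj_def by blast
qed

lemma kids_nbrs: "v \<in> V \<Longrightarrow> set (kids v N) \<subseteq> nbrs v"
  using child_in parent_edge by (fastforce simp: set_kids nbrs_def insert_commute)

lemma neighbour_lists: "neighbour_lists V E adj"
  unfolding neighbour_lists_def
proof
  fix v assume v: "v \<in> V"
  then obtain r where "adj v = kids v N @ r" "distinct r" "set r = nbrs v - set (kids v N)"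
    by (rule adj_split)
  then show "distinct (adj v) \<and> set (adj v) = {u \<in> V. {v, u} \<in> E}"
    using distinct_kids[OF v, of N] kids_nbrs[OF v] unfolding nbrs_def[of v, symmetric] by auto
qed

lemma adj_kid:
  assumes v: "v \<in> V" and k: "k < N" and c: "child v k = Some u"
  shows "length (kids v k) < length (adj v)" "adj v ! length (kids v k) = u"
proof -
  obtain r where "adj v = kids v N @ r" using adj_split[OF v] by metis
  moreover obtain r' where "kids v N = kids v (Suc k) @ r'" using kids_prefix[of "Suc k" v] k by auto
  ultimately have "adj v = kids v k @ u # (r' @ r)" by (simp add: kids_Suc c)
  then show "length (kids v k) < length (adj v)" "adj v ! length (kids v k) = u" by auto
qed

text \<open>A neighbour whose parent is \<open>v\<close> occurs among the candidates of
  \<open>v\<close> under its key, so everything behind the children is rejected.\<close>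

lemma reject_rest:
  assumes v: "v \<in> V" and r: "rs_from adj s g v (length (adj v)) tr"
  shows "rs_from adj s g v (length (kids v N)) tr"
proof -
  obtain r where a: "adj v = kids v N @ r" "set r = nbrs v - set (kids v N)" using adj_split[OF v] by metis
  have "rs_from adj s g v (length (kids v N) + j) tr" if "j \<le> length r" for j
    using that
  proof (induction "length r - j" arbitrary: j)
    case 0
    then show ?case using assms(2) a by simp
  next
    case (Suc d)
    then have j: "j < length r" "d = length r - Suc j" by auto
    have rj: "r ! j \<in> V" "r ! j \<notin> set (kids v N)" using j(1) a(2) nth_mem[of j r] by (auto simp: nbrs_def)
    have "r ! j = s \<or> g (r ! j) \<noteq> v"
    proof (rule ccontr)
      assume "\<not> (r ! j = s \<or> g (r ! j) \<noteq> v)"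
      then have "key (r ! j) < N \<and> child v (key (r ! j)) = Some (r ! j)" using parent_key[OF rj(1)] by auto
      then show False using rj(2) by (auto simp: set_kids)
    qed
    moreover have "rs_from adj s g v (Suc (length (kids v N) + j)) tr"
      using Suc.hyps(1)[OF j(2)] j(1) by simp
    moreover have "length (kids v N) + j < length (adj v)" "adj v ! (length (kids v N) + j) = r ! j"
      using j(1) a(1) by (simp_all add: nth_append)
    ultimately show ?case by (rule rs_reject[rotated 2])
  qed
  from this[of 0] show ?thesis by simp
qed

lemma reported_append: "reported (tr @ tr') = reported tr @ reported tr'"
  by (induction tr rule: reported.induct) auto

text \<open>The outer induction descends to children, which have fewer vertices of smaller
  objective; the inner one runs through the candidates. Every reported vertex costs its N candidates
  and one backtracking step, hence N + 1. The trace is stated with an arbitrary continuation because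
  \<open>rs_from\<close> describes only searches that run to the end.\<close>

lemma dfs_subtree:
  assumes "v \<in> V" "k \<le> N"
  shows "\<exists>tr m. dfs v k tr m v N \<and> distinct (reported tr) \<and> set (reported tr) = below v k \<and>
    m = N - k + (N + 1) * length (reported tr) \<and>
    (\<forall>rest. rs_from adj s g v (length (adj v)) rest \<longrightarrow> rs_from adj s g v (length (kids v k)) (tr @ rest))"
  using assms
proof (induction "card {w \<in> V. obj w < obj v}" arbitrary: v k rule: less_induct)
  case outer: less
  show ?case
    using outer.prems(2)
  proof (induction "N - k" arbitrary: k)
    case 0
    then have k: "k = N" by simp
    have "below v N = {}" by (auto simp: below_def)
    then show ?case unfolding k using reject_rest[OF outer.prems(1)]
      by (intro exI[of _ "[]"] exI[of _ 0]) (auto intro: dfs_refl)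
  next
    case (Suc d)
    then have k: "k < N" "d = N - Suc k" "Suc k \<le> N" by auto
    obtain tr m where IH: "dfs v (Suc k) tr m v N" "distinct (reported tr)" "set (reported tr) = below v (Suc k)"
      "m = N - Suc k + (N + 1) * length (reported tr)"
      "\<forall>rest. rs_from adj s g v (length (adj v)) rest \<longrightarrow> rs_from adj s g v (length (kids v (Suc k))) (tr @ rest)"
      using Suc.hyps(1)[OF k(2,3)] by blast
    note v = outer.prems(1)
    show ?case
    proof (cases "child v k")
      case None
      then have "kids v (Suc k) = kids v k" by (simp add: kids_Suc)
      then show ?thesis
        using IH dfs_next[OF v k(1) None IH(1)] below_None[OF None] k
        by (intro exI[of _ tr] exI[of _ "Suc m"]) auto
    next
      case (Some u)
      note c = child_in[OF v k(1) Some]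
      have "{w \<in> V. obj w < obj u} \<subset> {w \<in> V. obj w < obj v}"
        using child_arc[OF v k(1) Some] c by auto
      then have "card {w \<in> V. obj w < obj u} < card {w \<in> V. obj w < obj v}"
        using finite_V by (intro psubset_card_mono) auto
      from outer.hyps[OF this, of 0] obtain tu mu where u: "dfs u 0 tu mu u N" "distinct (reported tu)"
        "set (reported tu) = below u 0" "mu = N + (N + 1) * length (reported tu)"
        "\<forall>rest. rs_from adj s g u (length (adj u)) rest \<longrightarrow> rs_from adj s g u (length (kids u 0)) (tu @ rest)"
        using c by auto
      \<comment> \<open>The key of \<open>u\<close> is \<open>k\<close>, so backtracking resumes
        exactly behind it.\<close>
      have "dfs u N (Move v # tr) (Suc m) v N" using dfs_up[of u tr m v N] c IH(1) by simp
      from dfs_trans[OF u(1) this]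
      have "dfs u 0 (tu @ Move v # tr) (mu + Suc m) v N" .
      from dfs_down[OF v k(1) Some this]
      have d: "dfs v k (Move u # Report u # tu @ Move v # tr) (Suc (mu + Suc m)) v N" .
      let ?t = "Move u # Report u # tu @ Move v # tr"
      have rep: "reported ?t = u # reported tu @ reported tr" by (simp add: reported_append)
      have rs: "rs_from adj s g v (length (kids v k)) (?t @ rest)"
        if "rs_from adj s g v (length (adj v)) rest" for rest
      proof -
        note a = adj_kid[OF v k(1) Some]
        have "length (kids v (Suc k)) = Suc (length (kids v k))" by (simp add: kids_Suc Some)
        then have "rs_from adj s g v (Suc (length (kids v k))) (tr @ rest)" using IH(5) that by metis
        then have "rs_from adj s g u (length (adj u)) (Move v # tr @ rest)"
          using c a by (intro rs_backtrack[of u s g v _ adj]) auto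
        then have "rs_from adj s g u 0 (tu @ Move v # tr @ rest)"
          using u(5) by (auto simp: kids_def)
        then show ?thesis using rs_forward[of "length (kids v k)" adj v u s g] a c by simp
      qed
      have dis: "distinct (reported ?t)"
        unfolding rep using u(2,3) IH(2,3) below_Some(2)[OF v k(1) Some] not_below[of u 0] c by auto
      have st: "set (reported ?t) = below v k"
        unfolding rep below_Some(1)[OF v k(1) Some] using u(3) IH(3) by simp
      have mm: "Suc (mu + Suc m) = N - k + (N + 1) * length (reported ?t)"
        unfolding rep u(4) IH(4) using k by (simp add: algebra_simps)
      show ?thesis by (intro exI[of _ ?t] exI[of _ "Suc (mu + Suc m)"] conjI d dis st mm allI impI rs)
    qed
  qed
qed

text \<open>The added 1 makes room for the final iteration, in which the finished root is recognised
  and the loop ends.\<close>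

theorem dfs_all:
  obtains tr m where "dfs s 0 tr m s N" "reverse_search adj s g (Move s # Report s # tr)"
    "distinct (reported (Move s # Report s # tr))" "set (reported (Move s # Report s # tr)) = V"
    "m + 1 = (N + 1) * card V"
proof -
  obtain tr m where t: "dfs s 0 tr m s N" "distinct (reported tr)" "set (reported tr) = below s 0"
    "m = N + (N + 1) * length (reported tr)"
    "\<forall>rest. rs_from adj s g s (length (adj s)) rest \<longrightarrow> rs_from adj s g s (length (kids s 0)) (tr @ rest)"
    using dfs_subtree[OF s_in, of 0] by auto
  have "rs_from adj s g s (length (kids s 0)) (tr @ [])" by (rule t(5)[rule_format, OF rs_stop])
  then have "reverse_search adj s g (Move s # Report s # tr)"
    unfolding reverse_search_def by (simp add: kids_def)
  moreover have V: "insert s (below s 0) = V"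
    using below_0[OF s_in] reaches_s by (metis (mono_tags, lifting) Collect_cong Collect_mem_eq)
  moreover have d: "distinct (s # reported tr)" using t not_below[OF s_in] by simp
  moreover have "card V = Suc (length (reported tr))"
    using distinct_card[OF d] V t(3) by simp
  ultimately show ?thesis using that[OF t(1)] t(2-4) by simp
qed

end

section \<open>The program\<close>

definition runs :: "nat \<Rightarrow> (signed_set \<Rightarrow> real) \<Rightarrow> nat \<Rightarrow> com \<Rightarrow> memory \<Rightarrow>
    rvec event list \<Rightarrow> nat \<Rightarrow> (memory \<Rightarrow> bool) \<Rightarrow> bool" where
  "runs n f m c M tr T Q \<longleftrightarrow> (\<exists>t M'. exec n f m c M tr t M' \<and> t \<le> T \<and> Q M')"

text \<open>Meant for silent commands without loops, whose effect can be computed symbolically. The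
  value False for the remaining commands keeps \<open>wp_runs\<close> sound; these are treated with
  \<open>runs\<close>.\<close>

primrec wp :: "nat \<Rightarrow> (signed_set \<Rightarrow> real) \<Rightarrow> nat \<Rightarrow> com \<Rightarrow> memory \<Rightarrow> (memory \<Rightarrow> bool) \<Rightarrow> bool" where
  "wp n f m Skip M Q \<longleftrightarrow> Q M"
| "wp n f m (Assign a e) M Q \<longleftrightarrow> legal m M a \<and> is_address m (ev M a) \<and> legal m M e \<and>
     Q (M(nat \<lfloor>ev M a\<rfloor> := ev M e))"
| "wp n f m (Query a b) M Q \<longleftrightarrow> legal m M a \<and> is_address m (ev M a) \<and> legal m M b \<and>
     is_block n m (ev M b) \<and> (\<forall>i \<in> {1..n}. vector_at n M (ev M b) i \<in> {- 1, 0, 1}) \<and>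
     Q (M(nat \<lfloor>ev M a\<rfloor> := f (signed_set_at n M (ev M b))))"
| "wp n f m (ReportVec b) M Q \<longleftrightarrow> False"
| "wp n f m (MoveTo b) M Q \<longleftrightarrow> False"
| "wp n f m (Seq c d) M Q \<longleftrightarrow> wp n f m c M (\<lambda>M'. wp n f m d M' Q)"
| "wp n f m (If b c d) M Q \<longleftrightarrow> legal_test m M b \<and>
     (holds M b \<longrightarrow> wp n f m c M Q) \<and> (\<not> holds M b \<longrightarrow> wp n f m d M Q)"
| "wp n f m (While b c) M Q \<longleftrightarrow> False"

text \<open>A bound for the time of the programs to which \<open>wp\<close> applies; both branches of a conditional
  are counted.  The values for outputs and loops are irrelevant.\<close>

primrec wc :: "com \<Rightarrow> nat" where
  "wc Skip = 0"
| "wc (Assign a e) = 1 + cost a + cost e"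
| "wc (Query a b) = 1 + cost a + cost b"
| "wc (ReportVec b) = 0"
| "wc (MoveTo b) = 0"
| "wc (Seq c d) = wc c + wc d"
| "wc (If b c d) = cost_test b + wc c + wc d"
| "wc (While b c) = 0"

lemma wp_mono: "wp n f m c M Q \<Longrightarrow> (\<And>M'. Q M' \<Longrightarrow> Q' M') \<Longrightarrow> wp n f m c M Q'"
proof (induction c arbitrary: M Q Q')
  case (Seq c d)
  have "wp n f m c M (\<lambda>M'. wp n f m d M' Q')"
    by (rule Seq.IH(1)[OF Seq.prems(1)[unfolded wp.simps]]) (rule Seq.IH(2)[OF _ Seq.prems(2)])
  then show ?case by simp
qed auto

lemma wp_runs: "wp n f m c M Q \<Longrightarrow> runs n f m c M [] (wc c) Q"
proof (induction c arbitrary: M Q)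
  case Skip
  then show ?case by (auto simp: runs_def intro: exec_Skip)
next
  case (Assign a e)
  then show ?case unfolding runs_def wp.simps wc.simps by (metis exec_Assign order_refl)
next
  case (Query a b)
  then show ?case unfolding runs_def wp.simps wc.simps by (metis exec_Query order_refl)
next
  case (Seq c d)
  from Seq.IH(1)[OF Seq.prems[unfolded wp.simps]] obtain t M' where
    1: "exec n f m c M [] t M'" "t \<le> wc c" "wp n f m d M' Q" unfolding runs_def by blast
  from Seq.IH(2)[OF 1(3)] obtain t' M'' where
    2: "exec n f m d M' [] t' M''" "t' \<le> wc d" "Q M''" unfolding runs_def by blast
  show ?case unfolding runs_def
    using exec_Seq[OF 1(1) 2(1)] 1 2 by (intro exI[of _ "t + t'"] exI[of _ M'']) auto
next
  case (If b c d)
  show ?case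
  proof (cases "holds M b")
    case True
    then obtain t M' where 1: "exec n f m c M [] t M'" "t \<le> wc c" "Q M'"
      using If.IH(1)[of M Q] If.prems unfolding runs_def by auto
    have "exec n f m (If b c d) M [] (cost_test b + t) M'"
      using exec_IfTrue[OF _ True 1(1)] If.prems by simp
    then show ?thesis unfolding runs_def using 1 by (intro exI[of _ "cost_test b + t"] exI[of _ M']) simp
  next
    case False
    then obtain t M' where 1: "exec n f m d M [] t M'" "t \<le> wc d" "Q M'"
      using If.IH(2)[of M Q] If.prems unfolding runs_def by auto
    have "exec n f m (If b c d) M [] (cost_test b + t) M'"
      using exec_IfFalse[OF _ False 1(1)] If.prems by simp
    then show ?thesis unfolding runs_def using 1 by (intro exI[of _ "cost_test b + t"] exI[of _ M']) simp
  qed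
qed auto

lemma runs_mono:
  assumes "runs n f m c M tr T Q" "T \<le> T'" "\<And>M'. Q M' \<Longrightarrow> Q' M'"
  shows "runs n f m c M tr T' Q'"
  using assms unfolding runs_def by (meson order_trans)

lemma runs_Seq:
  assumes "runs n f m c M tr T (\<lambda>M'. runs n f m d M' tr' T' Q)"
  shows "runs n f m (Seq c d) M (tr @ tr') (T + T') Q"
proof -
  obtain t M' where 1: "exec n f m c M tr t M'" "t \<le> T" "runs n f m d M' tr' T' Q"
    using assms unfolding runs_def by blast
  then obtain t' M'' where 2: "exec n f m d M' tr' t' M''" "t' \<le> T'" "Q M''"
    unfolding runs_def by blast
  show ?thesis unfolding runs_def
    using exec_Seq[OF 1(1) 2(1)] 1 2 by (intro exI[of _ "t + t'"] exI[of _ M'']) auto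
qed

lemma runs_If:
  assumes "legal_test m M b" "holds M b \<Longrightarrow> runs n f m c M tr T Q" "\<not> holds M b \<Longrightarrow> runs n f m d M tr T Q"
  shows "runs n f m (If b c d) M tr (cost_test b + T) Q"
proof (cases "holds M b")
  case True
  then obtain t M' where "exec n f m c M tr t M'" "t \<le> T" "Q M'" using assms unfolding runs_def by blast
  then show ?thesis
    using exec_IfTrue[OF assms(1) True] unfolding runs_def by (meson add_left_mono)
next
  case False
  then obtain t M' where "exec n f m d M tr t M'" "t \<le> T" "Q M'" using assms unfolding runs_def by blast
  then show ?thesis
    using exec_IfFalse[OF assms(1) False] unfolding runs_def by (meson add_left_mono)
qed

lemma runs_While_stop:
  "legal_test m M b \<Longrightarrow> \<not> holds M b \<Longrightarrow> Q M \<Longrightarrow> runs n f m (While b c) M [] (cost_test b) Q"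
  unfolding runs_def using exec_WhileFalse by blast

lemma runs_While_step:
  assumes b: "legal_test m M b" "holds M b"
    and c: "runs n f m c M tr T (\<lambda>M'. runs n f m (While b c) M' tr' T' Q)"
  shows "runs n f m (While b c) M (tr @ tr') (cost_test b + T + T') Q"
proof -
  obtain t M' where 1: "exec n f m c M tr t M'" "t \<le> T" "runs n f m (While b c) M' tr' T' Q"
    using c unfolding runs_def by blast
  then obtain t' M'' where 2: "exec n f m (While b c) M' tr' t' M''" "t' \<le> T'" "Q M''"
    unfolding runs_def by blast
  show ?thesis unfolding runs_def
    using exec_WhileTrue[OF b 1(1) 2(1)] 1 2 by (intro exI[of _ "cost_test b + t + t'"] exI[of _ M'']) auto
qed

text \<open>The index k of the invariant is a variant and bounds the number of iterations; the extra
  1 pays for the final test.\<close>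

lemma runs_While:
  assumes inv: "Inv k M"
    and legal: "\<And>k M. Inv k M \<Longrightarrow> legal_test m M b"
    and body: "\<And>k M. Inv k M \<Longrightarrow> holds M b \<Longrightarrow> wp n f m c M (\<lambda>M'. \<exists>k'<k. Inv k' M')"
  shows "runs n f m (While b c) M [] ((k + 1) * (wc c + cost_test b)) (\<lambda>M'. (\<exists>k. Inv k M') \<and> \<not> holds M' b)"
  using inv
proof (induction k arbitrary: M rule: less_induct)
  case (less k)
  let ?Q = "\<lambda>M'. (\<exists>k. Inv k M') \<and> \<not> holds M' b"
  show ?case
  proof (cases "holds M b")
    case False
    show ?thesis
      by (rule runs_mono[OF runs_While_stop[where Q = ?Q]]) (use False less.prems legal in auto)
  next
    case True
    have "runs n f m c M [] (wc c) (\<lambda>M'. runs n f m (While b c) M' [] (k * (wc c + cost_test b)) ?Q)"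
    proof (rule runs_mono[OF wp_runs[OF body[OF less.prems True]]])
      fix M' assume "\<exists>k'<k. Inv k' M'"
      then obtain k' where k': "k' < k" "Inv k' M'" by blast
      show "runs n f m (While b c) M' [] (k * (wc c + cost_test b)) ?Q"
        by (rule runs_mono[OF less.IH[OF k']]) (use k' mult_le_mono1[of "k' + 1" k "wc c + cost_test b"] in auto)
    qed simp
    from runs_While_step[OF legal[OF less.prems] True this]
    have "runs n f m (While b c) M [] (cost_test b + wc c + k * (wc c + cost_test b)) ?Q" by simp
    then show ?thesis by (rule runs_mono) auto
  qed
qed

section \<open>Addresses given by real sums\<close>

lemma nat_floor_sum [simp]:
  "nat \<lfloor>numeral w + real i\<rfloor> = numeral w + i"
  "nat \<lfloor>numeral w + real i + real j\<rfloor> = numeral w + i + j"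
proof -
  have "numeral w + real i = real (numeral w + i)" "numeral w + real i + real j = real (numeral w + i + j)"
    by simp_all
  then show "nat \<lfloor>numeral w + real i\<rfloor> = numeral w + i"
    "nat \<lfloor>numeral w + real i + real j\<rfloor> = numeral w + i + j"
    by (metis floor_of_nat nat_int)+
qed

lemma nat_int_sum [simp]:
  "nat (numeral w + int i) = numeral w + i"
  "nat (numeral w + int i + int j) = numeral w + i + j"
  by (simp_all add: nat_add_distrib)

lemma is_address_real: "is_address m (real k) \<longleftrightarrow> k < m"
  by (auto simp: is_address_def)

lemma is_address_simps [simp]:
  "is_address m 0 \<longleftrightarrow> 0 < m"
  "is_address m 1 \<longleftrightarrow> 1 < m"
  "is_address m (numeral w) \<longleftrightarrow> numeral w < m"
  "is_address m (numeral w + real i) \<longleftrightarrow> numeral w + i < m"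
  "is_address m (numeral w + real i + real j) \<longleftrightarrow> numeral w + i + j < m"
  using is_address_real[of m 0] is_address_real[of m 1] is_address_real[of m "numeral w"]
    is_address_real[of m "numeral w + i"] is_address_real[of m "numeral w + i + j"]
  by simp_all

lemma is_block_real: "is_block n m (real k) \<longleftrightarrow> k + n < m"
  by (auto simp: is_block_def)

lemma is_block_simps [simp]:
  "is_block n m (numeral w) \<longleftrightarrow> numeral w + n < m"
  "is_block n m (numeral w + real i) \<longleftrightarrow> numeral w + i + n < m"
  using is_block_real[of n m "numeral w"] is_block_real[of n m "numeral w + i"]
  by simp_all

text \<open>The vertex is stored in the cells 20 + i and the sign vector T in the cells 20 + n + i, for i in
  1, ..., n.  The other cells: 1, 2 the pair to be tried next; 3, 4 the pair (a, b) of a move; 5, 6 their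
  coordinates, which the canonical chain has to avoid; 7, 8, 9 a code, its coordinate and sign;
  10 the answer of the oracle; 11 the value of f at T; 12 the last code; 13, 14 the last descent;
  15 the length of the chain; 16 the length of the move; 17, 18 the signs of a and b; 19 an
  intermediate result; 20 is 1 after
  the search has ended.\<close>

abbreviation (input) R :: "nat \<Rightarrow> exp" where "R k \<equiv> Cell (Num (int k))"
abbreviation (input) Va :: "exp \<Rightarrow> exp" where "Va e \<equiv> Add (Num 20) e"
abbreviation (input) Ta :: "exp \<Rightarrow> exp" where "Ta e \<equiv> Add (Add (Num 20) (R 0)) e"
abbreviation (input) Set :: "nat \<Rightarrow> exp \<Rightarrow> com" where "Set k e \<equiv> Assign (Num (int k)) e"
abbreviation (input) Ask :: com where "Ask \<equiv> Query (Num 10) (Add (Num 20) (R 0))"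

definition decode :: "nat \<Rightarrow> nat \<Rightarrow> nat \<Rightarrow> com" where
  "decode y i s = If (Less (R 0) (R y))
     (Seq (Set i (Sub (Add (Mul (Num 2) (R 0)) (Num 1)) (R y))) (Set s (Num (- 1))))
     (Seq (Set i (R y)) (Set s (Num 1)))"

definition clear_body :: com where
  "clear_body = Seq (Assign (Ta (R 7)) (Num 0)) (Set 7 (Add (R 7) (Num 1)))"

definition accept_com :: com where
  "accept_com = Seq (Set 11 (R 10))
    (Seq (If (Less (R 7) (R 12)) (Seq (Set 13 (R 12)) (Set 14 (R 7))) Skip)
    (Seq (Set 12 (R 7)) (Seq (Set 15 (Add (R 15) (Num 1))) (Set 7 (Num 0)))))"

text \<open>Since the current T is tight, the extended vector is tight iff the new value of f
  exceeds the old one by the signed coordinate. No inner product is computed, so each trial takes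
  constant time; a refused code is erased from T.\<close>

definition try_com :: com where
  "try_com = Seq (Assign (Ta (R 8)) (R 9))
    (Seq Ask
    (If (Eq (R 10) (Add (R 11) (Mul (R 9) (Cell (Va (R 8)))))) accept_com (Assign (Ta (R 8)) (Num 0))))"

text \<open>After a code has been accepted, the scan starts again from 0 + 1.\<close>

definition scan_body :: com where
  "scan_body = Seq (decode 7 8 9)
    (Seq (If (And (Not (Eq (R 8) (R 5))) (And (Not (Eq (R 8) (R 6))) (Eq (Cell (Ta (R 8))) (Num 0))))
       try_com Skip)
    (Set 7 (Add (R 7) (Num 1))))"

definition scan_init :: com where
  "scan_init = Seq (Set 11 (Num 0)) (Seq (Set 12 (Num 0)) (Seq (Set 13 (Num 0)) (Seq (Set 14 (Num 0))
     (Seq (Set 15 (Num 0)) (Set 7 (Num 1))))))"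

definition clear_test :: test where "clear_test = Not (Less (R 0) (R 7))"
definition scan_test :: test where "scan_test = Not (Less (Mul (Num 2) (R 0)) (R 7))"

definition greedy_com :: com where
  "greedy_com = Seq (Set 7 (Num 1)) (Seq (While clear_test clear_body)
     (Seq scan_init (While scan_test scan_body)))"

context bisub
begin

text \<open>Cells 0, ..., 20 and two blocks of n cells, for the vertex and the sign vector.\<close>

abbreviation space :: nat where "space \<equiv> 21 + 2 * n"
abbreviation wps where "wps \<equiv> wp n f space"
abbreviation rns where "rns \<equiv> runs n f space"

definition memv :: "memory \<Rightarrow> rvec \<Rightarrow> bool" where
  "memv M v \<longleftrightarrow> M 0 = real n \<and> (\<forall>i\<in>{1..n}. M (20 + i) = v i)"

definition memT :: "memory \<Rightarrow> rvec \<Rightarrow> bool" where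
  "memT M T \<longleftrightarrow> (\<forall>i\<in>{1..n}. M (20 + n + i) = T i)"

definition same_but :: "nat set \<Rightarrow> memory \<Rightarrow> memory \<Rightarrow> bool" where
  "same_but A M M' \<longleftrightarrow> (\<forall>k. k \<notin> A \<longrightarrow> M' k = M k)"

lemma memv_upd [simp]: "k \<le> 20 \<Longrightarrow> k \<noteq> 0 \<Longrightarrow> memv (M(k := x)) v = memv M v"
  by (auto simp: memv_def)

lemma memT_upd [simp]: "k \<le> 20 \<Longrightarrow> memT (M(k := x)) T = memT M T"
  by (auto simp: memT_def)

lemma memv_updT [simp]: "i \<ge> 1 \<Longrightarrow> memv (M(20 + n + i := x)) v = memv M v"
  by (auto simp: memv_def)

lemma signed_set_at_eq: "signed_set_at n M b = signed_set_of n (vector_at n M b)"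
  by (simp add: signed_set_at_def signed_set_of_def)

lemma vector_at_upd:
  "k \<le> 20 \<Longrightarrow> vector_at n (M(k := x)) (20 + real n) = vector_at n M (20 + real n)"
  "i \<in> {1..n} \<Longrightarrow> vector_at n (M(20 + i := x)) (20 + real n) = vector_at n M (20 + real n)"
  "i \<in> {1..n} \<Longrightarrow> vector_at n (M(20 + n + i := x)) (20 + real n) = (vector_at n M (20 + real n))(i := x)"
  by (auto simp: vector_at_def fun_eq_iff)

lemma memT_svec: "code_list n l \<Longrightarrow> memT M (svec n l) \<longleftrightarrow> vector_at n M (20 + real n) = svec n l"
  using sign_vec_svec[of n l] by (auto simp: vector_at_def memT_def fun_eq_iff sign_vec_def)

lemma svec_ternary: "code_list n l \<Longrightarrow> \<forall>i\<in>{1..n}. svec n l i = - 1 \<or> svec n l i = 0 \<or> svec n l i = 1"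
  using sign_vec_svec[of n l] by (auto simp: sign_vec_def)

lemma wp_If:
  assumes "legal_test space M t" "holds M t \<Longrightarrow> wps c M Q" "\<not> holds M t \<Longrightarrow> wps d M Q"
  shows "wps (If t c d) M Q"
  using assms by simp

lemma wp_decode:
  assumes M: "M 0 = real n" "M y = real c" "c \<in> codes n"
    and r: "y \<in> {1..20}" "i \<in> {1..20}" "s \<in> {1..20}" "i \<noteq> s" "i \<noteq> y"
    and Q: "Q (M(i := real (idx n c), s := sg n c))"
  shows "wps (decode y i s) M Q"
proof -
  have a: "is_address space (real k)" if "k \<in> {1..20}" for k
    using that by (simp add: is_address_real)
  have "real (2 * n + 1 - c) = 2 * real n + 1 - real c" using M(3) by (auto simp: codes_def of_nat_diff)
  then show ?thesis
    using assms a by (auto simp: decode_def idx_def sg_def is_address_real)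
qed


text \<open>The cells that the construction of a canonical chain may change.\<close>

definition scratch :: "nat set" where
  "scratch = {7..15} \<union> {20 + n + 1..20 + 2 * n}"

text \<open>Cell 11 is meant to hold f at the current vector. It is described by the inner product,
  which is the same for a tight vector and turns the comparison in \<open>try_com\<close> into a
  statement about slack.\<close>

definition greedy_state :: "memory \<Rightarrow> rvec \<Rightarrow> nat list \<Rightarrow> bool" where
  "greedy_state M v l \<longleftrightarrow> memv M v \<and> memT M (svec n l) \<and> M 11 = dot n (svec n l) v \<and>
     M 12 = real (fst (descent l)) \<and> M 13 = real (fst (snd (descent l))) \<and>
     M 14 = real (snd (snd (descent l))) \<and> M 15 = real (length l)"

lemma same_but_refl [simp]: "same_but A M M"
  by (simp add: same_but_def)

lemma same_but_trans: "same_but A M M' \<Longrightarrow> same_but A M' M'' \<Longrightarrow> same_but A M M''"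
  by (simp add: same_but_def)

lemma same_but_upd: "same_but A M M' \<Longrightarrow> k \<in> A \<Longrightarrow> same_but A M (M'(k := x))"
  by (auto simp: same_but_def)

lemma same_but_upd_iff: "k \<in> A \<Longrightarrow> same_but A M (M'(k := x)) = same_but A M M'"
  by (auto simp: same_but_def)

text \<open>The inequations are stated in both directions because the simplifier would otherwise split
  on \<open>n = 0\<close> when it compares addresses.\<close>

lemma address_facts:
  assumes "i \<in> {1..n}" "j \<in> {1..n}"
  shows "is_address space (20 + real i)" "is_address space (20 + real n + real i)"
    "is_block n space (20 + real n)"
    "j \<noteq> n + i" "n + i \<noteq> j" "i \<noteq> n + i" "n \<noteq> 0" "n > 0"
    "vector_at n (N(20 + n + i := x)) (20 + real n) = (vector_at n N (20 + real n))(i := x)"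
    "vector_at n (N(20 + i := x)) (20 + real n) = vector_at n N (20 + real n)"
    "memv (N(20 + n + i := x)) v = memv N v" "20 + n + i \<in> scratch"
  using assms by (simp_all add: vector_at_upd scratch_def)

lemmas sum_address_simps = is_address_simps(4,5) is_block_simps memv_updT

lemma scratch_regs: "7 \<in> scratch" "10 \<in> scratch" "11 \<in> scratch" "12 \<in> scratch" "13 \<in> scratch"
    "14 \<in> scratch" "15 \<in> scratch"
  by (simp_all add: scratch_def)

lemma wp_set:
  assumes "k \<le> 20" "legal space M e" "Q (M(k := ev M e))"
  shows "wps (Set k e) M Q"
  using assms by (simp add: is_address_real)

lemma wp_try:
  assumes g: "greedy_state M v l" and c: "code_list n (l @ [y])"
    and r: "M 7 = real y" "M 8 = real (idx n y)" "M 9 = sg n y"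
  shows "wps try_com M (\<lambda>M'. same_but scratch M M' \<and>
    (if slack v (svec n (l @ [y])) = 0 then greedy_state M' v (l @ [y]) \<and> M' 7 = 0
     else greedy_state M' v l \<and> M' 7 = real y))"
proof -
  have y: "y \<in> codes n" "idx n y \<notin> idx n ` set l" and l: "code_list n l" using c by (auto simp: code_list_snoc)
  define i where "i = idx n y"
  have i: "i \<in> {1..n}" using idx_range[OF y(1)] by (simp add: i_def)
  obtain p a b where d: "descent l = (p, a, b)" by (metis prod_cases3)
  have gs: "memv M v" "M 0 = real n" "M (20 + i) = v i" "vector_at n M (20 + real n) = svec n l"
    "M 11 = dot n (svec n l) v" "M 12 = real p" "M 13 = real a" "M 14 = real b" "M 15 = real (length l)"
    "M 8 = real i"
    using g d memT_svec[OF l] i r by (simp_all add: greedy_state_def memv_def i_def)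
  have up: "(svec n l)(i := sg n y) = svec n (l @ [y])" "(svec n l)(i := 0) = svec n l"
    using y(2) by (auto simp: fun_eq_iff svec_snoc svec_notin unit_def i_def)
  have dt: "dot n (svec n (l @ [y])) v = dot n (svec n l) v + sg n y * v i"
    by (simp add: dot_snoc[OF y(1)] i_def)
  note af = address_facts[OF i i]
  note ex = try_com_def accept_com_def gs r(1,3) up dt af vector_at_upd(1) signed_set_at_eq scratch_regs
    svec_ternary[OF c, simplified] same_but_upd_iff greedy_state_def memT_svec[OF c] memT_svec[OF l]
    descent_snoc d
  show ?thesis
    by ((simp (no_asm) add: ex del: sum_address_simps wp.simps(7)) | rule wp_If
      | (simp add: ex slack_def del: sum_address_simps; fail))+
qed

text \<open>All codes below y have been refused for the current l. Accepting a code may make smaller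
  ones available, so the scan must then restart at 1. The value 2 n + 1 of y means that the chain is
  complete.\<close>

definition scan_inv :: "memory \<Rightarrow> rvec \<Rightarrow> nat \<Rightarrow> nat \<Rightarrow> nat list \<Rightarrow> nat \<Rightarrow> bool" where
  "scan_inv M v p q l y \<longleftrightarrow> greedy_state M v l \<and> M 5 = real p \<and> M 6 = real q \<and> M 7 = real y \<and>
     greedy_prefix v {p, q} l \<and> (\<forall>z<y. \<not> avail v {p, q} l z) \<and> 1 \<le> y \<and> y \<le> 2 * n + 1"

lemma wp_scan:
  assumes s: "scan_inv M v p q l y" and y: "y \<le> 2 * n"
  shows "wps scan_body M (\<lambda>M'. same_but scratch M M' \<and>
    (if avail v {p, q} l y then scan_inv M' v p q (l @ [y]) 1 else scan_inv M' v p q l (y + 1)))"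
proof -
  have yc: "y \<in> codes n" using s y by (simp add: scan_inv_def codes_def)
  have g: "greedy_state M v l" and r: "M 5 = real p" "M 6 = real q" "M 7 = real y"
    using s by (auto simp: scan_inv_def)
  have lc: "code_list n l" using s greedy_prefix_tight unfolding scan_inv_def tight_list_def by blast
  define i where "i = idx n y"
  have i: "i \<in> {1..n}" using idx_range[OF yc] by (simp add: i_def)
  define M1 where "M1 = M(8 := real i, 9 := sg n y)"
  have g1: "greedy_state M1 v l" using g by (simp add: greedy_state_def M1_def)
  have r1: "M1 5 = real p" "M1 6 = real q" "M1 7 = real y" "M1 8 = real i" "M1 9 = sg n y"
    using r by (simp_all add: M1_def)
  have m0: "M1 0 = real n" "M1 (20 + n + i) = svec n l i"
    using g1 i by (simp_all add: greedy_state_def memv_def memT_def)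
  have sb: "same_but scratch M M1"
    unfolding M1_def by (intro same_but_upd same_but_refl) (auto simp: scratch_def)
  let ?C = "And (Not (Eq (R 8) (R 5))) (And (Not (Eq (R 8) (R 6))) (Eq (Cell (Ta (R 8))) (Num 0)))"
  let ?Q = "\<lambda>M'. same_but scratch M M' \<and>
    (if avail v {p, q} l y then scan_inv M' v p q (l @ [y]) 1 else scan_inv M' v p q l (y + 1))"
  have legal: "legal_test space M1 ?C" using i by (simp add: r1 m0)
  have hold: "holds M1 ?C \<longleftrightarrow> i \<notin> {p, q} \<and> i \<notin> idx n ` set l"
    using svec_nz[OF lc, of i] by (simp add: r1 m0) blast
  have inc: "wps (Set 7 (Add (R 7) (Num 1))) M' ?Q"
    if "same_but scratch M M'" "if avail v {p, q} l y then greedy_state M' v (l @ [y]) \<and> M' 7 = 0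
     else greedy_state M' v l \<and> M' 7 = real y" for M'
  proof (rule wp_set)
    show "legal space M' (Add (R 7) (Num 1))" by simp
    let ?N = "M'(7 := ev M' (Add (R 7) (Num 1)))"
    have "same_but scratch M ?N" using that(1) by (intro same_but_upd) (auto simp: scratch_def)
    moreover have "?N 5 = real p" "?N 6 = real q"
      using that(1) r by (simp_all add: same_but_def scratch_def)
    moreover have "scan_inv ?N v p q (l @ [y]) 1" if a: "avail v {p, q} l y" "greedy_state M' v (l @ [y])" "M' 7 = 0"
      using a calculation greedy_snoc[of v "{p, q}" l y] s
      by (simp add: scan_inv_def greedy_state_def) (simp add: avail_def codes_def)
    moreover have "scan_inv ?N v p q l (y + 1)" if a: "\<not> avail v {p, q} l y" "greedy_state M' v l" "M' 7 = real y"
      using a calculation s y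
      by (simp add: scan_inv_def greedy_state_def less_Suc_eq) 
    ultimately show "?Q ?N" using that(2) by (auto split: if_splits)
  qed simp
  have "wps (If ?C try_com Skip) M1 (\<lambda>M'. wps (Set 7 (Add (R 7) (Num 1))) M' ?Q)"
  proof (cases "i \<notin> {p, q} \<and> i \<notin> idx n ` set l")
    case True
    then have c: "code_list n (l @ [y])" using lc yc by (simp add: code_list_snoc i_def)
    have a: "avail v {p, q} l y \<longleftrightarrow> slack v (svec n (l @ [y])) = 0"
      using True yc by (simp add: avail_def i_def)
    have "wps try_com M1 (\<lambda>M'. wps (Set 7 (Add (R 7) (Num 1))) M' ?Q)"
    proof (rule wp_mono[OF wp_try[OF g1 c r1(3) _ r1(5)]])
      show "M1 8 = real (idx n y)" using r1 i_def by simp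
      fix M' assume "same_but scratch M1 M' \<and> (if slack v (svec n (l @ [y])) = 0
        then greedy_state M' v (l @ [y]) \<and> M' 7 = 0 else greedy_state M' v l \<and> M' 7 = real y)"
      then show "wps (Set 7 (Add (R 7) (Num 1))) M' ?Q"
        by (intro inc) (use same_but_trans[OF sb] a in auto)
    qed
    then show ?thesis unfolding wp.simps(7) using legal hold True by blast
  next
    case False
    then have a: "\<not> avail v {p, q} l y" by (auto simp: avail_def i_def)
    have "wps Skip M1 (\<lambda>M'. wps (Set 7 (Add (R 7) (Num 1))) M' ?Q)"
      unfolding wp.simps(1) by (rule inc[OF sb]) (use a g1 r1 in simp)
    then show ?thesis unfolding wp.simps(7) using legal hold False by blast
  qed
  then have Q: "wps (If ?C try_com Skip) (M(8 := real (idx n y), 9 := sg n y))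
      (\<lambda>M'. wps (Set 7 (Add (R 7) (Num 1))) M' ?Q)"
    by (simp only: M1_def i_def)
  show ?thesis
    unfolding scan_body_def wp.simps(6)
    by (rule wp_decode[where y = 7 and c = y and M = M and i = 8 and s = 9]; (rule Q)?)
      (use g r(3) yc in \<open>simp_all add: greedy_state_def memv_def\<close>)
qed

definition scan_time :: "nat \<Rightarrow> nat" where
  "scan_time k = (k + 1) * (wc scan_body + cost_test scan_test)"

lemma runs_scan:
  assumes s: "scan_inv M v p q [] 1"
  shows "rns (While scan_test scan_body) M [] (scan_time (n * (2 * n + 1) + 2 * n))
    (\<lambda>M'. same_but scratch M M' \<and> greedy_state M' v (glist v {p, q}))"
proof -
  \<comment> \<open>The variant is lexicographic: an accepted code lowers the first term by 2 n + 1,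
    while the restart resets the second to no more than 2 n.\<close>
  define Inv where "Inv k M' \<longleftrightarrow> same_but scratch M M' \<and>
    (\<exists>l y. scan_inv M' v p q l y \<and> k = (n - length l) * (2 * n + 1) + (2 * n + 1 - y))" for k M'
  have "Inv (n * (2 * n + 1) + 2 * n) M" unfolding Inv_def
    using s by (intro conjI exI[of _ "[]"] exI[of _ 1]) auto
  then have "rns (While scan_test scan_body) M []
      ((n * (2 * n + 1) + 2 * n + 1) * (wc scan_body + cost_test scan_test))
    (\<lambda>M'. (\<exists>k. Inv k M') \<and> \<not> holds M' scan_test)"
  proof (rule runs_While)
    fix k M' assume I: "Inv k M'"
    then obtain l y where M': "same_but scratch M M'" "scan_inv M' v p q l y"
      and k: "k = (n - length l) * (2 * n + 1) + (2 * n + 1 - y)" unfolding Inv_def by blast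
    show "legal_test space M' scan_test" by (simp add: scan_test_def)
    have m: "M' 0 = real n" "M' 7 = real y" using M' by (auto simp: scan_inv_def greedy_state_def memv_def)
    assume "holds M' scan_test"
    then have "\<not> real (2 * n) < real y" by (simp add: scan_test_def m)
    then have y: "y \<le> 2 * n" by (simp only: of_nat_less_iff not_less)
    show "wps scan_body M' (\<lambda>M''. \<exists>k'<k. Inv k' M'')"
    proof (rule wp_mono[OF wp_scan[OF M'(2) y]], elim conjE)
      fix M'' assume sb: "same_but scratch M' M''" and
        d: "if avail v {p, q} l y then scan_inv M'' v p q (l @ [y]) 1 else scan_inv M'' v p q l (y + 1)"
      have sb': "same_but scratch M M''" using same_but_trans[OF M'(1) sb] .
      show "\<exists>k'<k. Inv k' M''"
      proof (cases "avail v {p, q} l y")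
        case True
        then have sc: "scan_inv M'' v p q (l @ [y]) 1" using d by simp
        then have "length (l @ [y]) \<le> n"
          using greedy_prefix_tight[of v "{p, q}" "l @ [y]"] code_list_length[of n "l @ [y]"]
          by (simp only: scan_inv_def tight_list_def)
        then obtain e where e: "n - length l = Suc e" "n - length (l @ [y]) = e" by (cases "n - length l") auto
        show ?thesis
        proof (intro exI conjI)
          show "Inv (e * (2 * n + 1) + (2 * n + 1 - 1)) M''"
            unfolding Inv_def using sb' sc e(2) by (intro conjI exI[of _ "l @ [y]"] exI[of _ 1]) simp_all
          show "e * (2 * n + 1) + (2 * n + 1 - 1) < k" unfolding k e using y by simp
        qed
      next
        case False
        then have sc: "scan_inv M'' v p q l (y + 1)" using d by simp
        show ?thesis
        proof (intro exI conjI)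
          show "Inv ((n - length l) * (2 * n + 1) + (2 * n + 1 - (y + 1))) M''"
            unfolding Inv_def using sb' sc by (intro conjI exI[of _ l] exI[of _ "y + 1"]) simp_all
          show "(n - length l) * (2 * n + 1) + (2 * n + 1 - (y + 1)) < k" unfolding k using y by simp
        qed
      qed
    qed
  qed
  then show ?thesis
  proof (rule runs_mono)
    show "(n * (2 * n + 1) + 2 * n + 1) * (wc scan_body + cost_test scan_test)
      \<le> scan_time (n * (2 * n + 1) + 2 * n)" by (simp add: scan_time_def)
    fix M' assume A: "(\<exists>k. Inv k M') \<and> \<not> holds M' scan_test"
    then have h: "\<not> holds M' scan_test" by (rule conjunct2)
    obtain k where I: "Inv k M'" using conjunct1[OF A] by (rule exE)
    from I obtain l y where M': "same_but scratch M M'" "scan_inv M' v p q l y" unfolding Inv_def by blast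
    have m: "M' 0 = real n" "M' 7 = real y" using M' by (auto simp: scan_inv_def greedy_state_def memv_def)
    then have "real (2 * n) < real y" using h by (simp add: scan_test_def)
    then have y: "2 * n < y" by (simp only: of_nat_less_iff)
    have "\<not> avail v {p, q} l z" for z
    proof (cases "z < y")
      case True
      then show ?thesis using M'(2) by (simp add: scan_inv_def)
    next
      case False
      then show ?thesis using y by (auto simp: avail_def codes_def)
    qed
    then have "greedy v {p, q} l" using M'(2) by (simp add: greedy_def scan_inv_def)
    then have "glist v {p, q} = l" by (rule glist_eqI)
    then show "same_but scratch M M' \<and> greedy_state M' v (glist v {p, q})"
      using M' by (simp add: scan_inv_def)
  qed
qed

lemma runs_clear:
  assumes m: "memv M v" and 7: "M 7 = 1"
  shows "rns (While clear_test clear_body) M [] ((n + 1) * (wc clear_body + cost_test clear_test))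
    (\<lambda>M'. same_but scratch M M' \<and> memv M' v \<and> memT M' (svec n []))"
proof -
  define Inv where "Inv k M' \<longleftrightarrow> same_but scratch M M' \<and> memv M' v \<and>
    (\<exists>i. M' 7 = real i \<and> 1 \<le> i \<and> i \<le> n + 1 \<and> k = n + 1 - i \<and> (\<forall>j. 1 \<le> j \<and> j < i \<longrightarrow> M' (20 + n + j) = 0))" for k M'
  have "Inv n M" unfolding Inv_def using m 7 by (intro conjI exI[of _ 1]) auto
  then have "rns (While clear_test clear_body) M [] ((n + 1) * (wc clear_body + cost_test clear_test))
    (\<lambda>M'. (\<exists>k. Inv k M') \<and> \<not> holds M' clear_test)"
  proof (rule runs_While)
    fix k M' assume I: "Inv k M'"
    then obtain i where M': "same_but scratch M M'" "memv M' v" "M' 7 = real i" "1 \<le> i" "i \<le> n + 1"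
      "k = n + 1 - i" "\<forall>j. 1 \<le> j \<and> j < i \<longrightarrow> M' (20 + n + j) = 0" unfolding Inv_def by blast
    show "legal_test space M' clear_test" by (simp add: clear_test_def)
    have m0: "M' 0 = real n" using M' by (simp add: memv_def)
    assume "holds M' clear_test"
    then have i: "i \<le> n" by (simp add: clear_test_def m0 M')
    let ?N = "M'(20 + n + i := 0, 7 := real i + 1)"
    have "same_but scratch M ?N" using M'(1) i M'(4) by (intro same_but_upd) (auto simp: scratch_def)
    moreover have "memv ?N v" using M'(2,4) by simp
    moreover have "\<forall>j. 1 \<le> j \<and> j < i + 1 \<longrightarrow> ?N (20 + n + j) = 0" using M'(7) by (auto simp: less_Suc_eq)
    ultimately have "Inv (n + 1 - (i + 1)) ?N" unfolding Inv_def using i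
      by (intro conjI exI[of _ "i + 1"]) auto
    moreover have "n + 1 - (i + 1) < k" using i M' by simp
    ultimately have "\<exists>k'<k. Inv k' ?N" by blast
    then show "wps clear_body M' (\<lambda>M''. \<exists>k'<k. Inv k' M'')"
      using i M'(3) m0 by (simp add: clear_body_def)
  qed
  then show ?thesis
  proof (rule runs_mono)
    show "(n + 1) * (wc clear_body + cost_test clear_test) \<le> (n + 1) * (wc clear_body + cost_test clear_test)" ..
    fix M' assume A: "(\<exists>k. Inv k M') \<and> \<not> holds M' clear_test"
    then have h: "\<not> holds M' clear_test" by (rule conjunct2)
    obtain k where I: "Inv k M'" using conjunct1[OF A] by (rule exE)
    have M': "same_but scratch M M'" "memv M' v" using I unfolding Inv_def by blast+
    have "\<exists>i. M' 7 = real i \<and> i \<le> n + 1 \<and> (\<forall>j. 1 \<le> j \<and> j < i \<longrightarrow> M' (20 + n + j) = 0)"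
      using I unfolding Inv_def by (elim conjE exE) (rule exI, intro conjI, assumption+)
    then obtain i where i: "M' 7 = real i \<and> i \<le> n + 1 \<and> (\<forall>j. 1 \<le> j \<and> j < i \<longrightarrow> M' (20 + n + j) = 0)"
      ..
    have "M' 0 = real n" using M' by (simp add: memv_def)
    then have "n < i" using h i by (simp add: clear_test_def)
    then show "same_but scratch M M' \<and> memv M' v \<and> memT M' (svec n [])"
      using M' i by (auto simp: memT_def)
  qed
qed

definition greedy_time :: nat where
  "greedy_time = wc (Set 7 (Num 1)) + (n + 1) * (wc clear_body + cost_test clear_test) + wc scan_init +
     scan_time (n * (2 * n + 1) + 2 * n)"

lemma runs_greedy:
  assumes m: "memv M v" and pq: "M 5 = real p" "M 6 = real q"
  shows "rns greedy_com M [] greedy_time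
    (\<lambda>M'. same_but scratch M M' \<and> greedy_state M' v (glist v {p, q}))"
proof -
  let ?Q = "\<lambda>M'. same_but scratch M M' \<and> greedy_state M' v (glist v {p, q})"
  let ?T = "scan_time (n * (2 * n + 1) + 2 * n)"
  have a: "rns (While scan_test scan_body) M1 [] ?T ?Q"
    if "same_but scratch M M1" "scan_inv M1 v p q [] 1" for M1
    by (rule runs_mono[OF runs_scan[OF that(2)]]) (use same_but_trans[OF that(1)] in auto)
  have b: "wps scan_init M1 (\<lambda>M2. rns (While scan_test scan_body) M2 [] ?T ?Q)"
    if h: "same_but scratch M M1" "memv M1 v" "memT M1 (svec n [])" for M1
  proof -
    define M2 where "M2 = M1(11 := 0, 12 := 0, 13 := 0, 14 := 0, 15 := 0, 7 := 1::real)"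
    have "same_but scratch M M2" unfolding M2_def
      using h(1) by (intro same_but_upd) (auto simp: scratch_def)
    moreover have "M2 5 = real p" "M2 6 = real q" using pq calculation by (simp_all add: same_but_def scratch_def)
    moreover have "\<not> avail v {p, q} [] 0" by (simp add: avail_def codes_def)
    then have "scan_inv M2 v p q [] 1" unfolding scan_inv_def
      using h calculation greedy_Nil by (simp add: M2_def greedy_state_def descent_def dot_def)
    ultimately have "rns (While scan_test scan_body) M2 [] ?T ?Q" by (intro a)
    then show ?thesis by (simp add: scan_init_def M2_def)
  qed
  let ?R = "Seq scan_init (While scan_test scan_body)"
  have c: "rns ?R M1 [] (wc scan_init + ?T) ?Q"
    if "same_but scratch M M1" "memv M1 v" "memT M1 (svec n [])" for M1
    using runs_Seq[OF wp_runs[OF b[OF that]]] by simp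
  let ?cl = "(n + 1) * (wc clear_body + cost_test clear_test)"
  have d: "rns (Seq (While clear_test clear_body) ?R) M1 [] (?cl + (wc scan_init + ?T)) ?Q"
    if h: "same_but scratch M M1" "memv M1 v" "M1 7 = 1" for M1
  proof -
    have "rns (While clear_test clear_body) M1 [] ?cl (\<lambda>M2. rns ?R M2 [] (wc scan_init + ?T) ?Q)"
    proof (rule runs_mono[OF runs_clear[OF h(2,3)] order_refl])
      fix M2 assume "same_but scratch M1 M2 \<and> memv M2 v \<and> memT M2 (svec n [])"
      then show "rns ?R M2 [] (wc scan_init + ?T) ?Q"
        using same_but_trans[OF h(1)] by (intro c) blast+
    qed
    from runs_Seq[OF this] show ?thesis by simp
  qed
  have "wps (Set 7 (Num 1)) M (\<lambda>M1. rns (Seq (While clear_test clear_body) ?R) M1 []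
      (?cl + (wc scan_init + ?T)) ?Q)"
  proof (rule wp_set)
    show "rns (Seq (While clear_test clear_body) ?R) (M(7 := ev M (Num 1))) []
      (?cl + (wc scan_init + ?T)) ?Q"
      by (rule d) (use m in \<open>auto intro!: same_but_upd simp: scratch_def\<close>)
  qed simp_all
  from runs_Seq[OF wp_runs[OF this]]
  show ?thesis unfolding greedy_com_def greedy_time_def by (simp add: add.assoc)
qed

end

section \<open>Moves and the pair of a vertex on the machine\<close>

definition probe :: "nat \<Rightarrow> nat \<Rightarrow> com" where
  "probe k s = Seq (Assign (Ta (R k)) (R s)) Ask"

definition edge_init :: com where
  "edge_init = Seq (decode 3 5 17) (decode 4 6 18)"

text \<open>T + b has been found tight and b is erased; then T + a gives the candidate length in
  cell 19, and adding b again gives T + a + b. All comparisons use the one stored value of f at T,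
  and cell 16 stays 0 unless every condition holds.\<close>

definition check_rest :: com where
  "check_rest = Seq (Assign (Ta (R 6)) (Num 0)) (Seq (probe 5 17)
    (Seq (Set 19 (Sub (R 10) (Add (R 11) (Mul (R 17) (Cell (Va (R 5)))))))
    (If (Eq (R 5) (R 6))
      (If (Eq (R 15) (Sub (R 0) (Num 1))) (Set 16 (R 19)) Skip)
      (Seq (probe 6 18)
        (If (Eq (R 10) (Add (Add (R 11) (Mul (R 18) (Cell (Va (R 6))))) (Mul (R 17) (Cell (Va (R 5))))))
          (Set 16 (R 19)) Skip)))))"

definition edge_check :: com where
  "edge_check = Seq (Set 16 (Num 0)) (Seq (probe 6 18)
    (If (Eq (R 10) (Add (R 11) (Mul (R 18) (Cell (Va (R 6)))))) check_rest Skip))"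

definition move_com :: com where
  "move_com = Seq (Assign (Va (R 5)) (Add (Cell (Va (R 5))) (Mul (R 16) (R 17))))
    (If (Eq (R 5) (R 6)) Skip (Assign (Va (R 6)) (Sub (Cell (Va (R 6))) (Mul (R 16) (R 18)))))"

text \<open>Reuses the length in cell 16 with the opposite sign, which avoids building another
  chain.\<close>

definition undo_com :: com where
  "undo_com = Seq edge_init (Seq (Set 16 (Sub (Num 0) (R 16))) move_com)"

definition edge_com :: com where
  "edge_com = Seq edge_init (Seq greedy_com (Seq edge_check move_com))"

text \<open>Accounts for the code appended in \<open>pair\<close>: the negative of the last code is
  smaller than that code iff the latter exceeds n.\<close>

definition last_com :: com where
  "last_com = If (Less (R 0) (R 12)) (Seq (Set 13 (R 12)) (Set 14 (Sub (Add (Mul (Num 2) (R 0)) (Num 1)) (R 12)))) Skip"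

definition pair_com :: com where
  "pair_com = Seq (Seq (Set 5 (Num 0)) (Set 6 (Num 0))) (Seq greedy_com last_com)"

context bisub
begin

text \<open>The complement contains the counters, the pair in cells 3 and 4 and the stop flag, which
  a move must preserve.\<close>

definition work :: "nat set" where
  "work = {5..19} \<union> {21..20 + 2 * n}"

lemma same_but_mono: "same_but A M M' \<Longrightarrow> A \<subseteq> B \<Longrightarrow> same_but B M M'"
  by (auto simp: same_but_def)

lemma wp_edge_init:
  assumes "M 0 = real n" "M 3 = real a" "M 4 = real b" "a \<in> codes n" "b \<in> codes n"
    "Q (M(5 := real (idx n a), 17 := sg n a, 6 := real (idx n b), 18 := sg n b))"
  shows "wps edge_init M Q"
  unfolding edge_init_def wp.simps(6)
  by (rule wp_decode[where c = a], use assms in simp_all)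
    (rule wp_decode[where c = b], use assms in simp_all)

lemma wp_edge_check:
  assumes g: "greedy_state M v (glist v {idx n a, idx n b})" and ab: "a \<in> codes n" "b \<in> codes n"
    and r: "M 5 = real (idx n a)" "M 6 = real (idx n b)" "M 17 = sg n a" "M 18 = sg n b"
  shows "wps edge_check M (\<lambda>M'. same_but (scratch \<union> {16, 19}) M M' \<and> memv M' v \<and> M' 16 = W v a b)"
proof -
  define l where "l = glist v {idx n a, idx n b}"
  define i j where "i = idx n a" and "j = idx n b"
  define w where "w = W v a b"
  have av: "i \<notin> idx n ` set l" "j \<notin> idx n ` set l"
    using glist_avoids[of v "{i, j}"] by (auto simp: l_def i_def j_def)
  have lc: "code_list n l" unfolding l_def by (rule glist_code_list)
  have c: "code_list n (l @ [a])" "code_list n (l @ [b])" "i \<noteq> j \<Longrightarrow> code_list n (l @ [a, b])"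
    using lc av ab by (auto simp: code_list_append i_def j_def) (auto simp: code_list_def)
  have ij: "i \<in> {1..n}" "j \<in> {1..n}" using idx_range ab by (auto simp: i_def j_def)
  have gs: "memv M v" "M 0 = real n" "M (20 + i) = v i" "M (20 + j) = v j" "M 5 = real i" "M 6 = real j"
    "vector_at n M (20 + real n) = svec n l" "M 11 = dot n (svec n l) v" "M 15 = real (length l)"
    using g memT_svec[OF lc] ij r by (simp_all add: greedy_state_def l_def memv_def i_def j_def)
  have up: "(svec n l)(i := sg n a) = svec n (l @ [a])" "(svec n l)(j := sg n b) = svec n (l @ [b])"
    "(svec n l)(j := 0) = svec n l" "i \<noteq> j \<Longrightarrow> (svec n (l @ [a]))(j := sg n b) = svec n (l @ [a, b])"
    using av by (auto simp: fun_eq_iff svec_append svec_notin unit_def i_def j_def)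
  have d: "dot n (svec n (l @ [a])) v = dot n (svec n l) v + sg n a * v i"
    "dot n (svec n (l @ [b])) v = dot n (svec n l) v + sg n b * v j"
    "dot n (svec n (l @ [a, b])) v = dot n (svec n l) v + sg n b * v j + sg n a * v i"
    using dot_snoc[OF ab(1), of l v] dot_snoc[OF ab(2), of l v] dot_snoc[OF ab(2), of "l @ [a]" v]
    by (simp_all add: i_def j_def)
  have le: "real (length l) = real n - 1 \<longleftrightarrow> length l = n - 1" using n_pos by (auto simp: of_nat_diff)
  \<comment> \<open>The program adds a before b, \<open>W\<close> names b first; the sums
    coincide.\<close>
  have sw: "svec n (l @ [b, a]) = svec n (l @ [a, b])" using svec_swap[of l a b "[]"] by simp
  have w: "w = (if slack v (svec n (l @ [b])) = 0 \<and>
        (if i = j then length l = n - 1 else slack v (svec n (l @ [b, a])) = 0)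
     then slack v (svec n (l @ [a])) else 0)"
    by (simp only: W_def Let_def l_def i_def j_def w_def)
  have t: "(\<forall>x\<in>{1..n}. svec n (l @ [a]) x \<in> {-1, 0, 1}) \<and> (\<forall>x\<in>{1..n}. svec n (l @ [b]) x \<in> {-1, 0, 1}) \<and>
    (i \<noteq> j \<longrightarrow> (\<forall>x\<in>{1..n}. svec n (l @ [a, b]) x \<in> {-1, 0, 1}))"
    using svec_ternary c by simp
  note ex = edge_check_def check_rest_def probe_def gs r(3,4) signed_set_at_eq up t[simplified]
    address_facts[OF ij] address_facts[OF ij(2,1)] vector_at_upd(1) scratch_regs same_but_upd_iff
  show ?thesis
    unfolding w_def[symmetric]
  proof (cases "i = j")
    case True
    show "wps edge_check M (\<lambda>M'. same_but (scratch \<union> {16, 19}) M M' \<and> memv M' v \<and> M' 16 = w)"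
      by ((simp (no_asm) add: ex[unfolded True] True
          del: sum_address_simps wp.simps(7)) | rule wp_If
        | (simp add: ex[unfolded True] True w[unfolded True] sw slack_def d[unfolded True] le
          del: sum_address_simps; fail))+
  next
    case False
    show "wps edge_check M (\<lambda>M'. same_but (scratch \<union> {16, 19}) M M' \<and> memv M' v \<and> M' 16 = w)"
      by ((simp (no_asm) add: ex False not_sym[OF False]
          del: sum_address_simps wp.simps(7)) | rule wp_If
        | (simp add: ex False not_sym[OF False] w sw slack_def d le
          del: sum_address_simps; fail))+
  qed
qed

lemma wp_move:
  assumes m: "memv M v" and ab: "a \<in> codes n" "b \<in> codes n"
    and r: "M 5 = real (idx n a)" "M 6 = real (idx n b)" "M 17 = sg n a" "M 18 = sg n b"
  shows "wps move_com M (\<lambda>M'. same_but {21..20 + n} M M' \<and>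
    memv M' (\<lambda>i. v i + M 16 * dvec a b i))"
proof -
  define i j where "i = idx n a" and "j = idx n b"
  have ij: "i \<in> {1..n}" "j \<in> {1..n}" using idx_range ab by (auto simp: i_def j_def)
  have M0: "M 0 = real n" "\<And>k. k \<in> {1..n} \<Longrightarrow> M (20 + k) = v k" using m by (auto simp: memv_def)
  have r': "M 5 = real i" "M 6 = real j" using r by (simp_all add: i_def j_def)
  show ?thesis
  proof (cases "i = j")
    case True
    have "memv (M(20 + j := v j + M 16 * sg n a)) (\<lambda>k. v k + M 16 * dvec a b k)"
      using M0 ij True by (auto simp: memv_def dvec_def unit_def i_def j_def)
    moreover have "same_but {21..20 + n} M (M(20 + j := v j + M 16 * sg n a))"
      by (intro same_but_upd same_but_refl) (use ij in auto)
    ultimately show ?thesis using ij True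
      by (simp add: move_com_def r' r(3,4) M0)
  next
    case False
    let ?N = "M(20 + i := v i + M 16 * sg n a, 20 + j := v j - M 16 * sg n b)"
    have "memv ?N (\<lambda>k. v k + M 16 * dvec a b k)"
      using M0 ij False by (auto simp: memv_def dvec_def unit_def i_def j_def)
    moreover have "same_but {21..20 + n} M ?N"
      by (intro same_but_upd same_but_refl) (use ij in auto)
    ultimately show ?thesis using ij False
      by (simp add: move_com_def r' r(3,4) M0)
  qed
qed

definition edge_time :: nat where
  "edge_time = wc edge_init + (greedy_time + (wc edge_check + wc move_com))"

lemma runs_edge:
  assumes m: "memv M v" and ab: "a \<in> codes n" "b \<in> codes n" and r: "M 3 = real a" "M 4 = real b"
  shows "rns edge_com M [] edge_time
    (\<lambda>M'. same_but work M M' \<and> memv M' (E v a b) \<and> M' 16 = W v a b)"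
proof -
  let ?Q = "\<lambda>M'. same_but work M M' \<and> memv M' (E v a b) \<and> M' 16 = W v a b"
  have sub: "scratch \<subseteq> work" "scratch \<union> {16, 19} \<subseteq> work" "{21..20 + n} \<subseteq> work"
    by (auto simp: scratch_def work_def)
  have M0: "M 0 = real n" using m by (simp add: memv_def)
  define M1 where "M1 = M(5 := real (idx n a), 17 := sg n a, 6 := real (idx n b), 18 := sg n b)"
  have sb1: "same_but work M M1"
    unfolding M1_def by (intro same_but_upd same_but_refl) (auto simp: work_def)
  have m1: "memv M1 v" using m by (simp add: M1_def)
  have r1: "M1 5 = real (idx n a)" "M1 6 = real (idx n b)" "M1 17 = sg n a" "M1 18 = sg n b"
    by (simp_all add: M1_def)
  have c4: "wps move_com M3 ?Q"
    if h: "same_but work M M3" "memv M3 v" "M3 16 = W v a b"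
      "M3 5 = real (idx n a)" "M3 6 = real (idx n b)" "M3 17 = sg n a" "M3 18 = sg n b" for M3
  proof (rule wp_mono[OF wp_move[OF h(2) ab h(4-7)]])
    fix M' assume k: "same_but {21..20 + n} M3 M' \<and> memv M' (\<lambda>i. v i + M3 16 * dvec a b i)"
    then have "same_but work M M'" using same_but_trans[OF h(1) same_but_mono[OF _ sub(3)]] by blast
    moreover have "M' 16 = M3 16" using k by (simp add: same_but_def)
    ultimately show "?Q M'" using k h(3) by (simp add: E_def)
  qed
  have c3: "wps (Seq edge_check move_com) M2 ?Q"
    if h: "same_but scratch M1 M2" "greedy_state M2 v (glist v {idx n a, idx n b})" for M2
    unfolding wp.simps(6)
  proof (rule wp_mono[OF wp_edge_check[OF h(2) ab]])
    show r2: "M2 5 = real (idx n a)" "M2 6 = real (idx n b)" "M2 17 = sg n a" "M2 18 = sg n b"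
      using h(1) r1 by (auto simp: same_but_def scratch_def)
    fix M3 assume k: "same_but (scratch \<union> {16, 19}) M2 M3 \<and> memv M3 v \<and> M3 16 = W v a b"
    show "wps move_com M3 ?Q"
    proof (rule c4)
      show "same_but work M M3"
        using same_but_trans[OF same_but_trans[OF sb1 same_but_mono[OF h(1) sub(1)]] same_but_mono[OF _ sub(2)]] k
        by blast
      show "memv M3 v" "M3 16 = W v a b" using k by auto
      show "M3 5 = real (idx n a)" "M3 6 = real (idx n b)" "M3 17 = sg n a" "M3 18 = sg n b"
        using k r2 by (auto simp: same_but_def scratch_def)
    qed
  qed
  have c2: "rns greedy_com M1 [] greedy_time
      (\<lambda>M2. rns (Seq edge_check move_com) M2 [] (wc edge_check + wc move_com) ?Q)"
  proof (rule runs_mono[OF runs_greedy[OF m1 r1(1,2)] order_refl])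
    fix M2 assume "same_but scratch M1 M2 \<and> greedy_state M2 v (glist v {idx n a, idx n b})"
    then show "rns (Seq edge_check move_com) M2 [] (wc edge_check + wc move_com) ?Q"
      using wp_runs[OF c3[of M2]] by simp
  qed
  have "wps edge_init M (\<lambda>M1. rns (Seq greedy_com (Seq edge_check move_com)) M1 []
      (greedy_time + (wc edge_check + wc move_com)) ?Q)"
    by (rule wp_edge_init[OF M0 r ab]) (use runs_Seq[OF c2] in \<open>simp add: M1_def\<close>)
  from runs_Seq[OF wp_runs[OF this]] show ?thesis
    unfolding edge_com_def edge_time_def by simp
qed

lemma wp_undo:
  assumes m: "memv M (E v a b)" and ab: "a \<in> codes n" "b \<in> codes n" and r: "M 3 = real a" "M 4 = real b"
    "M 16 = W v a b"
  shows "wps undo_com M (\<lambda>M'. same_but work M M' \<and> memv M' v)"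
proof -
  define M1 where "M1 = M(5 := real (idx n a), 17 := sg n a, 6 := real (idx n b), 18 := sg n b, 16 := - W v a b)"
  have M0: "M 0 = real n" using m by (simp add: memv_def)
  have m1: "memv M1 (E v a b)" using m by (simp add: M1_def)
  have sb1: "same_but work M M1"
    unfolding M1_def by (intro same_but_upd same_but_refl) (auto simp: work_def)
  have "wps move_com M1 (\<lambda>M'. same_but work M M' \<and> memv M' v)"
  proof (rule wp_mono[OF wp_move[OF m1 ab]])
    show "M1 5 = real (idx n a)" "M1 6 = real (idx n b)" "M1 17 = sg n a" "M1 18 = sg n b"
      by (simp_all add: M1_def)
    fix M' assume k: "same_but {21..20 + n} M1 M' \<and> memv M' (\<lambda>i. E v a b i + M1 16 * dvec a b i)"
    have "{21..20 + n} \<subseteq> work" by (auto simp: work_def)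
    then have "same_but work M M'" using same_but_trans[OF sb1] same_but_mono k by blast
    moreover have "(\<lambda>i. E v a b i + M1 16 * dvec a b i) = v" by (simp add: E_def M1_def)
    ultimately show "same_but work M M' \<and> memv M' v" using k by simp
  qed
  then have q: "wps (Seq (Set 16 (Sub (Num 0) (R 16))) move_com)
      (M(5 := real (idx n a), 17 := sg n a, 6 := real (idx n b), 18 := sg n b))
      (\<lambda>M'. same_but work M M' \<and> memv M' v)"
    by (simp add: M1_def r)
  show ?thesis
    unfolding undo_com_def wp.simps(6)[of n f space edge_init]
    by (rule wp_edge_init[OF M0 r(1,2) ab]) (rule q)
qed

text \<open>No code has the coordinate 0, so that 0 excludes nothing.\<close>

lemma glist_zero: "glist v {0} = glist v {}"
proof (rule glist_eqI[symmetric, THEN sym])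
  have av: "avail v {0} l y \<longleftrightarrow> avail v {} l y" for l y
    using idx_range[of y n] by (auto simp: avail_def)
  have "greedy_prefix v {0} l" if "greedy_prefix v {} l" for l
    using that by (induction rule: greedy_prefix.induct) (auto intro: greedy_Nil greedy_snoc simp: av)
  then show "greedy v {0} (glist v {})"
    using greedy_glist[of v "{}"] by (simp add: greedy_def av)
qed

definition pair_time :: nat where
  "pair_time = wc (Seq (Set 5 (Num 0)) (Set 6 (Num 0))) + (greedy_time +
     wc last_com)"

lemma runs_pair:
  assumes m: "memv M v" and v: "v \<in> V"
  shows "rns pair_com M [] pair_time (\<lambda>M'. same_but (scratch \<union> {5, 6}) M M' \<and> memv M' v \<and>
    M' 13 = real (fst (pair v)) \<and> M' 14 = real (snd (pair v)))"
proof -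
  let ?Q = "\<lambda>M'. same_but (scratch \<union> {5, 6}) M M' \<and> memv M' v \<and>
    M' 13 = real (fst (pair v)) \<and> M' 14 = real (snd (pair v))"
  define M1 where "M1 = M(5 := 0, 6 := 0::real)"
  have m1: "memv M1 v" using m by (simp add: M1_def)
  have sb1: "same_but (scratch \<union> {5, 6}) M M1"
    unfolding M1_def by (intro same_but_upd same_but_refl) auto
  have fin: "wps last_com M2 ?Q"
    if h: "same_but scratch M1 M2" "greedy_state M2 v (glist v {})" for M2
  proof -
    define l where "l = glist v {}"
    obtain p a b where d: "descent l = (p, a, b)" by (metis prod_cases3)
    have ne: "l \<noteq> []" using glist_nonempty[OF v] by (simp add: l_def)
    then have p: "p = last l" using descent_cases[OF d] by simp
    have pc: "p \<in> codes n" using glist_codes[of p v "{}"] ne p by (simp add: l_def)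
    have g: "M2 12 = real p" "M2 13 = real a" "M2 14 = real b" "memv M2 v" "M2 0 = real n"
      using h(2) d by (simp_all add: greedy_state_def l_def[symmetric] memv_def)
    have pr: "pair v = (if neg n p < p then (p, neg n p) else (a, b))"
      unfolding pair_def l_def[symmetric] Let_def p[symmetric] descent_snoc d by simp
    have np: "neg n p < p \<longleftrightarrow> n < p" using pc by (auto simp: neg_def codes_def)
    have rn: "real (neg n p) = 2 * real n + 1 - real p" using pc by (auto simp: neg_def codes_def of_nat_diff)
    have sb2: "same_but (scratch \<union> {5, 6}) M M2"
      using same_but_trans[OF sb1 same_but_mono[OF h(1)]] by blast
    have "same_but (scratch \<union> {5, 6}) M (M2(13 := x, 14 := y))" for x y
      using sb2 by (intro same_but_upd) (auto simp: scratch_def)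
    then show ?thesis using sb2 g pr np rn by (simp add: last_com_def)
  qed
  have c2: "rns greedy_com M1 [] greedy_time (\<lambda>M2. rns last_com M2 [] (wc last_com) ?Q)"
  proof (rule runs_mono[OF runs_greedy[OF m1, of 0 0] order_refl])
    show "M1 5 = real 0" "M1 6 = real 0" by (simp_all add: M1_def)
    fix M2 assume "same_but scratch M1 M2 \<and> greedy_state M2 v (glist v {0, 0})"
    then show "rns last_com M2 [] (wc last_com) ?Q"
      by (intro wp_runs fin) (simp_all add: glist_zero)
  qed
  have "wps (Seq (Set 5 (Num 0)) (Set 6 (Num 0))) M (\<lambda>M1. rns (Seq greedy_com last_com) M1 []
      (greedy_time + wc last_com) ?Q)"
    using runs_Seq[OF c2] by (simp add: M1_def)
  from runs_Seq[OF wp_runs[OF this]] show ?thesis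
    unfolding pair_com_def pair_time_def by simp
qed

end

section \<open>The traversal on the machine\<close>

definition inc_com :: com where
  "inc_com = Seq (Set 2 (Add (R 2) (Num 1)))
    (If (Less (Mul (Num 2) (R 0)) (R 2)) (Seq (Set 2 (Num 1)) (Set 1 (Add (R 1) (Num 1)))) Skip)"

definition reset_com :: com where
  "reset_com = Seq (Set 1 (Num 1)) (Set 2 (Num 1))"

definition load_com :: com where
  "load_com = Seq (Set 3 (R 1)) (Set 4 (R 2))"

text \<open>Cells 1 and 2 receive the pair of the child, which is its number at the parent, so that
  the search resumes there. Cells 3 and 4 receive it exchanged, for the move to the parent.\<close>

definition swap_com :: com where
  "swap_com = Seq (Set 1 (R 13)) (Seq (Set 2 (R 14)) (Seq (Set 3 (R 14)) (Set 4 (R 13))))"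

definition down_com :: com where
  "down_com = Seq (MoveTo (Num 20)) (Seq (ReportVec (Num 20)) reset_com)"

definition child_test :: test where
  "child_test = And (Eq (R 13) (R 1)) (Eq (R 14) (R 2))"

definition zero_test :: "nat \<Rightarrow> test" where
  "zero_test k = Eq (R k) (Num 0)"

text \<open>The candidate overwrites the current vertex, and its own pair decides whether it is a
  child. If not, the move is undone.\<close>

definition child_com :: com where
  "child_com = Seq load_com (Seq edge_com (If (zero_test 16) inc_com
     (Seq pair_com (If child_test down_com (Seq undo_com inc_com)))))"

definition up_com :: com where
  "up_com = Seq pair_com (If (zero_test 13) (Set 20 (Num 1))
     (Seq swap_com (Seq edge_com (Seq (MoveTo (Num 20)) inc_com))))"

definition more_test :: test where
  "more_test = Not (Less (Mul (Num 2) (R 0)) (R 1))"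

definition step_com :: com where
  "step_com = If more_test child_com up_com"

definition loop_com :: com where
  "loop_com = While (zero_test 20) step_com"

text \<open>The root is computed directly: T runs through the chain 1, ..., n, and consecutive
  answers are subtracted. Cell 11 starts with 0, the value of f at the empty signed set.\<close>

definition init_body :: com where
  "init_body = Seq (Assign (Ta (R 7)) (Num 1)) (Seq Ask
     (Seq (Assign (Va (R 7)) (Sub (R 10) (R 11))) (Seq (Set 11 (R 10)) (Set 7 (Add (R 7) (Num 1))))))"

definition main_com :: com where
  "main_com = Seq (Set 7 (Num 1)) (Seq (While clear_test init_body)
     (Seq down_com loop_com))"

context bisub
begin

definition N :: nat where "N = (2 * n) * (2 * n)"

text \<open>With \<open>cb\<close>, the digits of the candidate number in base 2 n, shifted by 1 to
  become codes. At \<open>N\<close> the first digit reaches 2 n + 1, where \<open>more_test\<close>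
  fails.\<close>

definition ca :: "nat \<Rightarrow> nat" where "ca k = k div (2 * n) + 1"
definition cb :: "nat \<Rightarrow> nat" where "cb k = k mod (2 * n) + 1"

definition child_of :: "rvec \<Rightarrow> nat \<Rightarrow> rvec option" where
  "child_of v k = (if W v (ca k) (cb k) \<noteq> 0 \<and> pair (E v (ca k) (cb k)) = (ca k, cb k)
     then Some (E v (ca k) (cb k)) else None)"

definition key_of :: "rvec \<Rightarrow> nat" where
  "key_of v = (fst (pair v) - 1) * (2 * n) + (snd (pair v) - 1)"

lemma ca_cb_codes: "k < N \<Longrightarrow> ca k \<in> codes n \<and> cb k \<in> codes n"
  using n_pos by (auto simp: N_def ca_def cb_def codes_def less_mult_imp_div_less Suc_le_eq)

lemma ca_N: "ca N = 2 * n + 1"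
  using n_pos by (simp add: ca_def N_def)

lemma key_of_code:
  assumes "a \<in> codes n" "b \<in> codes n" "k = (a - 1) * (2 * n) + (b - 1)"
  shows "k < N" "ca k = a" "cb k = b"
proof -
  have ab: "1 \<le> a" "a \<le> 2 * n" "1 \<le> b" "b \<le> 2 * n" using assms by (auto simp: codes_def)
  have "k < (a - 1) * (2 * n) + 2 * n" using ab assms(3) by simp
  also have "\<dots> = a * (2 * n)" using ab by (cases a) auto
  also have "\<dots> \<le> N" unfolding N_def using ab by (intro mult_le_mono1) simp
  finally show "k < N" .
  obtain a' b' where s: "a = Suc a'" "b = Suc b'" using ab by (cases a; cases b) auto
  then have "k = a' * (2 * n) + b'" "b' < 2 * n" using assms(3) ab by simp_all
  then show "ca k = a" "cb k = b" unfolding ca_def cb_def s by simp_all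
qed

lemma code_of_key: "k < N \<Longrightarrow> (ca k - 1) * (2 * n) + (cb k - 1) = k"
  by (simp only: ca_def cb_def add_diff_cancel_right' div_mult_mod_eq)

sublocale tree: search_tree V "adjacent_pairs P" sink g obj N child_of key_of
proof
  show "finite V" by (rule finite_V)
  show "sink \<in> V" by (rule sink_in_V)
  fix v assume v: "v \<in> V" "v \<noteq> sink"
  obtain a b where ab: "pair v = (a, b)" by fastforce
  note p = parent[OF v ab]
  show "g v \<in> V" "{v, g v} \<in> adjacent_pairs P" "obj v < obj (g v)" using p by auto
  have k: "key_of v = (a - 1) * (2 * n) + (b - 1)" by (simp add: key_of_def ab)
  show "key_of v < N \<and> child_of (g v) (key_of v) = Some v"
    using key_of_code[OF p(1,2) k] p ab by (simp add: child_of_def)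
next
  fix v k u assume v: "v \<in> V" and k: "k < N" and c: "child_of v k = Some u"
  have u: "W v (ca k) (cb k) \<noteq> 0" "pair (E v (ca k) (cb k)) = (ca k, cb k)" "u = E v (ca k) (cb k)"
    using c by (auto simp: child_of_def split: if_splits)
  note ch = child[OF v _ _ u(1,2)]
  show "u \<in> V \<and> u \<noteq> sink \<and> g u = v \<and> key_of u = k"
    using ch ca_cb_codes[OF k] u code_of_key[OF k] by (simp add: key_of_def)
qed

definition rep :: "rvec \<Rightarrow> nat \<Rightarrow> memory \<Rightarrow> bool" where
  "rep v k M \<longleftrightarrow> memv M v \<and> M 20 = 0 \<and> M 1 = real (ca k) \<and> M 2 = real (cb k)"

lemma wp_inc: "rep v k M \<Longrightarrow> wps inc_com M (rep v (Suc k))"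
proof -
  assume r: "rep v k M"
  have M0: "M 0 = real n" "M 1 = real (ca k)" "M 2 = real (cb k)" using r by (simp_all add: rep_def memv_def)
  have c: "2 * real n < real (cb k) + 1 \<longleftrightarrow> Suc (k mod (2 * n)) = 2 * n"
  proof -
    have "k mod (2 * n) < 2 * n" using n_pos by simp
    moreover have "2 * real n < real (cb k) + 1 \<longleftrightarrow> 2 * n < cb k + 1" by linarith
    ultimately show ?thesis by (auto simp: cb_def)
  qed
  show ?thesis
  proof (cases "Suc (k mod (2 * n)) = 2 * n")
    case True
    then have "ca (Suc k) = ca k + 1" "cb (Suc k) = 1" by (simp_all add: ca_def cb_def div_Suc mod_Suc)
    then show ?thesis using r c True M0 by (simp add: inc_com_def rep_def)
  next
    case False
    then have "ca (Suc k) = ca k" "cb (Suc k) = cb k + 1" by (simp_all add: ca_def cb_def div_Suc mod_Suc)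
    then show ?thesis using r c False M0 by (simp add: inc_com_def rep_def)
  qed
qed

lemma wp_reset: "memv M v \<Longrightarrow> M 20 = 0 \<Longrightarrow> wps reset_com M (rep v 0)"
  by (simp add: reset_com_def rep_def ca_def cb_def)

lemma vector_at_V: "memv M v \<Longrightarrow> supported v \<Longrightarrow> vector_at n M 20 = v"
  by (auto simp: vector_at_def memv_def supported_def fun_eq_iff)

lemma V_supported: "v \<in> V \<Longrightarrow> supported v"
  using P_supported V_in_P by blast

lemma runs_MoveTo:
  assumes "memv M v" "v \<in> V" "Q M"
  shows "rns (MoveTo (Num 20)) M [Move v] (n + 2) Q"
proof -
  have "exec n f space (MoveTo (Num 20)) M [Move (vector_at n M (ev M (Num 20)))] (1 + n + cost (Num 20)) M"
    by (rule exec_MoveTo) simp_all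
  then show ?thesis unfolding runs_def using assms vector_at_V[OF assms(1) V_supported[OF assms(2)]]
    by (intro exI[of _ "1 + n + cost (Num 20)"] exI[of _ M]) simp
qed

lemma runs_ReportVec:
  assumes "memv M v" "v \<in> V" "Q M"
  shows "rns (ReportVec (Num 20)) M [Report v] (n + 2) Q"
proof -
  have "exec n f space (ReportVec (Num 20)) M [Report (vector_at n M (ev M (Num 20)))] (1 + n + cost (Num 20)) M"
    by (rule exec_ReportVec) simp_all
  then show ?thesis unfolding runs_def using assms vector_at_V[OF assms(1) V_supported[OF assms(2)]]
    by (intro exI[of _ "1 + n + cost (Num 20)"] exI[of _ M]) simp
qed

definition down_time :: nat where
  "down_time = (n + 2) + ((n + 2) + wc reset_com)"

lemma runs_down:
  assumes "memv M v" "v \<in> V" "M 20 = 0"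
  shows "rns down_com M [Move v, Report v] down_time (rep v 0)"
proof -
  have "rns (ReportVec (Num 20)) M [Report v] (n + 2)
      (\<lambda>M. rns reset_com M [] (wc reset_com) (rep v 0))"
    by (rule runs_ReportVec[OF assms(1,2)]) (rule wp_runs[OF wp_reset[OF assms(1,3)]])
  from runs_Seq[OF this]
  have "rns (Seq (ReportVec (Num 20)) reset_com) M [Report v] ((n + 2) + wc reset_com) (rep v 0)"
    by simp
  then have "rns (MoveTo (Num 20)) M [Move v] (n + 2)
      (\<lambda>M. rns (Seq (ReportVec (Num 20)) reset_com) M [Report v] ((n + 2) + wc reset_com) (rep v 0))"
    by (rule runs_MoveTo[OF assms(1,2)])
  from runs_Seq[OF this] show ?thesis by (simp only: down_com_def down_time_def append.simps)
qed

definition child_time :: nat where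
  "child_time = wc load_com + (edge_time + (cost_test (zero_test 16) + (wc inc_com +
     (pair_time + (cost_test child_test + (down_time + (wc undo_com + wc inc_com)))))))"

definition child_trace :: "rvec \<Rightarrow> nat \<Rightarrow> rvec event list" where
  "child_trace v k = (case child_of v k of None \<Rightarrow> [] | Some u \<Rightarrow> [Move u, Report u])"

definition child_state :: "rvec \<Rightarrow> nat \<Rightarrow> memory \<Rightarrow> bool" where
  "child_state v k = (case child_of v k of None \<Rightarrow> rep v (Suc k) | Some u \<Rightarrow> rep u 0)"

lemma runs_child:
  assumes r: "rep v k M" and v: "v \<in> V" and k: "k < N"
  shows "rns child_com M (child_trace v k) child_time (child_state v k)"
proof -
  define a b where "a = ca k" and "b = cb k"
  have ab: "a \<in> codes n" "b \<in> codes n" using ca_cb_codes[OF k] by (simp_all add: a_def b_def)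
  have m: "memv M v" "M 20 = 0" "M 1 = real a" "M 2 = real b" using r by (simp_all add: rep_def a_def b_def)
  define M1 where "M1 = M(3 := real a, 4 := real b)"
  have m1: "memv M1 v" "M1 3 = real a" "M1 4 = real b" using m by (simp_all add: M1_def)
  let ?I = "If child_test down_com (Seq undo_com inc_com)"
  let ?O = "If (zero_test 16) inc_com (Seq pair_com ?I)"
  let ?T3 = "down_time + (wc undo_com + wc inc_com)"
  let ?T2 = "pair_time + (cost_test child_test + ?T3)"
  let ?t = "child_trace v k" and ?Q = "child_state v k"
  have O: "rns ?O M2 ?t (cost_test (zero_test 16) + (wc inc_com + ?T2)) ?Q"
    if h: "same_but work M1 M2" "memv M2 (E v a b)" "M2 16 = W v a b" for M2
  proof (rule runs_If)
    have keep: "M2 20 = 0" "M2 1 = real a" "M2 2 = real b" "M2 3 = real a" "M2 4 = real b"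
      using h(1) m by (simp_all add: same_but_def work_def M1_def)
    show "legal_test space M2 (zero_test 16)" by (simp add: zero_test_def)
    have z: "holds M2 (zero_test 16) \<longleftrightarrow> W v a b = 0" by (simp add: zero_test_def h(3))
    show "rns inc_com M2 ?t (wc inc_com + ?T2) ?Q" if "holds M2 (zero_test 16)"
    proof -
      have W: "W v a b = 0" using that z by simp
      then have "child_of v k = None" by (simp add: child_of_def a_def b_def)
      moreover have "E v a b = v" using W by (simp add: E_def)
      then have "rep v k M2" using h(2) keep by (simp add: rep_def a_def b_def)
      ultimately show ?thesis
        using runs_mono[OF wp_runs[OF wp_inc]] by (simp add: child_trace_def child_state_def)
    qed
    show "rns (Seq pair_com ?I) M2 ?t (wc inc_com + ?T2) ?Q" if "\<not> holds M2 (zero_test 16)"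
    proof -
      have W: "W v a b \<noteq> 0" using that z by simp
      define u where "u = E v a b"
      have u: "u \<in> V" using move(1)[OF v ab W] by (simp add: u_def)
      have I: "rns ?I M3 ?t (cost_test child_test + ?T3) ?Q"
        if j: "same_but (scratch \<union> {5, 6}) M2 M3" "memv M3 u" "M3 13 = real (fst (pair u))"
          "M3 14 = real (snd (pair u))" for M3
      proof (rule runs_If)
        have keep3: "M3 20 = 0" "M3 1 = real a" "M3 2 = real b" "M3 3 = real a" "M3 4 = real b" "M3 16 = W v a b"
          using j(1) keep h(3) by (simp_all add: same_but_def scratch_def)
        show "legal_test space M3 child_test" by (simp add: child_test_def)
        have ct: "holds M3 child_test \<longleftrightarrow> pair u = (a, b)"
          by (cases "pair u") (simp add: child_test_def j keep3 keep3[unfolded One_nat_def])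
        show "rns down_com M3 ?t ?T3 ?Q" if "holds M3 child_test"
        proof -
          have "child_of v k = Some u" using that ct W by (simp add: child_of_def u_def a_def b_def)
          then show ?thesis using runs_mono[OF runs_down[OF j(2) u keep3(1)]]
            by (simp add: child_trace_def child_state_def)
        qed
        show "rns (Seq undo_com inc_com) M3 ?t ?T3 ?Q" if "\<not> holds M3 child_test"
        proof -
          have c: "child_of v k = None" using that ct by (simp add: child_of_def u_def a_def b_def)
          have "wps undo_com M3 (\<lambda>M4. wps inc_com M4 (rep v (Suc k)))"
          proof (rule wp_mono[OF wp_undo[OF _ ab keep3(4,5,6)]])
            show "memv M3 (E v a b)" using j(2) by (simp add: u_def)
            fix M4 assume q: "same_but work M3 M4 \<and> memv M4 v"
            then have "rep v k M4"
              using keep3 by (simp add: rep_def same_but_def work_def a_def b_def)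
            then show "wps inc_com M4 (rep v (Suc k))" by (rule wp_inc)
          qed
          then have "wps (Seq undo_com inc_com) M3 (rep v (Suc k))" by simp
          from runs_mono[OF wp_runs[OF this]] show ?thesis
            using c by (simp add: child_trace_def child_state_def)
        qed
      qed
      have "rns pair_com M2 [] pair_time (\<lambda>M3. rns ?I M3 ?t (cost_test child_test + ?T3) ?Q)"
        by (rule runs_mono[OF runs_pair[OF h(2)[folded u_def] u] order_refl]) (use I in blast)
      from runs_mono[OF runs_Seq[OF this]] show ?thesis by simp
    qed
  qed
  have "rns edge_com M1 [] edge_time
      (\<lambda>M2. rns ?O M2 ?t (cost_test (zero_test 16) + (wc inc_com + ?T2)) ?Q)"
    by (rule runs_mono[OF runs_edge[OF m1(1) ab m1(2,3)] order_refl]) (use O in blast)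
  from runs_Seq[OF this]
  have "wps load_com M (\<lambda>M1. rns (Seq edge_com ?O) M1 ?t
      (edge_time + (cost_test (zero_test 16) + (wc inc_com + ?T2))) ?Q)"
    using m by (simp add: load_com_def M1_def)
  from runs_Seq[OF wp_runs[OF this]] show ?thesis unfolding child_com_def child_time_def by simp
qed

definition up_time :: nat where
  "up_time = pair_time + (cost_test (zero_test 13) + (wc (Set 20 (Num 1)) +
     (wc swap_com + (edge_time + ((n + 2) + wc inc_com)))))"

lemma runs_up:
  assumes r: "rep v N M" and v: "v \<in> V"
  shows "v \<noteq> sink \<Longrightarrow> rns up_com M [Move (g v)] up_time (rep (g v) (Suc (key_of v)))"
    and "v = sink \<Longrightarrow> rns up_com M [] up_time (\<lambda>M'. M' 20 = 1)"
proof -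
  obtain a b where ab: "pair v = (a, b)" by fastforce
  have m: "memv M v" "M 20 = 0" using r by (simp_all add: rep_def)
  let ?U = "Seq swap_com (Seq edge_com (Seq (MoveTo (Num 20)) inc_com))"
  let ?I = "If (zero_test 13) (Set 20 (Num 1)) ?U"
  let ?T = "wc swap_com + (edge_time + ((n + 2) + wc inc_com))"
  let ?Ti = "wc (Set 20 (Num 1)) + ?T"
  have pr: "rns pair_com M [] pair_time (\<lambda>M'. same_but (scratch \<union> {5, 6}) M M' \<and> memv M' v \<and>
    M' 13 = real a \<and> M' 14 = real b)"
    using runs_pair[OF m(1) v] by (simp add: ab)
  have legal: "legal_test space M' (zero_test 13)" for M' by (simp add: zero_test_def)
  show "rns up_com M [Move (g v)] up_time (rep (g v) (Suc (key_of v)))" if s: "v \<noteq> sink"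
  proof -
    let ?Q = "rep (g v) (Suc (key_of v))"
    note p = parent[OF v s ab]
    have gv: "g v = E v b a" by (simp add: g_def ab)
    have ca: "ca (key_of v) = a" "cb (key_of v) = b"
      using key_of_code[OF p(1,2), of "key_of v"] by (simp_all add: key_of_def ab)
    have I: "rns ?I M1 [Move (g v)] (cost_test (zero_test 13) + ?Ti) ?Q"
      if h: "same_but (scratch \<union> {5, 6}) M M1" "memv M1 v" "M1 13 = real a" "M1 14 = real b" for M1
    proof (rule runs_If[OF legal])
      have "a \<noteq> 0" using p(1) by (auto simp: codes_def)
      then show "rns (Set 20 (Num 1)) M1 [Move (g v)] ?Ti ?Q" if "holds M1 (zero_test 13)"
        using that h(3) by (simp add: zero_test_def)
      define M2 where "M2 = M1(1 := real a, 2 := real b, 3 := real b, 4 := real a)"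
      have m2: "memv M2 v" "M2 3 = real b" "M2 4 = real a" "M2 20 = 0" "M2 1 = real a" "M2 2 = real b"
        using h m(2) by (simp_all add: M2_def same_but_def scratch_def)
      have e: "rns (Seq (MoveTo (Num 20)) inc_com) M3 [Move (g v)] ((n + 2) + wc inc_com) ?Q"
        if j: "same_but work M2 M3" "memv M3 (g v)" for M3
      proof -
        have "rep (g v) (key_of v) M3"
          using j m2 by (simp add: rep_def ca same_but_def work_def)
        then have "rns inc_com M3 [] (wc inc_com) ?Q" by (intro wp_runs wp_inc)
        then have "rns (MoveTo (Num 20)) M3 [Move (g v)] (n + 2)
            (\<lambda>M. rns inc_com M [] (wc inc_com) ?Q)"
          by (rule runs_MoveTo[OF j(2) p(3)])
        from runs_Seq[OF this] show ?thesis by (simp only: append.simps)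
      qed
      have "rns edge_com M2 [] edge_time
          (\<lambda>M3. rns (Seq (MoveTo (Num 20)) inc_com) M3 [Move (g v)] ((n + 2) + wc inc_com) ?Q)"
        by (rule runs_mono[OF runs_edge[OF m2(1) p(2,1) m2(2,3)] order_refl]) (use e gv in auto)
      from runs_Seq[OF this]
      have "wps swap_com M1 (\<lambda>M2. rns (Seq edge_com (Seq (MoveTo (Num 20)) inc_com)) M2
          [Move (g v)] (edge_time + ((n + 2) + wc inc_com)) ?Q)"
        using h by (simp add: swap_com_def M2_def)
      from runs_mono[OF runs_Seq[OF wp_runs[OF this]]]
      show "rns ?U M1 [Move (g v)] ?Ti ?Q" by simp
    qed
    have "rns pair_com M [] pair_time
        (\<lambda>M1. rns ?I M1 [Move (g v)] (cost_test (zero_test 13) + ?Ti) ?Q)"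
      by (rule runs_mono[OF pr order_refl]) (use I in blast)
    from runs_Seq[OF this] show ?thesis unfolding up_com_def up_time_def by simp
  qed
  show "rns up_com M [] up_time (\<lambda>M'. M' 20 = 1)" if s: "v = sink"
  proof -
    let ?Q = "\<lambda>M'::memory. M' 20 = 1"
    have a: "a = 0" using ab s pair_sink by simp
    have I: "rns ?I M1 [] (cost_test (zero_test 13) + ?Ti) ?Q" if h: "M1 13 = real a" for M1
    proof (rule runs_If[OF legal])
      have "wps (Set 20 (Num 1)) M1 ?Q" by simp
      from runs_mono[OF wp_runs[OF this]]
      show "rns (Set 20 (Num 1)) M1 [] ?Ti ?Q" by simp
      show "rns ?U M1 [] ?Ti ?Q" if "\<not> holds M1 (zero_test 13)"
        using that h a by (simp add: zero_test_def)
    qed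
    have "rns pair_com M [] pair_time
        (\<lambda>M1. rns ?I M1 [] (cost_test (zero_test 13) + ?Ti) ?Q)"
      by (rule runs_mono[OF pr order_refl]) (use I in blast)
    from runs_Seq[OF this] show ?thesis unfolding up_com_def up_time_def by simp
  qed
qed

definition step_time :: nat where
  "step_time = cost_test more_test + (child_time + up_time)"

lemma runs_step_child:
  assumes r: "rep v k M" and v: "v \<in> V" and k: "k < N"
  shows "rns step_com M (child_trace v k) step_time (child_state v k)"
  unfolding step_com_def step_time_def
proof (rule runs_If)
  show "legal_test space M more_test" by (simp add: more_test_def)
  have "ca k \<le> 2 * n" using ca_cb_codes[OF k] by (simp add: codes_def)
  then have "holds M more_test" using r by (simp add: more_test_def rep_def memv_def)
  then show "\<not> holds M more_test \<Longrightarrow> rns up_com M (child_trace v k) (child_time + up_time) (child_state v k)"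
    by simp
  show "rns child_com M (child_trace v k) (child_time + up_time) (child_state v k)"
    by (rule runs_mono[OF runs_child[OF assms]]) simp_all
qed

lemma runs_step_up:
  assumes r: "rep v N M" and u: "rns up_com M tr up_time Q"
  shows "rns step_com M tr step_time Q"
  unfolding step_com_def step_time_def
proof (rule runs_If)
  show "legal_test space M more_test" by (simp add: more_test_def)
  have "\<not> holds M more_test" using r by (simp add: more_test_def rep_def memv_def ca_N)
  then show "holds M more_test \<Longrightarrow> rns child_com M tr (child_time + up_time) Q" by simp
  show "rns up_com M tr (child_time + up_time) Q"
    by (rule runs_mono[OF u]) simp_all
qed

definition loop_time :: nat where
  "loop_time = cost_test (zero_test 20) + step_time"

lemma loop_step:
  assumes "rep v k M"
    and "rns step_com M tr step_time (\<lambda>M'. rns loop_com M' tr' T Q)"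
  shows "rns loop_com M (tr @ tr') (loop_time + T) Q"
  unfolding loop_time_def loop_com_def
  by (rule runs_While_step[OF _ _ assms(2)[unfolded loop_com_def]]) (use assms(1) in \<open>simp_all add: zero_test_def rep_def\<close>)

text \<open>Each rule of the abstract search is one iteration of the loop, so m becomes a factor of
  the time. The time T pays for whatever follows the final state.\<close>

lemma runs_dfs:
  assumes "tree.dfs v k tr m w j" "rep v k M"
    and "\<And>M'. rep w j M' \<Longrightarrow> rns loop_com M' [] T Q"
  shows "rns loop_com M tr (m * loop_time + T) Q"
  using assms
proof (induction arbitrary: M rule: tree.dfs.induct)
  case (dfs_refl v k)
  then show ?case by simp
next
  case (dfs_down v k u tr m w j)
  have "rns step_com M [Move u, Report u] step_time
    (\<lambda>M'. rns loop_com M' tr (m * loop_time + T) Q)"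
    using runs_mono[OF runs_step_child[OF dfs_down.prems(1) dfs_down.hyps(1,2)] order_refl]
      dfs_down.IH[OF _ dfs_down.prems(2)] dfs_down.hyps(3)
    by (simp add: child_trace_def child_state_def)
  from loop_step[OF dfs_down.prems(1) this] show ?case by (simp add: add.assoc)
next
  case (dfs_next v k tr m w j)
  have "rns step_com M [] step_time
    (\<lambda>M'. rns loop_com M' tr (m * loop_time + T) Q)"
    using runs_mono[OF runs_step_child[OF dfs_next.prems(1) dfs_next.hyps(1,2)] order_refl]
      dfs_next.IH[OF _ dfs_next.prems(2)] dfs_next.hyps(3)
    by (simp add: child_trace_def child_state_def)
  from loop_step[OF dfs_next.prems(1) this] show ?case by (simp add: add.assoc)
next
  case (dfs_up v tr m w j)
  have "rns step_com M [Move (g v)] step_time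
    (\<lambda>M'. rns loop_com M' tr (m * loop_time + T) Q)"
    by (rule runs_step_up[OF dfs_up.prems(1)],
        rule runs_mono[OF runs_up(1)[OF dfs_up.prems(1) dfs_up.hyps(1,2)] order_refl])
      (rule dfs_up.IH[OF _ dfs_up.prems(2)])
  from loop_step[OF dfs_up.prems(1) this] show ?case by (simp add: add.assoc)
qed

lemma runs_stop:
  assumes "rep sink N M"
  shows "rns loop_com M [] (loop_time + cost_test (zero_test 20)) (\<lambda>_. True)"
proof -
  have "rns step_com M [] step_time
      (\<lambda>M'. rns loop_com M' [] (cost_test (zero_test 20)) (\<lambda>_. True))"
  proof (rule runs_step_up[OF assms], rule runs_mono[OF runs_up(2)[OF assms sink_in_V refl] order_refl])
    fix M' :: memory assume "M' 20 = 1"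
    then show "rns loop_com M' [] (cost_test (zero_test 20)) (\<lambda>_. True)"
      unfolding loop_com_def by (intro runs_While_stop) (simp_all add: zero_test_def)
  qed
  from loop_step[OF assms this] show ?thesis by simp
qed

end

section \<open>Constants of the time bound\<close>

definition greedy_const :: nat where
  "greedy_const = wc (Set 7 (Num 1)) + 2 * (wc clear_body + cost_test clear_test) + wc scan_init +
     6 * (wc scan_body + cost_test scan_test)"

text \<open>Both kinds of step are added up: two moves, two pairs and three announcements of a
  vector, each taking n + 2 \<le> 3 n^2 units, which gives the 9.\<close>

definition step_const :: nat where
  "step_const = (cost_test more_test + cost_test (zero_test 16) + cost_test (zero_test 13) +
     cost_test child_test + cost_test (zero_test 20) + wc load_com + 3 * wc inc_com + wc undo_com +
     wc reset_com + wc (Set 20 (Num 1)) + wc swap_com) + 9 +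
     2 * (wc edge_init + greedy_const + wc edge_check + wc move_com) +
     2 * (wc (Seq (Set 5 (Num 0)) (Set 6 (Num 0))) + greedy_const +
       wc last_com)"

text \<open>The 6 pays for the two announcements of the root, the 5 comes from \<open>N + 1\<close>
  = 4 n^2 + 1 \<le> 5 n^2.\<close>

definition main_const :: nat where
  "main_const = wc (Set 7 (Num 1)) + 2 * (wc init_body + cost_test clear_test) + 6 + wc reset_com +
     cost_test (zero_test 20) + 5 * step_const"

lemma le_square: "n \<ge> 1 \<Longrightarrow> (c::nat) \<le> c * n ^ 2" "n \<ge> 1 \<Longrightarrow> n \<le> n ^ 2" for n :: nat
  by (simp_all add: power2_eq_square)

context bisub
begin

text \<open>The factors 2 and 6 of the constant come from n + 1 \<le> 2 n^2 and 2 n^2 + 3 n + 1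
  \<le> 6 n^2.\<close>

lemma greedy_time_le: "greedy_time \<le> greedy_const * n ^ 2"
proof -
  have "n + 1 \<le> 2 * n ^ 2" using le_square(2)[OF n_pos] n_pos by linarith
  then have 1: "(n + 1) * (wc clear_body + cost_test clear_test) \<le> 2 * n ^ 2 * (wc clear_body + cost_test clear_test)"
    by (rule mult_le_mono1)
  have "n * (2 * n + 1) + 2 * n + 1 \<le> 6 * n ^ 2"
  proof -
    have "n * (2 * n + 1) + 2 * n + 1 = 2 * n ^ 2 + 3 * n + 1"
      by (simp add: power2_eq_square algebra_simps)
    then show ?thesis using le_square(2)[OF n_pos] n_pos by linarith
  qed
  then have 2: "scan_time (n * (2 * n + 1) + 2 * n) \<le> 6 * n ^ 2 * (wc scan_body + cost_test scan_test)"
    unfolding scan_time_def by (rule mult_le_mono1)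
  have "greedy_time \<le> wc (Set 7 (Num 1)) * n ^ 2 + 2 * n ^ 2 * (wc clear_body + cost_test clear_test) +
      wc scan_init * n ^ 2 + 6 * n ^ 2 * (wc scan_body + cost_test scan_test)"
    unfolding greedy_time_def by (intro add_mono 1 2 le_square(1) n_pos)
  also have "\<dots> = greedy_const * n ^ 2" unfolding greedy_const_def by (simp only: distrib_right distrib_left mult_ac add_ac)
  finally show ?thesis .
qed

lemma loop_time_le: "loop_time \<le> step_const * n ^ 2"
proof -
  let ?q = "n ^ 2"
  define ce where "ce = wc edge_init + greedy_const + wc edge_check + wc move_com"
  define cp where "cp = wc (Seq (Set 5 (Num 0)) (Set 6 (Num 0))) + greedy_const + wc last_com"
  have sq: "c \<le> c * ?q" for c by (rule le_square(1)[OF n_pos])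
  have e: "edge_time \<le> ce * ?q"
  proof -
    have "edge_time \<le> wc edge_init * ?q + (greedy_const * ?q + (wc edge_check * ?q + wc move_com * ?q))"
      unfolding edge_time_def by (intro add_mono sq greedy_time_le)
    then show ?thesis by (simp only: ce_def distrib_right add_ac)
  qed
  have p: "pair_time \<le> cp * ?q"
  proof -
    have "pair_time \<le> wc (Seq (Set 5 (Num 0)) (Set 6 (Num 0))) * ?q + (greedy_const * ?q + wc last_com * ?q)"
      unfolding pair_time_def by (intro add_mono sq greedy_time_le)
    then show ?thesis by (simp only: cp_def distrib_right add_ac)
  qed
  have n2: "n + 2 \<le> 3 * ?q" using le_square(2)[OF n_pos] n_pos by linarith
  define c where "c = cost_test more_test + cost_test (zero_test 16) + cost_test (zero_test 13) +
     cost_test child_test + cost_test (zero_test 20) + wc load_com + 3 * wc inc_com + wc undo_com +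
     wc reset_com + wc (Set 20 (Num 1)) + wc swap_com"
  have "loop_time = c + 3 * (n + 2) + 2 * edge_time + 2 * pair_time"
    unfolding loop_time_def step_time_def child_time_def up_time_def down_time_def c_def by simp
  also have "\<dots> \<le> c * ?q + 3 * (3 * ?q) + 2 * (ce * ?q) + 2 * (cp * ?q)"
    by (intro add_mono sq mult_le_mono order_refl n2 e p)
  also have "\<dots> = step_const * ?q"
    unfolding step_const_def ce_def[symmetric] cp_def[symmetric] c_def[symmetric] by (simp add: algebra_simps)
  finally show ?thesis .
qed

lemma runs_init:
  "rns (While clear_test init_body) ((initial_memory n)(7 := 1)) []
    ((n + 1) * (wc init_body + cost_test clear_test)) (\<lambda>M'. memv M' sink \<and> M' 20 = 0)"
proof -
  define F where "F i = f (signed_set_of n (svec n [1..<i]))" for i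
  define Inv where "Inv k M' \<longleftrightarrow> M' 0 = real n \<and> M' 20 = 0 \<and>
    (\<exists>i. M' 7 = real i \<and> 1 \<le> i \<and> i \<le> n + 1 \<and> k = n + 1 - i \<and> memT M' (svec n [1..<i]) \<and>
      M' 11 = F i \<and> (\<forall>j. 1 \<le> j \<and> j < i \<longrightarrow> M' (20 + j) = sink j))" for k M'
  have "signed_set_of n (svec n [1..<1]) = ({}, {})" by (simp add: signed_set_of_def)
  then have "F 1 = 0" using f_empty by (simp only: F_def)
  then have "Inv n ((initial_memory n)(7 := 1))" unfolding Inv_def
    by (intro conjI exI[of _ 1]) (simp_all add: initial_memory_def memT_def)
  then have "rns (While clear_test init_body) ((initial_memory n)(7 := 1)) []
    ((n + 1) * (wc init_body + cost_test clear_test))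
    (\<lambda>M'. (\<exists>k. Inv k M') \<and> \<not> holds M' clear_test)"
  proof (rule runs_While)
    fix k M' assume I: "Inv k M'"
    then obtain i where M': "M' 0 = real n" "M' 20 = 0" "M' 7 = real i" "1 \<le> i" "i \<le> n + 1"
      "k = n + 1 - i" "memT M' (svec n [1..<i])" "M' 11 = F i" "\<forall>j. 1 \<le> j \<and> j < i \<longrightarrow> M' (20 + j) = sink j"
      unfolding Inv_def by blast
    show "legal_test space M' clear_test" by (simp add: clear_test_def)
    assume "holds M' clear_test"
    then have i: "i \<le> n" by (simp add: clear_test_def M')
    then have i': "i \<in> {1..n}" using M' by simp
    have u: "[1..<i + 1] = [1..<i] @ [i]" using M'(4) by simp
    have "code_list n [1..<i + 1]" using i by (rule upt_codes)
    then have c: "code_list n ([1..<i] @ [i])" by (simp only: u)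
    then have ni: "idx n i \<notin> idx n ` set [1..<i]" by (simp only: code_list_snoc not_False_eq_True)
    have y: "idx n i = i" "sg n i = 1" using i by (simp_all add: idx_def sg_def)
    have up: "(svec n [1..<i])(i := 1) = svec n [1..<i + 1]"
      using svec_notin[OF ni] unfolding u by (simp add: fun_eq_iff svec_snoc unit_def y del: upt.simps upt_Suc)
    have T: "vector_at n M' (20 + real n) = svec n [1..<i]"
      using M'(7) memT_svec[of "[1..<i]"] c by (simp add: code_list_snoc)
    define S S' where "S = svec n [1..<i]" and "S' = svec n [1..<i + 1]"
    have SS: "S(i := 1) = S'" using up by (simp only: S_def S'_def)
    have FS: "f (signed_set_of n S') = F (i + 1)" by (simp only: F_def S'_def)
    have t: "\<forall>x\<in>{1..n}. S' x = - 1 \<or> S' x = 0 \<or> S' x = 1"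
      using svec_ternary[OF c] by (simp only: S'_def u)
    note af = address_facts[OF i' i']
    define M5 where "M5 = M'(20 + n + i := 1, 10 := F (i + 1), 20 + i := F (i + 1) - F i,
      11 := F (i + 1), 7 := real i + 1)"
    have s: "F (i + 1) - F i = sink i" using i' by (simp add: sink_def F_def)
    have "memT M5 S'"
      using M'(7) up i' unfolding S'_def up[symmetric] by (auto simp: M5_def memT_def)
    moreover have "M5 (20 + j) = sink j" if "1 \<le> j \<and> j < i + 1" for j
      using that s i' M'(9) by (cases "j = i") (simp_all add: M5_def)
    moreover have "M5 0 = real n" "M5 20 = 0" "M5 7 = real (i + 1)" "M5 11 = F (i + 1)"
      using M' i' by (simp_all add: M5_def)
    ultimately have "Inv (n + 1 - (i + 1)) M5" unfolding Inv_def S'_def using i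
      by (intro conjI exI[of _ "i + 1"]) simp_all
    moreover have "n + 1 - (i + 1) < k" using i M' by simp
    ultimately have g: "\<exists>k'<k. Inv k' M5" by (intro exI[of _ "n + 1 - (i + 1)"] conjI)
    show "wps init_body M' (\<lambda>M''. \<exists>k'<k. Inv k' M'')"
      using g unfolding M5_def by (simp add: init_body_def M'(1,3,8) T[folded S_def] af vector_at_upd(1)
        signed_set_at_eq SS FS t[simplified] del: sum_address_simps)
  qed
  then show ?thesis
  proof (rule runs_mono)
    show "(n + 1) * (wc init_body + cost_test clear_test) \<le> (n + 1) * (wc init_body + cost_test clear_test)" ..
    fix M' assume A: "(\<exists>k. Inv k M') \<and> \<not> holds M' clear_test"
    then have h: "\<not> holds M' clear_test" by (rule conjunct2)
    obtain k where "Inv k M'" using conjunct1[OF A] by (rule exE)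
    then have I: "M' 0 = real n" "M' 20 = 0"
      "\<exists>i. M' 7 = real i \<and> (\<forall>j. 1 \<le> j \<and> j < i \<longrightarrow> M' (20 + j) = sink j)"
      unfolding Inv_def by blast+
    from I(3) obtain i where i: "M' 7 = real i \<and> (\<forall>j. 1 \<le> j \<and> j < i \<longrightarrow> M' (20 + j) = sink j)" ..
    note M' = I(1,2) conjunct1[OF i] conjunct2[OF i]
    have "n < i" using h by (simp add: clear_test_def M')
    then show "memv M' sink \<and> M' 20 = 0" using M' by (auto simp: memv_def)
  qed
qed

text \<open>The loop makes (N + 1) |V| iterations of O(n^2) units each; the initial phase is linear
  in n and is absorbed since V is nonempty.\<close>

lemma runs_main:
  obtains tr where "rns main_com (initial_memory n) tr (main_const * (n ^ 4 * card V)) (\<lambda>_. True)"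
    "reverse_search tree.adj sink g tr" "distinct (reported tr)" "set (reported tr) = V"
proof -
  obtain tr m where t: "tree.dfs sink 0 tr m sink N"
    "reverse_search tree.adj sink g (Move sink # Report sink # tr)"
    "distinct (reported (Move sink # Report sink # tr))" "set (reported (Move sink # Report sink # tr)) = V"
    "m + 1 = (N + 1) * card V"
    by (rule tree.dfs_all)
  let ?Q = "\<lambda>_::memory. True"
  let ?L = "m * loop_time + (loop_time + cost_test (zero_test 20))"
  have "rns (Seq down_com loop_com) M ([Move sink, Report sink] @ tr) (down_time + ?L) ?Q"
    if h: "memv M sink \<and> M 20 = 0" for M
  proof (rule runs_Seq, rule runs_mono[OF runs_down[OF _ sink_in_V] order_refl])
    show "memv M sink" "M 20 = 0" using h by simp_all
    fix M' assume r: "rep sink 0 M'"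
    show "rns loop_com M' tr ?L ?Q"
      by (rule runs_dfs[OF t(1) r runs_stop])
  qed
  then have "rns (While clear_test init_body) ((initial_memory n)(7 := 1)) []
    ((n + 1) * (wc init_body + cost_test clear_test)) (\<lambda>M'. runs n f space
      (Seq down_com loop_com) M' ([Move sink, Report sink] @ tr) (down_time + ?L) ?Q)"
    by (rule runs_mono[OF runs_init order_refl])
  from runs_Seq[OF this]
  have "wps (Set 7 (Num 1)) (initial_memory n) (\<lambda>M'. runs n f space
      (Seq (While clear_test init_body) (Seq down_com loop_com)) M'
      ([Move sink, Report sink] @ tr) ((n + 1) * (wc init_body + cost_test clear_test) + (down_time + ?L)) ?Q)"
    by simp
  from runs_Seq[OF wp_runs[OF this]]
  have r: "rns main_com (initial_memory n) (Move sink # Report sink # tr)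
      (wc (Set 7 (Num 1)) + ((n + 1) * (wc init_body + cost_test clear_test) + (down_time + ?L))) ?Q"
    unfolding main_com_def by simp
  let ?q = "n ^ 4 * card V"
  have "card V \<ge> 1" using finite_V sink_in_V by (metis One_nat_def Suc_leI card_gt_0_iff empty_iff)
  then have q1: "n ^ 4 * 1 \<le> ?q" by (rule mult_le_mono2)
  have n4: "1 \<le> n ^ 4" "n \<le> n ^ 4" using n_pos by (simp_all add: numeral_eq_Suc)
  have sq: "c \<le> c * ?q" for c using q1 n4 by (metis (no_types, lifting) mult.right_neutral mult_le_mono2 order_trans)
  have nq: "n + 1 \<le> 2 * ?q" "n + 2 \<le> 3 * ?q" using q1 n4 by linarith+
  have N: "N + 1 \<le> 5 * n ^ 2" using le_square(1)[OF n_pos, of 1] by (simp add: N_def power2_eq_square)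
  have "m * loop_time + loop_time = (m + 1) * loop_time" by simp
  also have "\<dots> = (N + 1) * card V * loop_time" by (simp only: t(5))
  also have "\<dots> \<le> 5 * n ^ 2 * card V * (step_const * n ^ 2)"
    by (intro mult_le_mono N loop_time_le order_refl)
  also have "\<dots> = 5 * step_const * ?q"
  proof -
    have "n ^ 4 = n ^ 2 * n ^ 2" by (simp flip: power_add)
    then show ?thesis by (simp only: mult_ac)
  qed
  finally have L: "m * loop_time + loop_time \<le> 5 * step_const * ?q" .
  have "wc (Set 7 (Num 1)) + ((n + 1) * (wc init_body + cost_test clear_test) + (down_time + ?L)) =
      wc (Set 7 (Num 1)) + (n + 1) * (wc init_body + cost_test clear_test) + 2 * (n + 2) + wc reset_com +
      cost_test (zero_test 20) + (m * loop_time + loop_time)"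
    unfolding down_time_def by simp
  also have "\<dots> \<le> wc (Set 7 (Num 1)) * ?q + 2 * ?q * (wc init_body + cost_test clear_test) + 2 * (3 * ?q) +
      wc reset_com * ?q + cost_test (zero_test 20) * ?q + 5 * step_const * ?q"
    by (intro add_mono sq mult_le_mono nq order_refl L)
  also have "\<dots> = main_const * ?q" unfolding main_const_def by (simp only: distrib_right distrib_left mult_ac add_ac)
  finally have le: "wc (Set 7 (Num 1)) + ((n + 1) * (wc init_body + cost_test clear_test) + (down_time + ?L))
    \<le> main_const * ?q" .
  have "rns main_com (initial_memory n) (Move sink # Report sink # tr) (main_const * ?q) ?Q"
    by (rule runs_mono[OF r le]) simp
  then show ?thesis using t(2-4) by (rule that)
qed

end

theorem theorem3p3:
  shows "\<exists>(prog :: com) (C :: nat). \<forall>(n :: nat) (f :: signed_set \<Rightarrow> real).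
    n \<ge> 1 \<longrightarrow> bisubmodular n f \<longrightarrow> f ({}, {}) = 0 \<longrightarrow>
    (let P = bisub_polyhedron n f; V = vertices P; E = adjacent_pairs P in
      \<exists>s g adj tr time space M'.
        local_search_function V E s g \<and> neighbour_lists V E adj \<and>
        exec n f space prog (initial_memory n) tr time M' \<and>
        reverse_search adj s g tr \<and>
        distinct (reported tr) \<and> set (reported tr) = V \<and>
        time \<le> C * (n ^ 4 * card V) \<and> space \<le> C * n ^ 2)"
proof (intro exI[of _ main_com] exI[of _ "main_const + 23"] allI impI)
  fix n :: nat and f :: "signed_set \<Rightarrow> real"
  assume "n \<ge> 1" "bisubmodular n f" "f ({}, {}) = 0"
  then interpret bisub n f by unfold_locales
  obtain tr where r: "rns main_com (initial_memory n) tr (main_const * (n ^ 4 * card V)) (\<lambda>_. True)"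
    "reverse_search tree.adj sink g tr" "distinct (reported tr)" "set (reported tr) = V"
    by (rule runs_main)
  then obtain t M' where e: "exec n f space main_com (initial_memory n) tr t M'"
    "t \<le> main_const * (n ^ 4 * card V)" unfolding runs_def by blast
  have "main_const * (n ^ 4 * card V) \<le> (main_const + 23) * (n ^ 4 * card V)" by (rule mult_le_mono1) simp
  then have "t \<le> (main_const + 23) * (n ^ 4 * card V)" using e(2) by (rule order_trans[rotated])
  moreover have "space \<le> (main_const + 23) * n ^ 2"
  proof -
    \<comment> \<open>The memory has 21 + 2 n cells, and n is at least 1; this is the origin of the
      23.\<close>
    have "space \<le> 23 * n ^ 2" using le_square(2)[OF n_pos] n_pos by linarith
    also have "\<dots> \<le> (main_const + 23) * n ^ 2" by (rule mult_le_mono1) simp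
    finally show ?thesis .
  qed
  ultimately show "let P = bisub_polyhedron n f; V = vertices P; E = adjacent_pairs P in
      \<exists>s g adj tr time space M'.
        local_search_function V E s g \<and> neighbour_lists V E adj \<and>
        exec n f space main_com (initial_memory n) tr time M' \<and>
        reverse_search adj s g tr \<and>
        distinct (reported tr) \<and> set (reported tr) = V \<and>
        time \<le> (main_const + 23) * (n ^ 4 * card V) \<and> space \<le> (main_const + 23) * n ^ 2"
    unfolding Let_def P_def[symmetric] V_def[symmetric]
    using tree.local_search tree.neighbour_lists e(1) r(2-4) by blast
qed

end
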